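(* Let $p>1$. Let $s,q,V:\mathbb{R}^3\to(0,\infty)$ and $g:\mathbb{R}^3\to\mathbb{R}$ satisfy, with $\mathrm{Rg}(g)=g(\mathbb{R}^3)$: - $g\in W^{1,1}_{loc}(\mathbb{R}^3)$ is continuous and $\nabla g\neq 0$ a.e. on $\mathbb{R}^3$; - $|\nabla g(x)|=G(g(x))$ for a.e. $x\in\mathbb{R}^3$, where $G:\mathrm{Rg}(g)\to(0,\infty)$ is continuous and $\inf_{\mathrm{Rg}(g)}G>0$; - $s(x)=\tilde s(g(x))$, $q(x)=\tilde q(g(x))$, $V(x)=\tilde V(g(x))$ with $\tilde s,\tilde q,\tilde V:\mathrm{Rg}(g)\to(0,\infty)$ continuous. Put $\sigma(x)=\sqrt{q(x)/s(x)}$ and $\tau(x)=\bigl(q(x)/V(x)\bigr)^{1/(p-1)}$, and suppose additionally that - $\sigma_\infty:=\lim_{|x|\to\infty}\sigma(x)$ exists in $(0,\infty)$ and $\sup_{x\in\mathbb{R}^3}|\sigma(x)-\sigma_\infty|e^{\delta|x|}<\infty$ for some $\delta>0$; - $\sup_{\mathbb{R}^3}\tau<\infty$. Let $\omega:=\sigma_\infty$ and $T:=\frac{2\pi}{\omega}$. (i) If $\sigma\le\sigma_\infty$ on $\mathbb{R}^3$ and $\sigma\not\equiv\sigma_\infty$, then there exists a $T$-periodic $\mathbb{R}^3$-valued weak solution $U\not\equiv0$ of $$s(x)\partial_t^2U+\nabla\times\nabla\times U+q(x)U+V(x)|U|^{p-1}U=0,\qquad (x,t)\in\mathbb{R}^3\times\mathbb{R},$$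 which is spatially exponentially localized w.r.t. $U_\infty=0$. Moreover, for every continuous function $a:\mathbb{R}\to\mathbb{R}$ the phase-shifted function $U_a(x,t)=U(x,t+a(g(x)))$ is again a $T$-periodic weak solution of this equation which is spatially exponentially localized w.r.t. $0$. (ii) If $\sigma\ge\sigma_\infty$ on $\mathbb{R}^3$ and $\sigma\not\equiv\sigma_\infty$, then there exists a $T$-periodic $\mathbb{R}^3$-valued weak solution $U\not\equiv0$ of $$s(x)\partial_t^2U+\nabla\times\nabla\times U+q(x)U-V(x)|U|^{p-1}U=0,\qquad (x,t)\in\mathbb{R}^3\times\mathbb{R},$$ which is spatially exponentially localized w.r.t. $U_\infty=0$. Moreover, for every continuous function $a:\mathbb{R}\to\mathbb{R}$ the phase-shifted function $U_a(x,t)=U(x,t+a(g(x)))$ is again a $T$-periodic weak solution of this equation which is spatially exponentially localized w.r.t. $0$.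
   Context: Spatial exponential localization: for a vector field $U_\infty:\mathbb{R}^3\times\mathbb{R}\to\mathbb{R}^3$, a function $U:\mathbb{R}^3\times\mathbb{R}\to\mathbb{R}^3$ is spatially exponentially localized w.r.t. $U_\infty$ if there exists $\delta>0$ such that $\sup\{|U(x,t)-U_\infty(x,t)|e^{\delta|x|}:(x,t)\in\mathbb{R}^3\times\mathbb{R}\}<\infty$. For open $\Omega\subset\mathbb{R}^3$, $H_{\rm curl}(\Omega)$ is the space of $L^2(\Omega)^3$ vector fields whose distributional curl lies in $L^2(\Omega)^3$. Weak solution: for $-\infty\le T_1<T_2\le+\infty$, a function $U:(T_1,T_2)\to L^\infty_{loc}(\mathbb{R}^3)^3$ with $U\in L^2((T_1,T_2);H_{\rm curl}(B))\cap H^2((T_1,T_2);L^2(B)^3)$ for every open ball $B\subset\mathbb{R}^3$ is a weak solution of $s\,\partial_t^2U+\nabla\times\nabla\times U+qU\pm V|U|^{p-1}U=0$ on $(T_1,T_2)$ if for a.a. $t\in(T_1,T_2)$ $$\int_{\mathbb{R}^3}\Bigl(s(x)\partial_t^2U(x,t)\cdot v+\nabla\times U(x,t)\cdot\nabla\times v+\bigl(q(x)U(x,t)\pm V(x)|U(x,t)|^{p-1}U(x,t)\bigr)\cdot v\Bigr)dx=0$$ for all $v\in H_{\rm curl}(\mathbb{R}^3)$ with compact support. Periodicity: for finite $T_1<T_2$ with $T=T_2-T_1$, a weak solution $U$ on $(T_1,T_2)$ is $T$-periodic if $U(\cdot,T_1)=U(\cdot,T_2)$ and $\partial_tU(\cdot,T_1)=\partial_tU(\cdot,T_2)$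 in the sense of equality of traces in $L^2(B)^3$ for every open ball $B\subset\mathbb{R}^3$; $U$ is then identified with its $T$-periodic extension to $t\in\mathbb{R}$. *)

theory Defs
  imports "HOL-Analysis.Analysis"
begin

type_synonym vfield = "real^3 \<Rightarrow> real^3"


subsection \<open>Test functions, weak gradient and weak curl\<close>

primrec C_k :: "nat \<Rightarrow> ('a::real_normed_vector \<Rightarrow> 'b::real_normed_vector) \<Rightarrow> bool" where
  "C_k 0 f \<longleftrightarrow> continuous_on UNIV f"
| "C_k (Suc k) f \<longleftrightarrow>
     (\<forall>x. f differentiable (at x)) \<and> (\<forall>h. C_k k (\<lambda>x. frechet_derivative f (at x) h))"

definition test_function ::
  "'a::real_normed_vector set \<Rightarrow> ('a \<Rightarrow> 'b::real_normed_vector) \<Rightarrow> bool" where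
  "test_function \<Omega> \<phi> \<longleftrightarrow>
     (\<forall>k. C_k k \<phi>) \<and> compact (closure {x. \<phi> x \<noteq> 0}) \<and> closure {x. \<phi> x \<noteq> 0} \<subseteq> \<Omega>"

definition locally_integrable ::
  "(real^3) set \<Rightarrow> (real^3 \<Rightarrow> 'b::euclidean_space) \<Rightarrow> bool" where
  "locally_integrable \<Omega> f \<longleftrightarrow> (\<forall>K. compact K \<and> K \<subseteq> \<Omega> \<longrightarrow> f absolutely_integrable_on K)"

definition partial :: "3 \<Rightarrow> (real^3 \<Rightarrow> real) \<Rightarrow> real^3 \<Rightarrow> real" where
  "partial i f x = frechet_derivative f (at x) (axis i 1)"

definition classical_curl :: "vfield \<Rightarrow> vfield" where
  "classical_curl \<phi> x = vector
     [partial 2 (\<lambda>y. \<phi> y $ 3) x - partial 3 (\<lambda>y. \<phi> y $ 2) x,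
      partial 3 (\<lambda>y. \<phi> y $ 1) x - partial 1 (\<lambda>y. \<phi> y $ 3) x,
      partial 1 (\<lambda>y. \<phi> y $ 2) x - partial 2 (\<lambda>y. \<phi> y $ 1) x]"

definition has_weak_gradient :: "(real^3) set \<Rightarrow> (real^3 \<Rightarrow> real) \<Rightarrow> vfield \<Rightarrow> bool" where
  "has_weak_gradient \<Omega> f w \<longleftrightarrow>
     locally_integrable \<Omega> f \<and> locally_integrable \<Omega> w \<and>
     (\<forall>\<phi>. test_function \<Omega> \<phi> \<longrightarrow> (\<forall>i.
        (LINT x|lebesgue_on \<Omega>. f x * partial i \<phi> x) = - (LINT x|lebesgue_on \<Omega>. w x $ i * \<phi> x)))"

definition W11_loc :: "(real^3) set \<Rightarrow> (real^3 \<Rightarrow> real) set" where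
  "W11_loc \<Omega> = {f. \<exists>w. has_weak_gradient \<Omega> f w}"

definition has_weak_curl :: "(real^3) set \<Rightarrow> vfield \<Rightarrow> vfield \<Rightarrow> bool" where
  "has_weak_curl \<Omega> u w \<longleftrightarrow>
     locally_integrable \<Omega> u \<and> locally_integrable \<Omega> w \<and>
     (\<forall>\<phi>. test_function \<Omega> \<phi> \<longrightarrow>
        (LINT x|lebesgue_on \<Omega>. u x \<bullet> classical_curl \<phi> x) = (LINT x|lebesgue_on \<Omega>. w x \<bullet> \<phi> x))"

text \<open>On an open set weak gradients and weak curls are unique up to null sets; the operators below
  pick a representative and are meaningful only where a weak derivative exists.\<close>

definition weak_gradient :: "(real^3) set \<Rightarrow> (real^3 \<Rightarrow> real) \<Rightarrow> vfield" where
  "weak_gradient \<Omega> f = (SOME w. has_weak_gradient \<Omega> f w)"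

definition weak_curl :: "(real^3) set \<Rightarrow> vfield \<Rightarrow> vfield" where
  "weak_curl \<Omega> u = (SOME w. has_weak_curl \<Omega> u w)"


subsection \<open>Spaces of vector fields\<close>

text \<open>The spaces are sets of representatives, with seminorms instead of norms.\<close>

definition L2 :: "(real^3) set \<Rightarrow> vfield set" where
  "L2 \<Omega> = {u. u \<in> borel_measurable (lebesgue_on \<Omega>) \<and>
              integrable (lebesgue_on \<Omega>) (\<lambda>x. (norm (u x))\<^sup>2)}"

definition L2_norm :: "(real^3) set \<Rightarrow> vfield \<Rightarrow> real" where
  "L2_norm \<Omega> u = sqrt (LINT x|lebesgue_on \<Omega>. (norm (u x))\<^sup>2)"

definition H_curl :: "(real^3) set \<Rightarrow> vfield set" where
  "H_curl \<Omega> = {u \<in> L2 \<Omega>. \<exists>w \<in> L2 \<Omega>. has_weak_curl \<Omega> u w}"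

definition H_curl_norm :: "(real^3) set \<Rightarrow> vfield \<Rightarrow> real" where
  "H_curl_norm \<Omega> u = sqrt ((L2_norm \<Omega> u)\<^sup>2 + (L2_norm \<Omega> (weak_curl \<Omega> u))\<^sup>2)"

definition Linf_loc :: "vfield set" where
  "Linf_loc = {u. u \<in> borel_measurable lebesgue \<and>
     (\<forall>K. compact K \<longrightarrow> (\<exists>C. AE x in lebesgue. x \<in> K \<longrightarrow> norm (u x) \<le> C))}"

definition compactly_supported :: "vfield \<Rightarrow> bool" where
  "compactly_supported v \<longleftrightarrow> (\<exists>K. compact K \<and> (AE x in lebesgue. x \<notin> K \<longrightarrow> v x = 0))"


subsection \<open>Functions of time with values in a seminormed space of vector fields\<close>

text \<open>Here \<open>X\<close> is the space and \<open>N\<close> its seminorm. Because equality in \<open>X\<close> is only up to null sets,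
  the Bochner notions of the library do not apply; the following definitions copy them,
  with \<open>N\<close> in place of the norm.\<close>

definition bochner_measurable ::
  "vfield set \<Rightarrow> (vfield \<Rightarrow> real) \<Rightarrow> real set \<Rightarrow> (real \<Rightarrow> vfield) \<Rightarrow> bool" where
  "bochner_measurable X N I f \<longleftrightarrow>
     (\<exists>S. (\<forall>n::nat. simple_function (lebesgue_on I) (S n) \<and> (\<forall>t\<in>I. S n t \<in> X)) \<and>
          (AE t in lebesgue_on I. (\<lambda>n. N (\<lambda>x. S n t x - f t x)) \<longlonglongrightarrow> 0))"

definition bochner_L2 ::
  "vfield set \<Rightarrow> (vfield \<Rightarrow> real) \<Rightarrow> real set \<Rightarrow> (real \<Rightarrow> vfield) set" where
  "bochner_L2 X N I = {f.
     (AE t in lebesgue_on I. f t \<in> X) \<and> bochner_measurable X N I f \<and>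
     integrable (lebesgue_on I) (\<lambda>t. (N (f t))\<^sup>2)}"

definition simple_integral_field :: "real set \<Rightarrow> (real \<Rightarrow> vfield) \<Rightarrow> vfield" where
  "simple_integral_field I S x = (\<Sum>v \<in> S ` I. measure lebesgue {t \<in> I. S t = v} *\<^sub>R v x)"

definition has_bochner_integral_field ::
  "vfield set \<Rightarrow> (vfield \<Rightarrow> real) \<Rightarrow> real set \<Rightarrow> (real \<Rightarrow> vfield) \<Rightarrow> vfield \<Rightarrow> bool" where
  "has_bochner_integral_field X N I f v \<longleftrightarrow>
     v \<in> X \<and> (AE t in lebesgue_on I. f t \<in> X) \<and> bochner_measurable X N I f \<and>
     (\<exists>S. (\<forall>n::nat. simple_function (lebesgue_on I) (S n) \<and> (\<forall>t\<in>I. S n t \<in> X) \<and>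
                    emeasure lebesgue {t \<in> I. S n t \<noteq> (\<lambda>x. 0)} < \<infinity>) \<and>
          (\<lambda>n. \<integral>\<^sup>+ t. ennreal (N (\<lambda>x. S n t x - f t x)) \<partial>lebesgue_on I) \<longlonglongrightarrow> 0 \<and>
          (\<lambda>n. N (\<lambda>x. simple_integral_field I (S n) x - v x)) \<longlonglongrightarrow> 0)"

abbreviation L2_L2 :: "real set \<Rightarrow> (real^3) set \<Rightarrow> (real \<Rightarrow> vfield) set" where
  "L2_L2 I \<Omega> \<equiv> bochner_L2 (L2 \<Omega>) (L2_norm \<Omega>) I"

abbreviation L2_H_curl :: "real set \<Rightarrow> (real^3) set \<Rightarrow> (real \<Rightarrow> vfield) set" where
  "L2_H_curl I \<Omega> \<equiv> bochner_L2 (H_curl \<Omega>) (H_curl_norm \<Omega>) I"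

definition has_weak_dt ::
  "real set \<Rightarrow> (real^3) set \<Rightarrow> (real \<Rightarrow> vfield) \<Rightarrow> (real \<Rightarrow> vfield) \<Rightarrow> bool" where
  "has_weak_dt I \<Omega> f f' \<longleftrightarrow> f \<in> L2_L2 I \<Omega> \<and> f' \<in> L2_L2 I \<Omega> \<and>
     (\<forall>\<phi>::real \<Rightarrow> real. test_function I \<phi> \<longrightarrow>
        (\<exists>v. has_bochner_integral_field (L2 \<Omega>) (L2_norm \<Omega>) I (\<lambda>t x. deriv \<phi> t *\<^sub>R f t x) v \<and>
             has_bochner_integral_field (L2 \<Omega>) (L2_norm \<Omega>) I (\<lambda>t x. \<phi> t *\<^sub>R f' t x) (\<lambda>x. - v x)))"

text \<open>\<open>f\<close> lies in \<open>H\<^sup>2(I; L\<^sup>2(\<Omega>)\<^sup>3)\<close> iff there is some \<open>f''\<close> with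
  \<open>has_weak_dt2 I \<Omega> f f''\<close>; then \<open>f''\<close> is unique up to null sets.\<close>

definition has_weak_dt2 ::
  "real set \<Rightarrow> (real^3) set \<Rightarrow> (real \<Rightarrow> vfield) \<Rightarrow> (real \<Rightarrow> vfield) \<Rightarrow> bool" where
  "has_weak_dt2 I \<Omega> f f'' \<longleftrightarrow> (\<exists>f'. has_weak_dt I \<Omega> f f' \<and> has_weak_dt I \<Omega> f' f'')"

text \<open>The trace at \<open>t\<^sub>0 \<in> [T\<^sub>1,T\<^sub>2]\<close> is the value at \<open>t\<^sub>0\<close> of the representative
  in \<open>C([T\<^sub>1,T\<^sub>2]; L\<^sup>2(\<Omega>)\<^sup>3)\<close>.\<close>

definition has_trace ::
  "real \<Rightarrow> real \<Rightarrow> (real^3) set \<Rightarrow> (real \<Rightarrow> vfield) \<Rightarrow> real \<Rightarrow> vfield \<Rightarrow> bool" where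
  "has_trace T\<^sub>1 T\<^sub>2 \<Omega> f t\<^sub>0 w \<longleftrightarrow>
     (\<exists>h. (\<forall>t\<in>{T\<^sub>1..T\<^sub>2}. h t \<in> L2 \<Omega>) \<and>
          (\<forall>t\<in>{T\<^sub>1..T\<^sub>2}.
             ((\<lambda>r. L2_norm \<Omega> (\<lambda>x. h r x - h t x)) \<longlongrightarrow> 0) (at t within {T\<^sub>1..T\<^sub>2})) \<and>
          (AE t in lebesgue_on {T\<^sub>1<..<T\<^sub>2}. AE x in lebesgue_on \<Omega>. h t x = f t x) \<and>
          h t\<^sub>0 = w)"


subsection \<open>Weak solutions\<close>

text \<open>Weak solutions of \<open>s \<partial>\<^sub>t\<^sup>2U + \<nabla>\<times>\<nabla>\<times>U + qU + W|U|\<^sup>p\<^sup>-\<^sup>1U = 0\<close>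
  on \<open>(T\<^sub>1,T\<^sub>2)\<close>; the two signs in front of the nonlinearity correspond to \<open>W = V\<close> and \<open>W = -V\<close>.
  Second time derivatives on the individual balls agree on overlaps, so a single field \<open>Utt\<close> serves
  for all of them. The library integral of a non-integrable function is 0, whence
  \<open>has_bochner_integral\<close>.\<close>

definition weak_solution ::
  "real \<Rightarrow> (real^3 \<Rightarrow> real) \<Rightarrow> (real^3 \<Rightarrow> real) \<Rightarrow> (real^3 \<Rightarrow> real) \<Rightarrow>
   ereal \<Rightarrow> ereal \<Rightarrow> (real^3 \<Rightarrow> real \<Rightarrow> real^3) \<Rightarrow> bool" where
  "weak_solution p s q W T\<^sub>1 T\<^sub>2 U \<longleftrightarrow>
     T\<^sub>1 < T\<^sub>2 \<and>
     (\<forall>t \<in> einterval T\<^sub>1 T\<^sub>2. (\<lambda>x. U x t) \<in> Linf_loc) \<and>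
     (\<forall>c r. (\<lambda>t x. U x t) \<in> L2_H_curl (einterval T\<^sub>1 T\<^sub>2) (ball c r)) \<and>
     (\<exists>Utt.
       (\<forall>c r. has_weak_dt2 (einterval T\<^sub>1 T\<^sub>2) (ball c r) (\<lambda>t x. U x t) Utt) \<and>
       (AE t in lebesgue_on (einterval T\<^sub>1 T\<^sub>2).
          \<forall>v. v \<in> H_curl UNIV \<and> compactly_supported v \<longrightarrow>
            has_bochner_integral lebesgue
              (\<lambda>x. (s x *\<^sub>R Utt t x) \<bullet> v x
                   + weak_curl UNIV (\<lambda>y. U y t) x \<bullet> weak_curl UNIV v x
                   + (q x *\<^sub>R U x t + (W x * norm (U x t) powr (p - 1)) *\<^sub>R U x t) \<bullet> v x)
              0))"

definition periodic_weak_solution_on ::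
  "real \<Rightarrow> (real^3 \<Rightarrow> real) \<Rightarrow> (real^3 \<Rightarrow> real) \<Rightarrow> (real^3 \<Rightarrow> real) \<Rightarrow>
   real \<Rightarrow> real \<Rightarrow> (real^3 \<Rightarrow> real \<Rightarrow> real^3) \<Rightarrow> bool" where
  "periodic_weak_solution_on p s q W T\<^sub>1 T\<^sub>2 U \<longleftrightarrow>
     weak_solution p s q W (ereal T\<^sub>1) (ereal T\<^sub>2) U \<and>
     (\<forall>c r. \<exists>w. has_trace T\<^sub>1 T\<^sub>2 (ball c r) (\<lambda>t x. U x t) T\<^sub>1 w \<and>
                has_trace T\<^sub>1 T\<^sub>2 (ball c r) (\<lambda>t x. U x t) T\<^sub>2 w) \<and>
     (\<forall>c r. \<exists>Ut w. has_weak_dt {T\<^sub>1<..<T\<^sub>2} (ball c r) (\<lambda>t x. U x t) Ut \<and>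
                   has_trace T\<^sub>1 T\<^sub>2 (ball c r) Ut T\<^sub>1 w \<and>
                   has_trace T\<^sub>1 T\<^sub>2 (ball c r) Ut T\<^sub>2 w)"

text \<open>A periodic weak solution on an interval of length \<open>T\<close>, identified with its \<open>T\<close>-periodic
  extension to all times.  For such an extension the choice of the interval is immaterial.\<close>

definition periodic_weak_solution ::
  "real \<Rightarrow> (real^3 \<Rightarrow> real) \<Rightarrow> (real^3 \<Rightarrow> real) \<Rightarrow> (real^3 \<Rightarrow> real) \<Rightarrow>
   real \<Rightarrow> (real^3 \<Rightarrow> real \<Rightarrow> real^3) \<Rightarrow> bool" where
  "periodic_weak_solution p s q W T U \<longleftrightarrow>
     (\<forall>x t. U x (t + T) = U x t) \<and>
     (\<forall>T\<^sub>1 T\<^sub>2. T\<^sub>2 - T\<^sub>1 = T \<longrightarrow> periodic_weak_solution_on p s q W T\<^sub>1 T\<^sub>2 U)"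

definition exp_localized ::
  "(real^3 \<Rightarrow> real \<Rightarrow> real^3) \<Rightarrow> (real^3 \<Rightarrow> real \<Rightarrow> real^3) \<Rightarrow> bool" where
  "exp_localized U Uinf \<longleftrightarrow>
     (\<exists>\<delta>>0. bdd_above (range (\<lambda>(x, t). norm (U x t - Uinf x t) * exp (\<delta> * norm x))))"

end

theory Submission
  imports Defs
begin

text \<open>
  Write \<open>n = \<nabla>g / |\<nabla>g|\<close>. Any field \<open>U(x,t) = f(g(x),t) n(x)\<close> with \<open>f\<close> continuous is curl-free: since
  \<open>|\<nabla>g| = G(g)\<close>, it equals \<open>(f(\<cdot>,t)/G)(g) \<nabla>g\<close>, the gradient of a function of \<open>g\<close>. Inserted into the
  equation, such a field leaves no spatial derivative at all, and because all coefficients are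
  functions of \<open>g\<close>, the equation holds as soon as for every value \<open>y\<close> of \<open>g\<close> the function \<open>f(y,\<cdot>)\<close>
  solves the ordinary differential equation \<open>s f'' + q f \<plusminus> V |f|\<^sup>p\<^sup>-\<^sup>1 f = 0\<close>. A phase shift depending
  on \<open>y\<close> does no harm to this, which is why the shifted fields are solutions too.

  With \<open>f(y,t) = \<tau> |\<beta>|\<^sup>1\<^sup>/\<^sup>(\<^sup>p\<^sup>-\<^sup>1\<^sup>) z(\<sigma> t)\<close> the ordinary differential equation becomes
  \<open>z'' + z + \<beta> |z|\<^sup>p\<^sup>-\<^sup>1 z = 0\<close>, \<open>z(0) = 1\<close>, \<open>z'(0) = 0\<close>, where the sign of \<open>\<beta>\<close> is the sign in front of
  \<open>V\<close>. For every \<open>\<beta> > -1\<close> this solution is periodic, and its period decreases strictly and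
  continuously from \<open>\<infinity>\<close> to \<open>0\<close> with value \<open>2\<pi>\<close> at \<open>\<beta> = 0\<close>. Hence \<open>\<beta>\<close> can be chosen as a continuous
  function of \<open>\<sigma>\<close> so that the period is \<open>2\<pi>\<sigma>/\<sigma>\<^sub>\<infinity>\<close>, which is \<open>T\<close> in the variable \<open>t\<close>; the
  condition \<open>\<sigma> \<le> \<sigma>\<^sub>\<infinity>\<close> or \<open>\<sigma> \<ge> \<sigma>\<^sub>\<infinity>\<close> is what gives \<open>\<beta>\<close> the right sign. Finally \<open>|\<beta>|\<close> is bounded by a
  multiple of \<open>|\<sigma> - \<sigma>\<^sub>\<infinity>|\<close>, so the amplitude inherits the exponential decay of \<open>\<sigma> - \<sigma>\<^sub>\<infinity>\<close>.

  Two ingredients carry the analysis. \<open>composite_gradient_curl_free\<close> is the statement that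
  \<open>f(g) \<nabla>g\<close> is curl-free for a merely continuous Sobolev function \<open>g\<close>; it rests on the chain rule
  \<open>weak_gradient_chain_rule\<close> and on the symmetry of second derivatives. The oscillator is solved
  by an angle variable (\<open>oscillation'_derivative\<close>, \<open>stiffness\<close>, \<open>abs_stiffness_le\<close>). For
  curl-free fields the Bochner-space conditions on \<open>U\<close> all follow from one property, uniform
  continuity in time on compact sets (\<open>tame\<close>): step functions in time then converge uniformly on
  balls.
\<close>

section \<open>Smooth functions\<close>

lemma C_k_SucI:
  assumes "\<And>x. (f has_derivative f' x) (at x)" "\<And>h. C_k k (\<lambda>x. f' x h)"
  shows "C_k (Suc k) f"
proof -
  have "frechet_derivative f (at x) = f' x" for x
    using frechet_derivative_at[OF assms(1)[of x]] by simp
  then show ?thesis using assms by (auto simp: differentiable_def)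
qed

lemma C_k_has_derivative:
  "C_k (Suc k) f \<Longrightarrow> (f has_derivative frechet_derivative f (at x)) (at x)"
  by (simp add: frechet_derivative_works[symmetric])

text \<open>Differentiability of the higher-order derivatives makes the lower-order ones continuous; the product
  rule below needs this descent, as one factor there is differentiated once less than the other.\<close>

lemma C_k_SucD: "C_k (Suc k) f \<Longrightarrow> C_k k f"
proof (induction k arbitrary: f)
  case 0
  then show ?case
    by (auto intro!: continuous_at_imp_continuous_on differentiable_imp_continuous_within)
next
  case (Suc k)
  then show ?case by (metis C_k.simps(2))
qed

lemma C_k_const: "C_k k (\<lambda>x. c)"
  by (induction k arbitrary: c) (auto intro!: C_k_SucI[where f'="\<lambda>x h. 0"])

lemma C_k_bounded_linear:
  assumes "bounded_linear L" shows "C_k k L"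
proof (cases k)
  case 0 then show ?thesis using assms by (simp add: linear_continuous_on)
next
  case (Suc j)
  then show ?thesis using assms
    by (auto intro!: C_k_SucI[where f'="\<lambda>x. L"] C_k_const bounded_linear_imp_has_derivative simp del: C_k.simps)
qed

lemma C_k_add: "C_k k f \<Longrightarrow> C_k k g \<Longrightarrow> C_k k (\<lambda>x. f x + g x)"
proof (induction k arbitrary: f g)
  case 0 then show ?case by (auto intro: continuous_on_add)
next
  case (Suc k)
  show ?case
    by (rule C_k_SucI[where f'="\<lambda>x h. frechet_derivative f (at x) h + frechet_derivative g (at x) h"])
       (use Suc in \<open>auto intro!: has_derivative_add C_k_has_derivative simp del: C_k.simps(2)\<close>, simp_all)
qed

lemma C_k_linear_compose:
  assumes "bounded_linear L" shows "C_k k f \<Longrightarrow> C_k k (\<lambda>x. L (f x))"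
proof (induction k arbitrary: f)
  case 0 then show ?case using assms
    by (auto intro: bounded_linear.continuous_on)
next
  case (Suc k)
  show ?case
    by (rule C_k_SucI[where f'="\<lambda>x h. L (frechet_derivative f (at x) h)"])
      (use Suc in \<open>auto intro!: bounded_linear.has_derivative[OF assms] C_k_has_derivative simp del: C_k.simps(2)\<close>, simp)
qed

lemma C_k_scaleR:
  fixes f :: "'a::real_normed_vector \<Rightarrow> real"
  shows "C_k k f \<Longrightarrow> C_k k g \<Longrightarrow> C_k k (\<lambda>x. f x *\<^sub>R g x)"
proof (induction k arbitrary: f g)
  case 0 then show ?case by (auto intro: continuous_intros)
next
  case (Suc k)
  have "C_k k (\<lambda>x. f x *\<^sub>R frechet_derivative g (at x) h + frechet_derivative f (at x) h *\<^sub>R g x)" for h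
    by (intro C_k_add Suc.IH) (use Suc.prems C_k_SucD in \<open>auto\<close>)
  then show ?case
    by (intro C_k_SucI[where f'="\<lambda>x h. f x *\<^sub>R frechet_derivative g (at x) h + frechet_derivative f (at x) h *\<^sub>R g x"])
       (use Suc.prems in \<open>auto intro!: has_derivative_scaleR C_k_has_derivative simp del: C_k.simps(2)\<close>)
qed

lemma C_k_mult:
  fixes f g :: "'a::real_normed_vector \<Rightarrow> real"
  shows "C_k k f \<Longrightarrow> C_k k g \<Longrightarrow> C_k k (\<lambda>x. f x * g x)"
  using C_k_scaleR[of k f g] by simp

lemma C_k_diff:
  fixes f g :: "'a::real_normed_vector \<Rightarrow> 'b::real_normed_vector"
  assumes "C_k k f" "C_k k g" shows "C_k k (\<lambda>x. f x - g x)"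
  using C_k_add[OF assms(1) C_k_linear_compose[OF bounded_linear_minus[OF bounded_linear_ident] assms(2)]] by simp

lemma C_k_shift: "C_k k f \<Longrightarrow> C_k k (\<lambda>x. f (x + c))"
proof (induction k arbitrary: f)
  case 0 then show ?case by (auto intro!: continuous_on_compose2[of UNIV f] continuous_intros)
next
  case (Suc k)
  have "((\<lambda>x. f (x + c)) has_derivative frechet_derivative f (at (x + c))) (at x)" for x
    using has_derivative_compose[OF _ C_k_has_derivative[OF Suc.prems], of "\<lambda>x. x + c" "\<lambda>h. h" x UNIV]
    by (simp add: has_derivative_add_const)
  then show ?case
    by (intro C_k_SucI) (use Suc in \<open>auto\<close>)
qed

lemma C_k_real_polynomial_function: "real_polynomial_function P \<Longrightarrow> C_k k P"
  by (induction rule: real_polynomial_function.induct)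
     (auto intro: C_k_bounded_linear C_k_const C_k_add C_k_mult)

text \<open>The factor \<open>t\<^sup>-\<^sup>n\<close> makes the family closed under differentiation, so that smoothness of \<open>exp (-1/t)\<close>,
  extended by zero, needs a single derivative computation.\<close>

definition flat :: "nat \<Rightarrow> real \<Rightarrow> real" where
  "flat n t = (if t > 0 then exp (- (1 / t)) / t ^ n else 0)"

lemma flat_tendsto_0: "(flat n \<longlongrightarrow> 0) (at 0)"
proof -
  have "((\<lambda>t::real. inverse t ^ n / exp (inverse t)) \<longlongrightarrow> 0) (at_right 0)"
    by (rule filterlim_compose[OF tendsto_power_div_exp_0 filterlim_inverse_at_top_right])
  moreover have "\<forall>\<^sub>F t in at_right 0. inverse t ^ n / exp (inverse t) = flat n t"
    by (rule eventually_at_rightI[of 0 1]) (auto simp: flat_def exp_minus field_simps)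
  ultimately have "(flat n \<longlongrightarrow> 0) (at_right 0)"
    by (rule Lim_transform_eventually)
  moreover have "(flat n \<longlongrightarrow> 0) (at_left 0)"
    by (rule tendsto_eventually, rule eventually_at_leftI[of "-1"]) (auto simp: flat_def)
  ultimately show ?thesis by (simp add: filterlim_split_at)
qed

lemma flat_has_derivative:
  "(flat n has_real_derivative (flat (n + 2) t - n * flat (n + 1) t)) (at t)"
proof -
  consider "t > 0" | "t < 0" | "t = 0" by linarith
  then show ?thesis
  proof cases
    case 1
    have "((\<lambda>t. exp (- (1 / t)) / t ^ n) has_real_derivative (flat (n + 2) t - n * flat (n + 1) t)) (at t)"
    proof (cases n)
      case 0
      then show ?thesis
        using 1 by (auto intro!: derivative_eq_intros simp: flat_def field_simps power2_eq_square)
    next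
      case (Suc m)
      have "t * t ^ (m - 1) = t ^ m" if "m > 0"
        using that by (cases m) auto
      then show ?thesis
        using 1 Suc by (cases "m = 0") (auto intro!: derivative_eq_intros simp: flat_def field_simps power2_eq_square)
    qed
    then show ?thesis
      by (rule has_field_derivative_transform_within_open[where S="{0<..}"])
         (use 1 in \<open>auto simp: flat_def\<close>)
  next
    case 2
    have "((\<lambda>t. 0::real) has_real_derivative (flat (n + 2) t - n * flat (n + 1) t)) (at t)"
      using 2 by (auto simp: flat_def)
    then show ?thesis
      by (rule has_field_derivative_transform_within_open[where S="{..<0}"])
         (use 2 in \<open>auto simp: flat_def\<close>)
  next
    case 3
    have "((\<lambda>h. (flat n (0 + h) - flat n 0) / h) \<longlongrightarrow> 0) (at 0)"
      by (rule Lim_transform_eventually[OF flat_tendsto_0[of "n+1"]])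
         (auto simp: flat_def eventually_at_filter)
    then show ?thesis using 3 by (simp add: DERIV_def flat_def)
  qed
qed

definition bump :: "nat \<Rightarrow> 'a::real_inner \<Rightarrow> real \<Rightarrow> 'a \<Rightarrow> real" where
  "bump n c R x = flat n (R\<^sup>2 - (x - c) \<bullet> (x - c))"

lemma C_k_bump: "C_k k (bump n c R)"
proof (induction k arbitrary: n)
  let ?f' = "\<lambda>n x h. (bump (n + 2) c R x - n * bump (n + 1) c R x) * (- (2 * (h \<bullet> (x - c))))"
  have der: "(bump n c R has_derivative ?f' n x) (at x)" for n x
  proof -
    have "((\<lambda>x. R\<^sup>2 - (x - c) \<bullet> (x - c)) has_derivative (\<lambda>h. - (2 * (h \<bullet> (x - c))))) (at x)"
      by (auto intro!: derivative_eq_intros simp: inner_commute)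
    from has_derivative_compose[OF this flat_has_derivative[unfolded has_field_derivative_def]]
    show ?thesis unfolding bump_def .
  qed
  { case 0
    show ?case using der
      by (auto intro!: continuous_at_imp_continuous_on has_derivative_continuous) }
  { case (Suc k)
    have "C_k k (\<lambda>x. - (2 * (h \<bullet> (x - c))))" for h
    proof -
      have "C_k k (\<lambda>x. - (2 * (h \<bullet> x)) + 2 * (h \<bullet> c))"
        by (intro C_k_add C_k_const C_k_bounded_linear)
           (auto intro!: bounded_linear_minus bounded_linear_const_mult bounded_linear_inner_right)
      then show ?thesis by (simp add: inner_diff_right algebra_simps)
    qed
    then show ?case
      by (intro C_k_SucI[OF der] C_k_mult C_k_diff Suc.IH C_k_const) auto }
qed

lemma bump_pos_iff: 
  assumes "R > 0" shows "0 < bump n c R x \<longleftrightarrow> x \<in> ball c R"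
proof -
  have "(x - c) \<bullet> (x - c) < R\<^sup>2 \<longleftrightarrow> x \<in> ball c R"
    using assms by (simp add: dist_norm norm_minus_commute power2_norm_eq_inner[symmetric] abs_le_square_iff[symmetric] flip: not_le)
  then show ?thesis by (auto simp: bump_def flat_def)
qed

lemma bump_nonneg: "0 \<le> bump n c R x"
  by (simp add: bump_def flat_def)

lemma bump_eq_0_iff: "R > 0 \<Longrightarrow> bump n c R x = 0 \<longleftrightarrow> x \<notin> ball c R"
  using bump_pos_iff[of R n c x] bump_nonneg[of n c R x] by linarith

lemma bump_0_le_1: "bump 0 c R x \<le> 1"
  by (simp add: bump_def flat_def)

text \<open>The bump \<open>b\<close> is positive exactly on the open ball of radius \<open>R\<close> and \<open>f\<close> vanishes outside a
  smaller one, so \<open>f / b\<close> is continuous. If a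
  polynomial \<open>P\<close> approximates it by Stone-Weierstrass, then \<open>b P\<close> is smooth, supported in the
  ball and close to \<open>f\<close>, as \<open>b \<le> 1\<close>.\<close>

lemma smooth_dense:
  fixes f :: "'a::euclidean_space \<Rightarrow> real"
  assumes cont: "continuous_on UNIV f" and supp: "\<And>x. f x \<noteq> 0 \<Longrightarrow> x \<in> cball c r"
    and r: "r < R" "0 < R" and e: "e > 0"
  obtains \<phi> where "\<And>k. C_k k \<phi>" "\<And>x. \<phi> x \<noteq> 0 \<Longrightarrow> x \<in> cball c R" "\<And>x. \<bar>\<phi> x - f x\<bar> \<le> e"
proof -
  let ?b = "bump 0 c R"
  have bcont: "continuous_on UNIV ?b" using C_k_bump[of 0 0 c R] by simp
  have "continuous_on (ball c R) (\<lambda>x. f x / ?b x)"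
    by (intro continuous_on_divide continuous_on_subset[OF cont] continuous_on_subset[OF bcont])
       (auto simp: bump_eq_0_iff[OF r(2)])
  moreover have "continuous_on (- cball c r) (\<lambda>x. f x / ?b x)"
  proof (rule continuous_on_eq[where f="\<lambda>x. 0"])
    show "0 = f x / ?b x" if "x \<in> - cball c r" for x
      using supp[of x] that by (cases "f x = 0") auto
  qed simp
  ultimately have "continuous_on (ball c R \<union> - cball c r) (\<lambda>x. f x / ?b x)"
    by (intro continuous_on_open_Un) auto
  then have "continuous_on (cball c R) (\<lambda>x. f x / ?b x)"
    by (rule continuous_on_subset) (use r in auto)
  then obtain P where P: "real_polynomial_function P"
      "\<And>x. x \<in> cball c R \<Longrightarrow> \<bar>f x / ?b x - P x\<bar> < e"
    using Stone_Weierstrass_real_polynomial_function[OF compact_cball _ e, of c R "\<lambda>x. f x / ?b x"] by blast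
  show ?thesis
  proof
    show "C_k k (\<lambda>x. ?b x * P x)" for k
      by (intro C_k_mult C_k_bump C_k_real_polynomial_function P)
    show "x \<in> cball c R" if "?b x * P x \<noteq> 0" for x
      using that by (auto simp: bump_eq_0_iff[OF r(2)])
    show "\<bar>?b x * P x - f x\<bar> \<le> e" for x
    proof (cases "x \<in> ball c R")
      case True
      then have b: "0 < ?b x" using bump_pos_iff[OF r(2), of 0 c x] by simp
      then have "?b x * P x - f x = - (?b x * (f x / ?b x - P x))"
        by (simp add: right_diff_distrib)
      then have "\<bar>?b x * P x - f x\<bar> = ?b x * \<bar>f x / ?b x - P x\<bar>"
        using b by (simp add: abs_mult)
      also have "\<dots> \<le> 1 * e"
        using P(2)[of x] True b bump_0_le_1[of c R x] by (intro mult_mono) auto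
      finally show ?thesis by simp
    next
      case False
      then have "f x = 0" using supp[of x] r by (cases "f x = 0") auto
      moreover have "?b x = 0" using False by (simp add: bump_eq_0_iff[OF r(2)])
      ultimately show ?thesis using e by simp
    qed
  qed
qed

section \<open>Pairing locally integrable functions with test functions\<close>

lemma LINT_lebesgue_on_eq:
  fixes F :: "'a::euclidean_space \<Rightarrow> 'b::euclidean_space"
  assumes "S \<in> sets lebesgue" "\<And>x. x \<notin> S \<Longrightarrow> F x = 0"
  shows "(LINT x|lebesgue_on S. F x) = (LINT x|lebesgue. F x)"
proof -
  have "(LINT x|lebesgue_on S. F x) = (LINT x|lebesgue. indicator S x *\<^sub>R F x)"
    using assms(1) by (intro integral_restrict_space) auto
  also have "\<dots> = (LINT x|lebesgue. F x)"
    by (intro Bochner_Integration.integral_cong refl) (use assms(2) in \<open>auto simp: indicator_def\<close>)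
  finally show ?thesis .
qed

lemma continuous_imp_lebesgue_measurable:
  "continuous_on UNIV f \<Longrightarrow> f \<in> borel_measurable lebesgue"
  using borel_measurable_continuous_onI[of f] by (simp add: measurable_completion)

lemma continuous_compact_support_bounded:
  fixes f :: "'a::euclidean_space \<Rightarrow> real"
  assumes "compact K" "continuous_on UNIV f" "\<And>x. f x \<noteq> 0 \<Longrightarrow> x \<in> K"
  obtains B where "B \<ge> 0" "\<And>x. \<bar>f x\<bar> \<le> B"
proof -
  have "bounded (f ` K)"
    using assms by (intro compact_imp_bounded compact_continuous_image) (auto intro: continuous_on_subset)
  then obtain B where "B > 0" "\<And>x. x \<in> K \<Longrightarrow> \<bar>f x\<bar> \<le> B" by (auto simp: bounded_pos)
  then show ?thesis using that[of B] assms(3) by (metis abs_zero less_imp_le)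
qed

lemma integrable_mult_compact_support:
  fixes f g :: "'a::euclidean_space \<Rightarrow> real"
  assumes f: "f absolutely_integrable_on K" and K: "compact K"
    and g: "continuous_on UNIV g" "\<And>x. g x \<noteq> 0 \<Longrightarrow> x \<in> K"
  shows "integrable lebesgue (\<lambda>x. f x * g x)"
proof -
  obtain B where B: "B \<ge> 0" "\<And>x. \<bar>g x\<bar> \<le> B"
    using continuous_compact_support_bounded[OF K g] by blast
  have g_meas: "g \<in> borel_measurable lebesgue"
    using borel_measurable_continuous_onI[OF g(1)] by (simp add: measurable_completion)
  have int: "integrable lebesgue (\<lambda>x. indicator K x * f x)"
    using f by (simp add: set_integrable_def)
  have "integrable lebesgue (\<lambda>x. (indicator K x * f x) * g x)"
  proof (rule Bochner_Integration.integrable_bound)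
    show "integrable lebesgue (\<lambda>x. B * (indicator K x * f x))" using int by simp
    show "(\<lambda>x. (indicator K x * f x) * g x) \<in> borel_measurable lebesgue"
      using int g_meas by (auto intro!: borel_measurable_times)
    show "AE x in lebesgue. norm ((indicator K x * f x) * g x) \<le> norm (B * (indicator K x * f x))"
      using B by (auto simp: abs_mult mult.commute intro!: mult_mono AE_I2)
  qed
  moreover have "(indicator K x * f x) * g x = f x * g x" for x
    using g(2)[of x] by (cases "g x = 0") (auto simp: indicator_def)
  ultimately show ?thesis by simp
qed

text \<open>Continuity of the pairing under uniform convergence with supports in a fixed compact set; combined
  with \<open>smooth_dense\<close> it carries identities from test functions over to continuous functions.\<close>

lemma integral_mult_diff_le:
  fixes f g h :: "'a::euclidean_space \<Rightarrow> real"
  assumes f: "f absolutely_integrable_on K" and K: "compact K"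
    and g: "continuous_on UNIV g" "\<And>x. g x \<noteq> 0 \<Longrightarrow> x \<in> K"
    and h: "continuous_on UNIV h" "\<And>x. h x \<noteq> 0 \<Longrightarrow> x \<in> K"
    and e: "\<And>x. \<bar>g x - h x\<bar> \<le> e"
  shows "\<bar>(LINT x|lebesgue. f x * g x) - (LINT x|lebesgue. f x * h x)\<bar>
           \<le> e * (LINT x|lebesgue. indicator K x * \<bar>f x\<bar>)"
proof -
  have "(LINT x|lebesgue. f x * g x) - (LINT x|lebesgue. f x * h x)
      = (LINT x|lebesgue. f x * g x - f x * h x)"
    using integrable_mult_compact_support[OF f K g] integrable_mult_compact_support[OF f K h] by simp
  also have "\<bar>\<dots>\<bar> \<le> (LINT x|lebesgue. \<bar>f x * g x - f x * h x\<bar>)"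
    by (rule integral_abs_bound)
  also have "\<dots> \<le> (LINT x|lebesgue. e * (indicator K x * \<bar>f x\<bar>))"
  proof (rule integral_mono)
    show "integrable lebesgue (\<lambda>x. \<bar>f x * g x - f x * h x\<bar>)"
      using integrable_mult_compact_support[OF f K g] integrable_mult_compact_support[OF f K h] by simp
    have "integrable lebesgue (\<lambda>x. \<bar>indicator K x * f x\<bar>)"
      using f by (auto simp: set_integrable_def)
    then show "integrable lebesgue (\<lambda>x. e * (indicator K x * \<bar>f x\<bar>))" by (simp add: abs_mult)
    show "\<bar>f x * g x - f x * h x\<bar> \<le> e * (indicator K x * \<bar>f x\<bar>)" for x
    proof (cases "x \<in> K")
      case True
      have "\<bar>f x * g x - f x * h x\<bar> = \<bar>f x\<bar> * \<bar>g x - h x\<bar>"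
        by (simp add: right_diff_distrib flip: abs_mult)
      then show ?thesis using True mult_left_mono[OF e[of x], of "\<bar>f x\<bar>"] by (simp add: mult.commute)
    next
      case False
      then have "g x = 0" "h x = 0" using g(2) h(2) by blast+
      then show ?thesis using False by simp
    qed
  qed
  finally show ?thesis by simp
qed

lemma closure_support_subset:
  assumes "closed K" "\<And>x. f x \<noteq> 0 \<Longrightarrow> x \<in> K" shows "closure {x. f x \<noteq> 0} \<subseteq> K"
  by (rule closure_minimal) (use assms in auto)

lemma test_functionI:
  fixes f :: "'a::euclidean_space \<Rightarrow> 'b::real_normed_vector"
  assumes "\<And>k. C_k k f" "compact K" "\<And>x. f x \<noteq> 0 \<Longrightarrow> x \<in> K" "K \<subseteq> S"
  shows "test_function S f"
proof -
  have *: "closure {x. f x \<noteq> 0} \<subseteq> K"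
    by (rule closure_support_subset) (use assms in \<open>auto intro: compact_imp_closed\<close>)
  moreover have "compact (closure {x. f x \<noteq> 0})"
    using * assms(2) by (meson bounded_closure bounded_subset closed_closure compact_eq_bounded_closed)
  ultimately show ?thesis using assms by (auto simp: test_function_def)
qed

lemma integral_C_c_eq_0:
  fixes f g :: "'a::euclidean_space \<Rightarrow> real"
  assumes f: "f absolutely_integrable_on cball c R"
    and test: "\<And>\<phi>. (\<And>k. C_k k \<phi>) \<Longrightarrow> (\<And>x. \<phi> x \<noteq> 0 \<Longrightarrow> x \<in> cball c R) \<Longrightarrow> (LINT x|lebesgue. f x * \<phi> x) = 0"
    and g: "continuous_on UNIV g" "\<And>x. g x \<noteq> 0 \<Longrightarrow> x \<in> cball c r" "r < R" "0 < R"
  shows "(LINT x|lebesgue. f x * g x) = 0"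
proof -
  define N where "N = (LINT x|lebesgue. indicator (cball c R) x * \<bar>f x\<bar>)"
  have N: "N \<ge> 0" unfolding N_def by (rule integral_nonneg_AE) (auto simp: indicator_def)
  have "\<bar>LINT x|lebesgue. f x * g x\<bar> \<le> 0 + e" if e: "e > 0" for e
  proof -
    define d where "d = e / (N + 1)"
    have d: "d > 0" "d * N \<le> e" using e N by (auto simp: d_def field_simps)
    obtain \<phi> where \<phi>: "\<And>k. C_k k \<phi>" "\<And>x. \<phi> x \<noteq> 0 \<Longrightarrow> x \<in> cball c R" "\<And>x. \<bar>\<phi> x - g x\<bar> \<le> d"
      using smooth_dense[OF g(1,2,3,4) d(1)] by blast
    have "\<bar>(LINT x|lebesgue. f x * \<phi> x) - (LINT x|lebesgue. f x * g x)\<bar> \<le> d * N"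
      unfolding N_def
    proof (rule integral_mult_diff_le[OF f compact_cball])
      show "continuous_on UNIV \<phi>" using \<phi>(1)[of 0] by simp
      show "x \<in> cball c R" if "g x \<noteq> 0" for x using g(2)[OF that] g(3) by simp
    qed (rule \<phi>(2), assumption, rule g(1), rule \<phi>(3))
    moreover have "(LINT x|lebesgue. f x * \<phi> x) = 0" by (rule test) (fact \<phi>)+
    ultimately show ?thesis using d(2) by simp
  qed
  then have "\<bar>LINT x|lebesgue. f x * g x\<bar> \<le> 0" by (rule field_le_epsilon)
  then show ?thesis by simp
qed

text \<open>Measurability makes \<open>sgn f\<close> an almost everywhere limit of continuous functions \<open>g\<^sub>n\<close>. Truncating these to
  \<open>[-1,1]\<close> and multiplying by the distance \<open>b\<close> to the complement of the ball gives admissible functions,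
  whence \<open>\<integral> |f| b = 0\<close> by dominated convergence.\<close>

lemma C_c_annihilator_AE_0:
  fixes f :: "'a::euclidean_space \<Rightarrow> real"
  assumes f: "f absolutely_integrable_on cball c R" and R: "0 < R"
    and C_c: "\<And>g. continuous_on UNIV g \<Longrightarrow> (\<And>x. g x \<noteq> 0 \<Longrightarrow> x \<in> cball c R) \<Longrightarrow> (LINT x|lebesgue. f x * g x) = 0"
  shows "AE x in lebesgue. x \<in> ball c R \<longrightarrow> f x = 0"
proof -
  let ?F = "\<lambda>x. indicator (cball c R) x * f x"
  have int: "integrable lebesgue ?F" using f by (simp add: set_integrable_def)
  then have "(\<lambda>x. sgn (?F x)) \<in> borel_measurable lebesgue" by simp
  then have "(\<lambda>x. sgn (?F x)) measurable_on UNIV"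
    by (subst measurable_on_iff_borel_measurable) auto
  then obtain N g where N: "negligible N" and g: "\<And>n::nat. continuous_on UNIV (g n)"
    and lim: "\<And>x. x \<notin> N \<Longrightarrow> (\<lambda>n. g n x) \<longlonglongrightarrow> sgn (?F x)"
    unfolding measurable_on_def by auto
  define b where "b x = max 0 (R - dist c x)" for x
  define G where "G n x = max (-1) (min 1 (g n x)) * b x" for n x
  have b: "0 \<le> b x" "b x \<le> R" "x \<notin> ball c R \<Longrightarrow> b x = 0" for x using R by (auto simp: b_def)
  have Gcont: "continuous_on UNIV (G n)" for n
    unfolding G_def b_def by (intro continuous_intros g)
  have bm: "b \<in> borel_measurable lebesgue"
    unfolding b_def by (intro continuous_imp_lebesgue_measurable continuous_intros)
  have zero: "(LINT x|lebesgue. ?F x * G n x) = 0" for n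
  proof -
    have eq: "?F x * G n x = f x * G n x" for x
    proof (cases "x \<in> cball c R")
      case False
      then have "b x = 0" by (intro b(3)) simp
      then show ?thesis by (simp add: G_def)
    qed simp
    have supp: "x \<in> cball c R" if "G n x \<noteq> 0" for x
    proof (rule ccontr)
      assume "x \<notin> cball c R"
      then have "b x = 0" by (intro b(3)) simp
      with that show False by (simp add: G_def)
    qed
    show ?thesis unfolding eq by (rule C_c[OF Gcont]) (rule supp)
  qed
  have "(\<lambda>n. LINT x|lebesgue. ?F x * G n x) \<longlonglongrightarrow> (LINT x|lebesgue. \<bar>?F x\<bar> * b x)"
  proof (rule integral_dominated_convergence[where w="\<lambda>x. R * \<bar>?F x\<bar>"])
    show "integrable lebesgue (\<lambda>x. R * \<bar>?F x\<bar>)" using int by (intro integrable_mult_right integrable_abs)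
    from bm show "(\<lambda>x. \<bar>?F x\<bar> * b x) \<in> borel_measurable lebesgue"
      by (rule borel_measurable_times[OF borel_measurable_abs[OF borel_measurable_integrable[OF int]]])
    have "G n \<in> borel_measurable lebesgue" for n
      using borel_measurable_continuous_onI[OF Gcont] by (simp add: measurable_completion)
    then show "(\<lambda>x. ?F x * G n x) \<in> borel_measurable lebesgue" for n
      by (rule borel_measurable_times[OF borel_measurable_integrable[OF int]])
    have "AE x in lebesgue. x \<notin> N" using N by (simp add: AE_iff_null_sets negligible_iff_null_sets null_sets_def AE_not_in)
    then show "AE x in lebesgue. (\<lambda>n. ?F x * G n x) \<longlonglongrightarrow> \<bar>?F x\<bar> * b x"
    proof eventually_elim
      case (elim x)
      have "(\<lambda>n. ?F x * G n x) \<longlonglongrightarrow> ?F x * (max (-1) (min 1 (sgn (?F x))) * b x)"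
        unfolding G_def by (intro tendsto_intros lim elim)
      also have "max (-1) (min 1 (sgn (?F x))) = sgn (?F x)" by (simp add: sgn_real_def)
      also have "?F x * (sgn (?F x) * b x) = \<bar>?F x\<bar> * b x" by (simp add: sgn_real_def)
      finally show ?case .
    qed
    show "AE x in lebesgue. norm (?F x * G n x) \<le> R * \<bar>?F x\<bar>" for n
    proof (rule AE_I2)
      fix x
      have "\<bar>G n x\<bar> \<le> 1 * R" unfolding G_def abs_mult using b[of x] by (intro mult_mono) auto
      then have "\<bar>?F x\<bar> * \<bar>G n x\<bar> \<le> \<bar>?F x\<bar> * R" by (intro mult_left_mono) auto
      then show "norm (?F x * G n x) \<le> R * \<bar>?F x\<bar>" by (simp only: real_norm_def abs_mult mult.commute[of R])
    qed
  qed
  then have eq0: "(LINT x|lebesgue. \<bar>?F x\<bar> * b x) = 0"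
    unfolding zero by (simp add: LIMSEQ_const_iff)
  have "integrable lebesgue (\<lambda>x. \<bar>?F x\<bar> * b x)"
  proof (rule Bochner_Integration.integrable_bound)
    show "integrable lebesgue (\<lambda>x. R * \<bar>?F x\<bar>)" using int by (intro integrable_mult_right integrable_abs)
    show "(\<lambda>x. \<bar>?F x\<bar> * b x) \<in> borel_measurable lebesgue"
      by (rule borel_measurable_times[OF borel_measurable_abs[OF borel_measurable_integrable[OF int]] bm])
    show "AE x in lebesgue. norm (\<bar>?F x\<bar> * b x) \<le> norm (R * \<bar>?F x\<bar>)"
    proof (rule AE_I2)
      fix x
      have "\<bar>?F x\<bar> * b x \<le> \<bar>?F x\<bar> * R" using b(2)[of x] by (intro mult_left_mono) auto
      then show "norm (\<bar>?F x\<bar> * b x) \<le> norm (R * \<bar>?F x\<bar>)"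
        using b(1)[of x] R by (simp add: abs_mult mult.commute)
    qed
  qed
  then have "AE x in lebesgue. \<bar>?F x\<bar> * b x = 0"
    using eq0 b by (subst (asm) integral_nonneg_eq_0_iff_AE) auto
  then show ?thesis
    by eventually_elim (auto simp: b_def indicator_def split: if_splits)
qed

section \<open>Uniqueness of the weak curl\<close>

text \<open>Needed because \<open>weak_curl\<close> picks an unspecified representative. Components are tested one at a time on
  small balls, and countably many of these balls cover \<open>\<Omega>\<close>.\<close>

lemma weak_curl_0_unique:
  assumes \<Omega>: "open \<Omega>" and u: "has_weak_curl \<Omega> u (\<lambda>x. 0)" and w: "has_weak_curl \<Omega> u w"
  shows "AE x in lebesgue. x \<in> \<Omega> \<longrightarrow> w x = 0"
proof -
  have \<Omega>_sets: "\<Omega> \<in> sets lebesgue" using \<Omega> by (simp add: lborelD)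
  have local: "AE x in lebesgue. x \<in> ball c (R / 2) \<longrightarrow> w x $ i = 0"
    if R: "R > 0" "cball c R \<subseteq> \<Omega>" for c R i
  proof -
    have int: "(\<lambda>x. w x $ i) absolutely_integrable_on cball c S" if "S \<le> R" for S
    proof -
      have "w absolutely_integrable_on cball c S"
        using w R that unfolding has_weak_curl_def locally_integrable_def
        by (meson compact_cball order_trans subset_cball)
      then have "(\<lambda>x. w x \<bullet> axis i 1) absolutely_integrable_on cball c S"
        by (rule absolutely_integrable_component)
      then show ?thesis by (simp add: inner_axis)
    qed
    have test: "(LINT x|lebesgue. w x $ i * \<phi> x) = 0"
      if \<phi>: "\<And>k. C_k k \<phi>" "\<And>x. \<phi> x \<noteq> 0 \<Longrightarrow> x \<in> cball c R" for \<phi> :: "real^3 \<Rightarrow> real"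
    proof -
      let ?\<Phi> = "\<lambda>x. \<phi> x *\<^sub>R axis i 1 :: real^3"
      have "test_function \<Omega> ?\<Phi>"
      proof (rule test_functionI[OF _ compact_cball _ R(2)])
        show "C_k k ?\<Phi>" for k by (intro C_k_scaleR C_k_const \<phi>)
        show "x \<in> cball c R" if "?\<Phi> x \<noteq> 0" for x
          by (rule \<phi>(2)) (use that in auto)
      qed
      then have "(LINT x|lebesgue_on \<Omega>. u x \<bullet> classical_curl ?\<Phi> x) = (LINT x|lebesgue_on \<Omega>. 0 \<bullet> ?\<Phi> x)"
        "(LINT x|lebesgue_on \<Omega>. u x \<bullet> classical_curl ?\<Phi> x) = (LINT x|lebesgue_on \<Omega>. w x \<bullet> ?\<Phi> x)"
        using u w unfolding has_weak_curl_def by blast+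
      then have "(LINT x|lebesgue_on \<Omega>. w x $ i * \<phi> x) = 0"
        by (simp add: inner_axis mult.commute)
      moreover have "(LINT x|lebesgue_on \<Omega>. w x $ i * \<phi> x) = (LINT x|lebesgue. w x $ i * \<phi> x)"
      proof (rule LINT_lebesgue_on_eq[OF \<Omega>_sets])
        fix x assume "x \<notin> \<Omega>"
        then have "\<phi> x = 0" using \<phi>(2)[of x] R(2) by blast
        then show "w x $ i * \<phi> x = 0" by simp
      qed
      ultimately show ?thesis by simp
    qed
    show ?thesis
    proof (rule C_c_annihilator_AE_0)
      show "(LINT x|lebesgue. w x $ i * g x) = 0"
        if "continuous_on UNIV g" "\<And>x. g x \<noteq> 0 \<Longrightarrow> x \<in> cball c (R / 2)" for g
        by (rule integral_C_c_eq_0[OF int[OF order_refl] test that]) (use R in auto)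
    qed (use int R in auto)
  qed
  define \<F> where "\<F> = {ball c (R / 2) | c R. R > 0 \<and> cball c R \<subseteq> \<Omega>}"
  have "\<And>S. S \<in> \<F> \<Longrightarrow> open S" by (auto simp: \<F>_def)
  then obtain \<F>' where \<F>': "\<F>' \<subseteq> \<F>" "countable \<F>'" "\<Union>\<F>' = \<Union>\<F>"
    using Lindelof by metis
  have "\<Omega> \<subseteq> \<Union>\<F>"
  proof
    fix x assume "x \<in> \<Omega>"
    then obtain R where "R > 0" "cball x R \<subseteq> \<Omega>" using \<Omega> open_contains_cball by metis
    then show "x \<in> \<Union>\<F>" unfolding \<F>_def by (intro UnionI[of "ball x (R/2)"]) auto
  qed
  moreover have "AE x in lebesgue. \<forall>S\<in>\<F>'. \<forall>i. x \<in> S \<longrightarrow> w x $ i = 0"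
  proof (subst AE_ball_countable[OF \<F>'(2)], intro ballI)
    fix S assume "S \<in> \<F>'"
    then obtain c R where S: "S = ball c (R / 2)" and R: "R > 0" "cball c R \<subseteq> \<Omega>"
      using \<F>'(1) by (auto simp: \<F>_def)
    show "AE x in lebesgue. \<forall>i. x \<in> S \<longrightarrow> w x $ i = 0"
      unfolding AE_all_countable S using local[OF R] by blast
  qed
  ultimately show ?thesis
    using \<F>'(3) by (elim AE_mp) (auto intro!: AE_I2 simp: vec_eq_iff)
qed

section \<open>Chain rule for continuous Sobolev functions\<close>

lemma C_k_directional_derivative:
  fixes f :: "'a::real_normed_vector \<Rightarrow> real"
  assumes "C_k (Suc k) f"
  shows "((\<lambda>s. f (y + s *\<^sub>R u)) has_real_derivative frechet_derivative f (at (y + s *\<^sub>R u)) u) (at s)"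
proof -
  interpret bounded_linear "frechet_derivative f (at (y + s *\<^sub>R u))"
    using C_k_has_derivative[OF assms] by (rule has_derivative_bounded_linear)
  have "((\<lambda>s. y + s *\<^sub>R u) has_derivative (\<lambda>h. h *\<^sub>R u)) (at s)"
    by (auto intro!: derivative_eq_intros)
  from has_derivative_compose[OF this C_k_has_derivative[OF assms]]
  show ?thesis by (simp add: has_field_derivative_def scaleR mult.commute[of _ "frechet_derivative f (at (y + s *\<^sub>R u)) u"])
qed

text \<open>The left-hand side is symmetric in \<open>u\<close> and \<open>v\<close>, so that letting \<open>h\<close> tend to zero proves Schwarz' theorem below.\<close>

lemma second_difference_quotient:
  fixes f :: "'a::real_normed_vector \<Rightarrow> real"
  assumes f: "C_k 2 f" and h: "h > 0"
  obtains s t where "0 < s" "s < h" "0 < t" "t < h"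
    "f (x + h *\<^sub>R u + h *\<^sub>R v) - f (x + h *\<^sub>R u) - f (x + h *\<^sub>R v) + f x
      = h * (h * frechet_derivative (\<lambda>x. frechet_derivative f (at x) u) (at (x + s *\<^sub>R u + t *\<^sub>R v)) v)"
proof -
  let ?fu = "\<lambda>x. frechet_derivative f (at x) u"
  have f': "C_k (Suc (Suc 0)) f" using f by (simp add: numeral_2_eq_2)
  then have fu: "C_k (Suc 0) ?fu" unfolding C_k.simps(2)[of "Suc 0"] by blast
  have "((\<lambda>s. f ((x + h *\<^sub>R v) + s *\<^sub>R u) - f (x + s *\<^sub>R u)) has_real_derivative
     ?fu ((x + h *\<^sub>R v) + s *\<^sub>R u) - ?fu (x + s *\<^sub>R u)) (at s)" for s
    by (intro DERIV_diff C_k_directional_derivative[OF f'])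
  from MVT2[OF h this] obtain s where s: "0 < s" "s < h"
    "f ((x + h *\<^sub>R v) + h *\<^sub>R u) - f (x + h *\<^sub>R u) - (f (x + h *\<^sub>R v) - f x)
      = h * (?fu ((x + h *\<^sub>R v) + s *\<^sub>R u) - ?fu (x + s *\<^sub>R u))" by auto
  from MVT2[OF h C_k_directional_derivative[OF fu, of "x + s *\<^sub>R u" v]]
  obtain t where t: "0 < t" "t < h"
    "?fu ((x + s *\<^sub>R u) + h *\<^sub>R v) - ?fu (x + s *\<^sub>R u) = h * frechet_derivative ?fu (at (x + s *\<^sub>R u + t *\<^sub>R v)) v"
    by auto
  show thesis
    by (rule that[OF s(1,2) t(1,2)]) (use s(3) t(3) in \<open>simp add: algebra_simps\<close>)
qed

lemma second_derivative_symmetric: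
  fixes f :: "'a::real_normed_vector \<Rightarrow> real"
  assumes f: "C_k 2 f"
  shows "frechet_derivative (\<lambda>x. frechet_derivative f (at x) u) (at x) v
       = frechet_derivative (\<lambda>x. frechet_derivative f (at x) v) (at x) u"
proof -
  define A where "A u v y = frechet_derivative (\<lambda>x. frechet_derivative f (at x) u) (at y) v" for u v y
  have cont: "continuous_on UNIV (A u v)" for u v
    using f unfolding A_def by (simp add: numeral_2_eq_2)
  define h where "h n = 1 / (real n + 1)" for n
  have h: "h n > 0" for n by (simp add: h_def)
  have h0: "h \<longlonglongrightarrow> 0" using LIMSEQ_Suc[OF lim_1_over_n] unfolding h_def by (simp add: add.commute)
  have lim: "(\<lambda>n. A u v (x + s n *\<^sub>R a + t n *\<^sub>R b)) \<longlonglongrightarrow> A u v x"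
    if "\<And>n. 0 < s n" "\<And>n. s n < h n" "\<And>n. 0 < t n" "\<And>n. t n < h n" for s t u v a b
  proof -
    have "s \<longlonglongrightarrow> 0" "t \<longlonglongrightarrow> 0"
      by (rule tendsto_sandwich[OF _ _ tendsto_const h0]; use that in \<open>auto intro!: always_eventually less_imp_le\<close>)+
    then have "(\<lambda>n. x + s n *\<^sub>R a + t n *\<^sub>R b) \<longlonglongrightarrow> x + 0 *\<^sub>R a + 0 *\<^sub>R b"
      by (intro tendsto_intros)
    then show ?thesis using cont[of u v] by (auto simp: continuous_on_eq_continuous_at intro: isCont_tendsto_compose)
  qed
  let ?D = "\<lambda>n. f (x + h n *\<^sub>R u + h n *\<^sub>R v) - f (x + h n *\<^sub>R u) - f (x + h n *\<^sub>R v) + f x"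
  have "\<exists>s t. 0 < s \<and> s < h n \<and> 0 < t \<and> t < h n \<and> ?D n = h n * (h n * A u v (x + s *\<^sub>R u + t *\<^sub>R v))" for n
    using second_difference_quotient[OF f h[of n], of x u v] unfolding A_def by metis
  then obtain s t where st: "\<And>n. 0 < s n" "\<And>n. s n < h n" "\<And>n. 0 < t n" "\<And>n. t n < h n"
    "\<And>n. ?D n = h n * (h n * A u v (x + s n *\<^sub>R u + t n *\<^sub>R v))" by metis
  have "\<exists>s t. 0 < s \<and> s < h n \<and> 0 < t \<and> t < h n \<and> ?D n = h n * (h n * A v u (x + s *\<^sub>R v + t *\<^sub>R u))" for n
  proof -
    obtain s t where "0 < s" "s < h n" "0 < t" "t < h n"
      "f (x + h n *\<^sub>R v + h n *\<^sub>R u) - f (x + h n *\<^sub>R v) - f (x + h n *\<^sub>R u) + f x = h n * (h n * A v u (x + s *\<^sub>R v + t *\<^sub>R u))"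
      using second_difference_quotient[OF f h[of n], of x v u] unfolding A_def by metis
    then show ?thesis by (intro exI[of _ s] exI[of _ t]) (auto simp: add_ac)
  qed
  then obtain s' t' where st': "\<And>n. 0 < s' n" "\<And>n. s' n < h n" "\<And>n. 0 < t' n" "\<And>n. t' n < h n"
    "\<And>n. ?D n = h n * (h n * A v u (x + s' n *\<^sub>R v + t' n *\<^sub>R u))" by metis
  have "A u v (x + s n *\<^sub>R u + t n *\<^sub>R v) = A v u (x + s' n *\<^sub>R v + t' n *\<^sub>R u)" for n
    using st(5)[of n] st'(5)[of n] h[of n] by simp
  then have "A u v x = A v u x"
    using lim[OF st(1-4), of u v u v] lim[OF st'(1-4), of v u v u] by (simp add: LIMSEQ_unique)
  then show ?thesis by (simp add: A_def)
qed

lemma frechet_derivative_outside_support: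
  assumes "closed K" "\<And>x. f x \<noteq> 0 \<Longrightarrow> x \<in> K" "x \<notin> K"
  shows "frechet_derivative f (at x) = (\<lambda>h. 0)"
proof -
  have "(f has_derivative (\<lambda>h. 0)) (at x)"
    by (rule has_derivative_transform_within_open[of "\<lambda>x. 0" _ _ _ "- K"]) (use assms in auto)
  then show ?thesis using frechet_derivative_at by metis
qed

lemma compact_support_uniformly_continuous:
  fixes f :: "'a::euclidean_space \<Rightarrow> real"
  assumes f: "continuous_on UNIV f" "\<And>x. f x \<noteq> 0 \<Longrightarrow> x \<in> cball 0 r" and e: "e > 0"
  obtains d where "d > 0" "\<And>x y. dist x y < d \<Longrightarrow> \<bar>f x - f y\<bar> \<le> e"
proof -
  have "uniformly_continuous_on (cball 0 (r + 1)) f"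
    using f(1) by (intro compact_uniformly_continuous compact_cball) (auto intro: continuous_on_subset)
  then obtain d where d: "d > 0" "\<And>x y. x \<in> cball 0 (r+1) \<Longrightarrow> y \<in> cball 0 (r+1) \<Longrightarrow> dist y x < d \<Longrightarrow> dist (f y) (f x) < e"
    using e unfolding uniformly_continuous_on_def by metis
  have "\<bar>f x - f y\<bar> \<le> e" if xy: "dist x y < min d 1" for x y
  proof (cases "x \<in> cball 0 (r + 1) \<and> y \<in> cball 0 (r + 1)")
    case True
    then show ?thesis using d(2)[of y x] xy by (auto simp: dist_real_def)
  next
    case False
    have "norm x \<le> norm y + dist x y" "norm y \<le> norm x + dist x y"
      by (metis dist_commute dist_norm norm_triangle_sub)+
    then have "x \<notin> cball 0 r" "y \<notin> cball 0 r" using False xy by auto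
    then have "f x = 0" "f y = 0" using f(2) by blast+
    then show ?thesis using e by simp
  qed
  then show thesis using that[of "min d 1"] d(1) by auto
qed

lemma shift_support:
  assumes "\<And>x. f x \<noteq> 0 \<Longrightarrow> x \<in> cball 0 r" "f (x - t *\<^sub>R e) \<noteq> 0" "norm e = 1"
  shows "x \<in> cball 0 (r + \<bar>t\<bar>)"
proof -
  have "norm (x - t *\<^sub>R e) \<le> r" using assms(1)[OF assms(2)] by simp
  moreover have "norm x \<le> norm (x - t *\<^sub>R e) + norm (t *\<^sub>R e)"
    using norm_triangle_ineq[of "x - t *\<^sub>R e" "t *\<^sub>R e"] by simp
  ultimately show ?thesis using assms(3) by simp
qed

lemma weak_gradient_test_function:
  assumes "has_weak_gradient UNIV g w" "\<And>k. C_k k \<phi>" "\<And>x. \<phi> x \<noteq> 0 \<Longrightarrow> x \<in> cball 0 r"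
  shows "(LINT x|lebesgue. g x * partial i \<phi> x) = - (LINT x|lebesgue. w x $ i * \<phi> x)"
proof -
  have "test_function UNIV \<phi>"
    by (rule test_functionI[OF assms(2) compact_cball assms(3)]) auto
  then show ?thesis using assms(1) unfolding has_weak_gradient_def by (simp add: lebesgue_on_UNIV_eq)
qed

lemma locally_integrable_UNIV_component:
  fixes w :: "real^3 \<Rightarrow> real^3"
  assumes "locally_integrable UNIV w" "compact K"
  shows "(\<lambda>x. w x $ i) absolutely_integrable_on K"
proof -
  have "w absolutely_integrable_on K" using assms by (auto simp: locally_integrable_def)
  then have "(\<lambda>x. w x \<bullet> axis i 1) absolutely_integrable_on K"
    by (rule absolutely_integrable_component)
  then show ?thesis by (simp add: inner_axis)
qed

text \<open>The translation sits on the smooth factor, whose difference quotients converge uniformly to the partial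
  derivative with supports in a fixed ball; integrability of \<open>g\<close> there gives the limit.\<close>

lemma integral_translation_derivative:
  fixes i :: 3 and g :: "real^3 \<Rightarrow> real"
  assumes g: "\<And>K. compact K \<Longrightarrow> g absolutely_integrable_on K"
    and \<phi>: "\<And>k. C_k k \<phi>" "\<And>x. \<phi> x \<noteq> 0 \<Longrightarrow> x \<in> cball 0 r"
  defines "e \<equiv> axis i 1"
  shows "((\<lambda>t. LINT x|lebesgue. g x * \<phi> (x - t *\<^sub>R e)) has_real_derivative
           (LINT x|lebesgue. g x * - partial i \<phi> (x - t *\<^sub>R e))) (at t)"
proof -
  have e1: "norm e = 1" by (simp add: e_def)
  define \<psi> where "\<psi> = partial i \<phi>"
  let ?s = "\<lambda>r x. x - r *\<^sub>R e"
  let ?J = "\<lambda>r. LINT x|lebesgue. g x * \<phi> (x - r *\<^sub>R e)"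
  let ?J' = "LINT x|lebesgue. g x * - \<psi> (x - t *\<^sub>R e)"
  define K where "K = cball (0::real^3) (r + \<bar>t\<bar> + 1)"
  have K: "compact K" by (simp add: K_def)
  have gK: "g absolutely_integrable_on K"
    using g K by simp
  define N where "N = (LINT x|lebesgue. indicator K x * \<bar>g x\<bar>)"
  have N: "N \<ge> 0" unfolding N_def by (rule integral_nonneg_AE) (auto simp: indicator_def)
  have \<phi>c: "continuous_on UNIV \<phi>" using \<phi>(1)[of 0] by simp
  have "C_k 0 (\<lambda>x. frechet_derivative \<phi> (at x) e)" using \<phi>(1)[of "Suc 0"] unfolding C_k.simps(2) by blast
  then have \<psi>c: "continuous_on UNIV \<psi>" unfolding \<psi>_def partial_def e_def by simp
  have \<psi>s: "x \<in> cball 0 r" if "\<psi> x \<noteq> 0" for x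
  proof (rule ccontr)
    assume "x \<notin> cball 0 r"
    then have "frechet_derivative \<phi> (at x) = (\<lambda>h. 0)"
      by (intro frechet_derivative_outside_support[OF closed_cball \<phi>(2)])
    with that show False by (simp add: \<psi>_def partial_def)
  qed
  have shift: "continuous_on UNIV (\<lambda>x. f (x - s *\<^sub>R e))" if "continuous_on UNIV f" for f :: "real^3 \<Rightarrow> real" and s
    by (rule continuous_on_compose2[OF that]) (auto intro!: continuous_intros)
  have supp: "x \<in> K" if "f (x - s *\<^sub>R e) \<noteq> 0" "\<And>x. f x \<noteq> 0 \<Longrightarrow> x \<in> cball 0 r" "\<bar>s\<bar> \<le> \<bar>t\<bar> + 1" 
    for x s and f :: "real^3 \<Rightarrow> real"
  proof -
    have "x \<in> cball 0 (r + \<bar>s\<bar>)" by (rule shift_support[where f=f, OF that(2) that(1) e1])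
    then show ?thesis using that(3) by (simp add: K_def)
  qed
  have der: "((\<lambda>s. \<phi> (x - s *\<^sub>R e)) has_real_derivative - \<psi> (x - s *\<^sub>R e)) (at s)" for x s
  proof -
    have "((\<lambda>s. \<phi> (x + s *\<^sub>R (- e))) has_real_derivative frechet_derivative \<phi> (at (x + s *\<^sub>R (- e))) (- e)) (at s)"
      by (rule C_k_directional_derivative[OF \<phi>(1)])
    moreover have "frechet_derivative \<phi> (at y) (- e) = - \<psi> y" for y
      using linear_frechet_derivative[of \<phi> "at y"] C_k.simps(2)[of 0 \<phi>] \<phi>(1)[of "Suc 0"]
      by (simp add: \<psi>_def partial_def e_def linear_neg)
    ultimately show ?thesis by simp
  qed
  have limit: "((\<lambda>k. (?J (t + k) - ?J t) / k)
      \<longlongrightarrow> ?J') (at 0)"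
  proof (rule LIM_I)
    fix \<epsilon> :: real assume \<epsilon>: "\<epsilon> > 0"
    define \<eta> where "\<eta> = \<epsilon> / (N + 1)"
    have \<eta>: "\<eta> > 0" "\<eta> * N < \<epsilon>" using \<epsilon> N by (auto simp: \<eta>_def field_simps)
    obtain d where d: "d > 0" "\<And>x y. dist x y < d \<Longrightarrow> \<bar>\<psi> x - \<psi> y\<bar> \<le> \<eta>"
      using compact_support_uniformly_continuous[OF \<psi>c \<psi>s \<eta>(1)] by blast
    have "norm ((?J (t + k) - ?J t) / k
        - ?J') < \<epsilon>"
      if k: "k \<noteq> 0" "\<bar>k\<bar> < min d 1" for k
    proof -
      have tk: "\<bar>t + k\<bar> \<le> \<bar>t\<bar> + 1" using k by linarith
      let ?q = "\<lambda>x. (\<phi> (?s (t + k) x) - \<phi> (?s t x)) / k"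
      have qc: "continuous_on UNIV ?q" by (intro continuous_intros shift[OF \<phi>c] k) (use k in auto)
      have qs: "x \<in> K" if "?q x \<noteq> 0" for x
      proof -
        from that have "\<phi> (?s (t + k) x) \<noteq> 0 \<or> \<phi> (?s t x) \<noteq> 0" by auto
        then show ?thesis
        proof
          assume "\<phi> (?s (t + k) x) \<noteq> 0"
          then show ?thesis by (rule supp[where f=\<phi>, OF _ \<phi>(2) tk])
        next
          assume "\<phi> (?s t x) \<noteq> 0"
          then show ?thesis using supp[where f=\<phi> and s=t and x=x, OF _ \<phi>(2)] by simp
        qed
      qed
      have pc: "continuous_on UNIV (\<lambda>x. - \<psi> (?s t x))" by (intro continuous_intros shift[OF \<psi>c])
      have ps: "x \<in> K" if "- \<psi> (?s t x) \<noteq> 0" for x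
      proof (rule supp[where f=\<psi> and s=t and x=x])
        show "\<psi> (?s t x) \<noteq> 0" using that by simp
      qed (rule \<psi>s, assumption, linarith)
      have close: "\<bar>?q x - - \<psi> (?s t x)\<bar> \<le> \<eta>" for x
      proof -
        let ?f = "\<lambda>s. \<phi> (x - s *\<^sub>R e) + s * \<psi> (?s t x)"
        have "norm (?f (t + k) - ?f t) \<le> \<eta> * norm (t + k - t)"
        proof (rule field_differentiable_bound[of "closed_segment t (t + k)"])
          show "(?f has_field_derivative (- \<psi> (x - s *\<^sub>R e) + \<psi> (?s t x))) (at s within closed_segment t (t + k))" for s
            by (rule has_field_derivative_at_within) (auto intro!: derivative_eq_intros der)
          show "norm (- \<psi> (x - s *\<^sub>R e) + \<psi> (?s t x)) \<le> \<eta>" if "s \<in> closed_segment t (t + k)" for s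
          proof -
            have "\<bar>s - t\<bar> \<le> \<bar>k\<bar>" using that by (auto simp: closed_segment_eq_real_ivl split: if_splits)
            moreover have "dist (?s t x) (x - s *\<^sub>R e) = \<bar>s - t\<bar>"
              using e1 by (simp add: dist_norm flip: scaleR_diff_left)
            ultimately have "\<bar>\<psi> (?s t x) - \<psi> (x - s *\<^sub>R e)\<bar> \<le> \<eta>" using k by (intro d(2)) auto
            then show ?thesis by simp
          qed
        qed auto
        then have "\<bar>\<phi> (?s (t + k) x) - \<phi> (?s t x) + k * \<psi> (?s t x)\<bar> \<le> \<eta> * \<bar>k\<bar>"
          by (simp add: algebra_simps)
        moreover have "\<phi> (?s (t + k) x) - \<phi> (?s t x) + k * \<psi> (?s t x) = (?q x - - \<psi> (?s t x)) * k"
          using k by (simp add: field_simps)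
        ultimately have "\<bar>?q x - - \<psi> (?s t x)\<bar> * \<bar>k\<bar> \<le> \<eta> * \<bar>k\<bar>" by (simp only: abs_mult)
        then show ?thesis by (rule mult_right_le_imp_le) (use k in simp)
      qed
      have "\<bar>(LINT x|lebesgue. g x * ?q x) - ?J'\<bar> \<le> \<eta> * N"
        unfolding N_def by (rule integral_mult_diff_le[OF gK K qc qs pc ps close])
      moreover have "(LINT x|lebesgue. g x * ?q x) = (?J (t + k) - ?J t) / k"
      proof -
        have i: "integrable lebesgue (\<lambda>x. g x * \<phi> (x - s *\<^sub>R e))" if "\<bar>s\<bar> \<le> \<bar>t\<bar> + 1" for s
          by (rule integrable_mult_compact_support[OF gK K shift[OF \<phi>c]]) (rule supp[where f=\<phi>, OF _ \<phi>(2) that])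
        have "(LINT x|lebesgue. g x * ?q x) = (LINT x|lebesgue. (g x * \<phi> (?s (t + k) x) - g x * \<phi> (?s t x)) / k)"
          by (simp add: right_diff_distrib)
        also have "\<dots> = (?J (t + k) - ?J t) / k"
          using i[OF tk] i[of t] by simp
        finally show ?thesis .
      qed
      ultimately show ?thesis using \<eta>(2) unfolding real_norm_def by linarith
    qed
    then show "\<exists>s>0. \<forall>k. k \<noteq> 0 \<and> norm (k - 0) < s \<longrightarrow> norm ((?J (t + k) - ?J t) / k
        - ?J') < \<epsilon>"
      using d(1) by (intro exI[of _ "min d 1"]) auto
  qed
  from limit show ?thesis by (simp add: DERIV_def \<psi>_def)
qed

lemma weak_gradient_translation_derivative:
  fixes i :: 3
  assumes g: "has_weak_gradient UNIV g w"
    and \<phi>: "\<And>k. C_k k \<phi>" "\<And>x. \<phi> x \<noteq> 0 \<Longrightarrow> x \<in> cball 0 r"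
  defines "e \<equiv> axis i 1"
  shows "((\<lambda>t. LINT x|lebesgue. g x * \<phi> (x - t *\<^sub>R e)) has_real_derivative
           (LINT x|lebesgue. w x $ i * \<phi> (x - t *\<^sub>R e))) (at t)"
proof -
  have e1: "norm e = 1" by (simp add: e_def)
  define \<psi> where "\<psi> = partial i \<phi>"
  have "(LINT x|lebesgue. g x * - \<psi> (x - t *\<^sub>R e)) = (LINT x|lebesgue. w x $ i * \<phi> (x - t *\<^sub>R e))"
  proof -
    have Ck: "C_k k (\<lambda>x. \<phi> (x - t *\<^sub>R e))" for k using C_k_shift[OF \<phi>(1), of k "- (t *\<^sub>R e)"] by simp
    have par: "partial i (\<lambda>x. \<phi> (x - t *\<^sub>R e)) x = \<psi> (x - t *\<^sub>R e)" for x
    proof -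
      have "((\<lambda>x. \<phi> (x - t *\<^sub>R e)) has_derivative frechet_derivative \<phi> (at (x - t *\<^sub>R e))) (at x)"
      proof -
        have "((\<lambda>x. x - t *\<^sub>R e) has_derivative (\<lambda>h. h)) (at x)"
          by (auto intro!: derivative_eq_intros)
        from has_derivative_compose[OF this C_k_has_derivative[OF \<phi>(1)]] show ?thesis .
      qed
      from frechet_derivative_at[OF this] show ?thesis by (simp add: partial_def \<psi>_def)
    qed
    have "(LINT x|lebesgue. g x * partial i (\<lambda>x. \<phi> (x - t *\<^sub>R e)) x) = - (LINT x|lebesgue. w x $ i * \<phi> (x - t *\<^sub>R e))"
      by (rule weak_gradient_test_function[OF g Ck, of "r + \<bar>t\<bar>"]) (rule shift_support[where f=\<phi>, OF \<phi>(2) _ e1])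
    then show ?thesis unfolding par by simp
  qed
  moreover have "((\<lambda>t. LINT x|lebesgue. g x * \<phi> (x - t *\<^sub>R e)) has_real_derivative
           (LINT x|lebesgue. g x * - \<psi> (x - t *\<^sub>R e))) (at t)"
    unfolding e_def \<psi>_def
    by (rule integral_translation_derivative[OF _ \<phi>])
       (use g in \<open>auto simp: has_weak_gradient_def locally_integrable_def\<close>)
  ultimately show ?thesis by simp
qed

text \<open>For smooth \<open>f\<close> this is the mean value theorem in the translation parameter, whose derivative is
  \<open>\<integral> w\<^sub>i f(\<cdot> - t e\<^sub>i)\<close>. Both sides are continuous in \<open>f\<close> for uniform convergence, which removes
  smoothness. The point of the lemma is that \<open>f\<close> may be merely continuous: in the chain rule \<open>f\<close>
  contains \<open>g\<close> itself.\<close>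

lemma weak_gradient_difference_quotient_C_c:
  fixes i :: 3
  assumes g: "has_weak_gradient UNIV g w"
    and f: "continuous_on UNIV f" "\<And>x. f x \<noteq> 0 \<Longrightarrow> x \<in> cball 0 r"
    and f0: "continuous_on UNIV f0" "\<And>x. f0 x \<noteq> 0 \<Longrightarrow> x \<in> cball 0 r"
    and \<tau>: "0 < \<tau>" "\<tau> \<le> 1" and r: "0 \<le> r"
    and close: "\<And>x t. 0 \<le> t \<Longrightarrow> t \<le> \<tau> \<Longrightarrow> \<bar>f (x - t *\<^sub>R axis i 1) - f0 x\<bar> \<le> \<epsilon>"
  shows "\<bar>(LINT x|lebesgue. g x * f (x - \<tau> *\<^sub>R axis i 1)) - (LINT x|lebesgue. g x * f x) - \<tau> * (LINT x|lebesgue. w x $ i * f0 x)\<bar>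
          \<le> \<tau> * \<epsilon> * (LINT x|lebesgue. indicator (cball 0 (r + 2)) x * \<bar>w x $ i\<bar>)"
proof -
  define e :: "real^3" where "e = axis i 1"
  have e1: "norm e = 1" by (simp add: e_def)
  let ?W = "LINT x|lebesgue. w x $ i * f0 x"
  define K where "K = cball (0::real^3) (r + 2)"
  have K: "compact K" by (simp add: K_def)
  have gK: "g absolutely_integrable_on K"
    using g K by (simp add: has_weak_gradient_def locally_integrable_def)
  have wK: "(\<lambda>x. w x $ i) absolutely_integrable_on K"
    using g K by (intro locally_integrable_UNIV_component) (simp_all add: has_weak_gradient_def)
  define M where "M = (LINT x|lebesgue. indicator K x * \<bar>g x\<bar>)"
  define N where "N = (LINT x|lebesgue. indicator K x * \<bar>w x $ i\<bar>)"
  have N: "N \<ge> 0" unfolding N_def by (rule integral_nonneg_AE) (auto simp: indicator_def)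
  have M: "M \<ge> 0" unfolding M_def by (rule integral_nonneg_AE) (auto simp: indicator_def)
  have shift: "continuous_on UNIV (\<lambda>x. f (x - s *\<^sub>R e))" if "continuous_on UNIV f" for f :: "real^3 \<Rightarrow> real" and s
    by (rule continuous_on_compose2[OF that]) (auto intro!: continuous_intros)
  have supp: "x \<in> K" if "f (x - s *\<^sub>R e) \<noteq> 0" "\<And>x. f x \<noteq> 0 \<Longrightarrow> x \<in> cball 0 (r+1)" "0 \<le> s" "s \<le> 1" 
    for x s and f :: "real^3 \<Rightarrow> real"
  proof -
    have "x \<in> cball 0 (r + 1 + \<bar>s\<bar>)" by (rule shift_support[where f=f, OF that(2) that(1) e1])
    then show ?thesis using that(3,4) by (simp add: K_def)
  qed
  have f0s: "x \<in> K" if "f0 x \<noteq> 0" for x using f0(2)[OF that] by (simp add: K_def)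
  have fs: "x \<in> cball 0 (r + 1)" if "f x \<noteq> 0" for x using f(2)[OF that] by simp
  let ?L = "\<lambda>f. (LINT x|lebesgue. g x * f (x - \<tau> *\<^sub>R e)) - (LINT x|lebesgue. g x * f x)"
  have "\<bar>?L f - \<tau> * ?W\<bar> \<le> \<tau> * \<epsilon> * N + \<delta>" if \<delta>: "\<delta> > 0" for \<delta>
  proof -
    define \<eta> where "\<eta> = \<delta> / (2 * M + N + 1)"
    have \<eta>: "\<eta> > 0" using \<delta> M N by (simp add: \<eta>_def)
    have "\<eta> * (2 * M + N) \<le> \<eta> * (2 * M + N + 1)" using \<eta> by (intro mult_left_mono) auto
    also have "\<dots> = \<delta>" using M N by (simp add: \<eta>_def)
    finally have \<eta>': "\<eta> * (2 * M + N) \<le> \<delta>" .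
    obtain \<phi> where \<phi>: "\<And>k. C_k k \<phi>" "\<And>x. \<phi> x \<noteq> 0 \<Longrightarrow> x \<in> cball 0 (r + 1)" "\<And>x. \<bar>\<phi> x - f x\<bar> \<le> \<eta>"
      using smooth_dense[OF f, of "r + 1" \<eta>] r \<eta> by auto
    have \<phi>c: "continuous_on UNIV \<phi>" using \<phi>(1)[of 0] by simp
    let ?F = "\<lambda>t. (LINT x|lebesgue. g x * \<phi> (x - t *\<^sub>R e)) - t * ?W"
    have "norm (?F \<tau> - ?F 0) \<le> ((\<epsilon> + \<eta>) * N) * norm (\<tau> - 0)"
    proof (rule field_differentiable_bound[of "{0..\<tau>}"])
      show "(?F has_field_derivative (LINT x|lebesgue. w x $ i * \<phi> (x - t *\<^sub>R e)) - ?W) (at t within {0..\<tau>})" for t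
      proof (rule has_field_derivative_at_within)
        have "((\<lambda>t. t * ?W) has_field_derivative ?W) (at t)"
          using DERIV_cmult_right[OF DERIV_ident, of "LINT x|lebesgue. w x $ i * f0 x"] by simp
        from DERIV_diff[OF weak_gradient_translation_derivative[OF g \<phi>(1,2), of i t, folded e_def] this]
        show "(?F has_field_derivative (LINT x|lebesgue. w x $ i * \<phi> (x - t *\<^sub>R e)) - ?W) (at t)" .
      qed
      show "norm ((LINT x|lebesgue. w x $ i * \<phi> (x - t *\<^sub>R e)) - ?W) \<le> (\<epsilon> + \<eta>) * N"
        if t: "t \<in> {0..\<tau>}" for t
        unfolding N_def real_norm_def
      proof (rule integral_mult_diff_le[OF wK K shift[OF \<phi>c] _ f0(1) f0s])
        show "x \<in> K" if "\<phi> (x - t *\<^sub>R e) \<noteq> 0" for x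
        proof (rule supp[where f=\<phi> and s=t and x=x, OF that \<phi>(2)])
          show "0 \<le> t" "t \<le> 1" using t \<tau> by auto
        qed
        show "\<bar>\<phi> (x - t *\<^sub>R e) - f0 x\<bar> \<le> \<epsilon> + \<eta>" for x
        proof -
          have "\<bar>f (x - t *\<^sub>R e) - f0 x\<bar> \<le> \<epsilon>" using close[of t x] t unfolding e_def by simp
          then show ?thesis using \<phi>(3)[of "x - t *\<^sub>R e"] by linarith
        qed
      qed
    qed (use \<tau> in auto)
    then have 1: "\<bar>?L \<phi> - \<tau> * ?W\<bar> \<le> \<tau> * (\<epsilon> + \<eta>) * N"
      using \<tau> by (simp add: algebra_simps)
    have 2: "\<bar>(LINT x|lebesgue. g x * \<phi> (x - s *\<^sub>R e)) - (LINT x|lebesgue. g x * f (x - s *\<^sub>R e))\<bar> \<le> \<eta> * M"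
      if s: "0 \<le> s" "s \<le> 1" for s
      unfolding M_def
      by (rule integral_mult_diff_le[OF gK K shift[OF \<phi>c] supp[where f=\<phi>, OF _ \<phi>(2) s] shift[OF f(1)] supp[where f=f, OF _ fs s] \<phi>(3)])
    have "\<bar>?L \<phi> - ?L f\<bar> \<le> 2 * (\<eta> * M)"
      using 2[of \<tau>] 2[of 0] \<tau> by simp
    with 1 have "\<bar>?L f - \<tau> * ?W\<bar> \<le> \<tau> * (\<epsilon> + \<eta>) * N + 2 * (\<eta> * M)" by linarith
    also have "\<dots> = \<tau> * \<epsilon> * N + (\<tau> * (\<eta> * N) + 2 * (\<eta> * M))" by (simp add: algebra_simps)
    also have "\<tau> * (\<eta> * N) + 2 * (\<eta> * M) \<le> 1 * (\<eta> * N) + 2 * (\<eta> * M)"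
      using \<tau> \<eta> N by (intro add_right_mono mult_right_mono) auto
    also have "\<dots> \<le> \<delta>" using \<eta>' by (simp add: algebra_simps)
    finally show ?thesis by simp
  qed
  then have "\<bar>?L f - \<tau> * ?W\<bar> \<le> \<tau> * \<epsilon> * N" by (rule field_le_epsilon)
  then show ?thesis by (simp add: e_def N_def K_def)
qed

lemma continuous_has_antiderivative:
  fixes h :: "real \<Rightarrow> real"
  assumes "continuous_on UNIV h"
  obtains H where "\<And>r. (H has_real_derivative h r) (at r)"
proof -
  have "\<exists>F. \<forall>x. - \<infinity> < ereal x \<longrightarrow> ereal x < \<infinity> \<longrightarrow> (F has_vector_derivative h x) (at x)"
    by (rule einterval_antiderivative) (use assms in \<open>auto simp: continuous_on_eq_continuous_at\<close>)
  then show thesis using that by (auto simp: has_real_derivative_iff_has_vector_derivative)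
qed

text \<open>The continuous version of the difference quotient of an antiderivative of \<open>h\<close>, meaningful also for \<open>a = b\<close>.\<close>

definition mean_value :: "(real \<Rightarrow> real) \<Rightarrow> real \<Rightarrow> real \<Rightarrow> real" where
  "mean_value h a b = integral {0..1} (\<lambda>s. h (a + s * (b - a)))"

lemma mean_value_antiderivative:
  assumes H: "\<And>r. (H has_real_derivative h r) (at r)"
  shows "H b - H a = mean_value h a b * (b - a)"
proof -
  have "((\<lambda>s. H (a + s * (b - a))) has_real_derivative h (a + s * (b - a)) * (b - a)) (at s)" for s
    by (rule DERIV_chain2[OF H]) (auto intro!: derivative_eq_intros)
  then have "((\<lambda>s. h (a + s * (b - a)) * (b - a)) has_integral (H (a + 1 * (b - a)) - H (a + 0 * (b - a)))) {0..1}"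
    by (intro fundamental_theorem_of_calculus)
       (auto simp: has_real_derivative_iff_has_vector_derivative intro: has_vector_derivative_at_within)
  from integral_unique[OF this] show ?thesis by (simp add: mean_value_def)
qed

lemma mean_value_close:
  assumes h: "continuous_on UNIV h" and close: "\<And>r. r \<in> closed_segment a b \<Longrightarrow> \<bar>h r - h a\<bar> \<le> e"
  shows "\<bar>mean_value h a b - h a\<bar> \<le> e"
proof -
  have c: "continuous_on {0..1} (\<lambda>s. h (a + s * (b - a)) - h a)"
    by (intro continuous_intros continuous_on_compose2[OF h]) auto
  have "((\<lambda>s. h (a + s * (b - a)) - h a) has_integral (mean_value h a b - h a)) {0..1}"
  proof -
    have "((\<lambda>s. h (a + s * (b - a))) has_integral mean_value h a b) {0..1}"
      unfolding mean_value_def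
      by (intro integrable_integral integrable_continuous_real continuous_intros continuous_on_compose2[OF h]) auto
    from has_integral_diff[OF this has_integral_const_real[of "h a" 0 1]] show ?thesis by simp
  qed
  moreover have "0 \<le> e" using close[of a] by fastforce
  moreover have "norm (h (a + s * (b - a)) - h a) \<le> e" if "s \<in> {0..1}" for s
  proof -
    have "a + s * (b - a) \<in> closed_segment a b"
      using that by (auto simp: in_segment algebra_simps intro!: exI[of _ s])
    then show ?thesis using close by simp
  qed
  ultimately have "norm (mean_value h a b - h a) \<le> e * measure lborel {0..1::real}"
    using has_integral_bound_real[of e "{}" "\<lambda>s. h (a + s * (b - a)) - h a" _ 0 1] by simp
  then show ?thesis by simp
qed

lemma mean_value_continuous:
  fixes f g :: "'a::euclidean_space \<Rightarrow> real"
  assumes h: "continuous_on UNIV h" and f: "continuous_on UNIV f" and g: "continuous_on UNIV g"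
  shows "continuous_on UNIV (\<lambda>x. mean_value h (f x) (g x))"
proof -
  have "continuous_on (UNIV \<times> cbox 0 1) (\<lambda>(x, s). h (f x + s * (g x - f x)))"
    unfolding split_beta
    by (intro continuous_on_compose2[OF h] continuous_intros continuous_on_compose2[OF f] continuous_on_compose2[OF g]) auto
  from integral_continuous_on_param[OF this] show ?thesis by (simp add: mean_value_def)
qed

lemma continuous_lebesgue_integral_translation:
  fixes f :: "'a::euclidean_space \<Rightarrow> real"
  assumes "continuous_on UNIV f"
  shows "(LINT x|lebesgue. f (x + c)) = (LINT x|lebesgue. f x)"
proof -
  have m: "f \<in> borel_measurable borel" by (rule borel_measurable_continuous_onI[OF assms])
  have m': "(\<lambda>x. f (x + c)) \<in> borel_measurable borel"
    by (intro borel_measurable_continuous_onI continuous_on_compose2[OF assms] continuous_intros) auto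
  have "(LINT x|lborel. f x) = (LINT x|distr lborel borel ((+) c). f x)" by (simp add: lborel_distr_plus)
  also have "\<dots> = (LINT x|lborel. f (c + x))" by (rule integral_distr) (use m in auto)
  finally show ?thesis using m m' by (simp add: integral_completion add.commute)
qed

lemma continuous_uniform_near_compact:
  fixes f :: "'a::euclidean_space \<Rightarrow> real"
  assumes f: "continuous_on UNIV f" and e: "e > 0"
  obtains d where "d > 0" "\<And>x y. x \<in> cball 0 r \<Longrightarrow> dist x y < d \<Longrightarrow> \<bar>f x - f y\<bar> \<le> e"
proof -
  have "uniformly_continuous_on (cball 0 (r + 1)) f"
    using f(1) by (intro compact_uniformly_continuous compact_cball) (auto intro: continuous_on_subset)
  then obtain d where d: "d > 0" "\<And>x y. x \<in> cball 0 (r+1) \<Longrightarrow> y \<in> cball 0 (r+1) \<Longrightarrow> dist y x < d \<Longrightarrow> dist (f y) (f x) < e"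
    using e unfolding uniformly_continuous_on_def by metis
  show thesis
  proof (rule that[of "min d 1"])
    fix x y :: 'a assume x: "x \<in> cball 0 r" and xy: "dist x y < min d 1"
    have "norm y \<le> norm x + dist x y" by (metis dist_commute dist_norm norm_triangle_sub)
    then have "y \<in> cball 0 (r + 1)" "x \<in> cball 0 (r + 1)" using x xy by auto
    then show "\<bar>f x - f y\<bar> \<le> e" using d(2)[of y x] xy by (auto simp: dist_real_def)
  qed (use d in auto)
qed

lemma absolutely_integrable_continuous_compact:
  fixes f :: "'a::euclidean_space \<Rightarrow> real"
  assumes f: "continuous_on UNIV f" and K: "compact K"
  shows "f absolutely_integrable_on K"
proof -
  obtain r where "K \<subseteq> cbox (-r) r" using compact_imp_bounded[OF K] bounded_subset_cbox_symmetric by metis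
  moreover have "f absolutely_integrable_on cbox (-r) r"
    by (rule absolutely_integrable_continuous) (rule continuous_on_subset[OF f], simp)
  ultimately show ?thesis using K set_integrable_subset lmeasurable_compact fmeasurableD by blast
qed

text \<open>Replace the derivative of \<open>\<phi>\<close> by a difference quotient and shift it onto \<open>H(g)\<close>. There
  \<open>H(g(x + \<tau> e)) - H(g(x)) = m\<^sub>\<tau>(x) (g(x + \<tau> e) - g(x))\<close> with the mean value \<open>m\<^sub>\<tau>\<close> of \<open>h\<close>, which is
  continuous in \<open>x\<close> and converges locally uniformly to \<open>h(g)\<close>. Shifting back, the difference quotient
  of \<open>g\<close> is tested against the continuous function \<open>m\<^sub>\<tau> \<phi>\<close>, and
  \<open>weak_gradient_difference_quotient_C_c\<close> gives the limit \<open>\<integral> w\<^sub>i h(g) \<phi>\<close>.\<close>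

lemma weak_gradient_chain_rule:
  fixes i :: 3
  assumes g: "has_weak_gradient UNIV g w" "continuous_on UNIV g"
    and h: "continuous_on UNIV h" and H: "\<And>r. (H has_real_derivative h r) (at r)"
    and \<phi>: "\<And>k. C_k k \<phi>" "\<And>x. \<phi> x \<noteq> 0 \<Longrightarrow> x \<in> cball 0 r" and r: "0 \<le> r"
  shows "(LINT x|lebesgue. H (g x) * partial i \<phi> x) = - (LINT x|lebesgue. h (g x) * w x $ i * \<phi> x)"
proof -
  define e :: "real^3" where "e = axis i 1"
  have e1: "norm e = 1" by (simp add: e_def)
  have Hc: "continuous_on UNIV H" using H by (meson DERIV_continuous continuous_at_imp_continuous_on)
  have Hgc: "continuous_on UNIV (\<lambda>x. H (g x))" by (rule continuous_on_compose2[OF Hc g(2)]) auto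
  have hgc: "continuous_on UNIV (\<lambda>x. h (g x))" by (rule continuous_on_compose2[OF h g(2)]) auto
  have \<phi>c: "continuous_on UNIV \<phi>" using \<phi>(1)[of 0] by simp
  obtain B where B: "B \<ge> 0" "\<And>x. \<bar>\<phi> x\<bar> \<le> B"
    using continuous_compact_support_bounded[OF compact_cball \<phi>c \<phi>(2)] by blast
  define f0 where "f0 x = h (g x) * \<phi> x" for x
  have f0: "continuous_on UNIV f0" unfolding f0_def by (intro continuous_intros hgc \<phi>c)
  have f0s: "x \<in> cball 0 r" if "f0 x \<noteq> 0" for x by (rule \<phi>(2)) (use that in \<open>auto simp: f0_def\<close>)
  define \<tau> where "\<tau> n = 1 / (real n + 1)" for n
  have \<tau>: "0 < \<tau> n" "\<tau> n \<le> 1" for n by (auto simp: \<tau>_def)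
  have \<tau>0: "\<tau> \<longlonglongrightarrow> 0" using LIMSEQ_Suc[OF lim_1_over_n] unfolding \<tau>_def by (simp add: add.commute)
  define f where "f n x = mean_value h (g x) (g (x + \<tau> n *\<^sub>R e)) * \<phi> x" for n x
  have gs: "continuous_on UNIV (\<lambda>x. g (x + c))" for c
    by (rule continuous_on_compose2[OF g(2)]) (auto intro!: continuous_intros)
  have f: "continuous_on UNIV (f n)" for n
    unfolding f_def by (intro continuous_intros mean_value_continuous h g(2) gs \<phi>c)
  have fs: "x \<in> cball 0 r" if "f n x \<noteq> 0" for x n by (rule \<phi>(2)) (use that in \<open>auto simp: f_def\<close>)
  define N where "N = (LINT x|lebesgue. indicator (cball 0 (r + 2)) x * \<bar>w x $ i\<bar>)"
  have N: "N \<ge> 0" unfolding N_def by (rule integral_nonneg_AE) (auto simp: indicator_def)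
  let ?W = "LINT x|lebesgue. w x $ i * f0 x"
  let ?g0 = "\<lambda>n. LINT x|lebesgue. g x * f n x"
  let ?gs = "\<lambda>n. LINT x|lebesgue. g x * f n (x - \<tau> n *\<^sub>R e)"
  let ?H0 = "LINT x|lebesgue. H (g x) * \<phi> x"
  let ?H1 = "LINT x|lebesgue. H (g x) * partial i \<phi> x"
  let ?Hs = "\<lambda>n. LINT x|lebesgue. H (g x) * \<phi> (x - \<tau> n *\<^sub>R e)"
  let ?Hq = "\<lambda>n. LINT x|lebesgue. H (g x) * ((\<phi> x - \<phi> (x - \<tau> n *\<^sub>R e)) / \<tau> n)"
  define D where "D n = (?gs n - ?g0 n) / \<tau> n" for n

  \<comment> \<open>uniform convergence of the translates of \<open>m\<^sub>\<tau> \<phi>\<close> to \<open>h(g) \<phi>\<close>\<close>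
  have close: "\<forall>\<^sub>F n in sequentially. \<forall>x t. 0 \<le> t \<longrightarrow> t \<le> \<tau> n \<longrightarrow> \<bar>f n (x - t *\<^sub>R e) - f0 x\<bar> \<le> \<epsilon>"
    if \<epsilon>: "\<epsilon> > 0" for \<epsilon>
  proof -
    define \<eta> where "\<eta> = \<epsilon> / (B + 1)"
    have \<eta>: "\<eta> > 0" using \<epsilon> B by (simp add: \<eta>_def)
    have "\<eta> * B + \<eta> = \<eta> * (B + 1)" by (simp add: algebra_simps)
    then have \<eta>B: "\<eta> * B + \<eta> = \<epsilon>" using B by (simp add: \<eta>_def)
    obtain d1 where d1: "d1 > 0" "\<And>x y. dist x y < d1 \<Longrightarrow> \<bar>f0 x - f0 y\<bar> \<le> \<eta>"
      using compact_support_uniformly_continuous[OF f0 f0s \<eta>] by blast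
    have "bounded (g ` cball 0 r)"
      by (intro compact_imp_bounded compact_continuous_image continuous_on_subset[OF g(2)]) auto
    then obtain M where M: "\<And>x. x \<in> cball 0 r \<Longrightarrow> \<bar>g x\<bar> \<le> M" by (force simp: bounded_iff)
    obtain d2 where d2: "d2 > 0" "\<And>a b. a \<in> cball 0 M \<Longrightarrow> dist a b < d2 \<Longrightarrow> \<bar>h a - h b\<bar> \<le> \<eta>"
      using continuous_uniform_near_compact[OF h \<eta>] by blast
    obtain d3 where d3: "d3 > 0" "\<And>x y. x \<in> cball 0 r \<Longrightarrow> dist x y < d3 \<Longrightarrow> \<bar>g x - g y\<bar> \<le> d2 / 2"
      using continuous_uniform_near_compact[OF g(2), of "d2 / 2"] d2(1) by auto
    have "\<forall>\<^sub>F n in sequentially. \<tau> n < min d1 d3" using \<tau>0 d1(1) d3(1) by (intro order_tendstoD) auto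
    then show ?thesis
    proof eventually_elim
      case (elim n)
      have mv: "\<bar>f n y - f0 y\<bar> \<le> \<eta> * B" for y
      proof (cases "y \<in> cball 0 r")
        case True
        have "\<bar>mean_value h (g y) (g (y + \<tau> n *\<^sub>R e)) - h (g y)\<bar> \<le> \<eta>"
        proof (rule mean_value_close[OF h])
          fix s assume s: "s \<in> closed_segment (g y) (g (y + \<tau> n *\<^sub>R e))"
          have "dist y (y + \<tau> n *\<^sub>R e) = \<tau> n" using e1 \<tau>(1)[of n] by (simp add: dist_norm)
          then have "\<bar>g y - g (y + \<tau> n *\<^sub>R e)\<bar> \<le> d2 / 2" using elim by (intro d3(2) True) auto
          moreover have "dist (g y) s \<le> \<bar>g y - g (y + \<tau> n *\<^sub>R e)\<bar>"
            using s by (auto simp: closed_segment_eq_real_ivl dist_real_def split: if_splits)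
          ultimately have "dist (g y) s < d2" using d2(1) by linarith
          then have "\<bar>h (g y) - h s\<bar> \<le> \<eta>" using M[OF True] by (intro d2(2)) auto
          then show "\<bar>h s - h (g y)\<bar> \<le> \<eta>" by (simp add: abs_minus_commute)
        qed
        then have "\<bar>mean_value h (g y) (g (y + \<tau> n *\<^sub>R e)) - h (g y)\<bar> * \<bar>\<phi> y\<bar> \<le> \<eta> * B"
          using B \<eta> by (intro mult_mono) auto
        then show ?thesis by (simp add: f_def f0_def left_diff_distrib flip: abs_mult)
      next
        case False
        then have "f n y = 0" "f0 y = 0" using fs[of n y] f0s[of y] by blast+
        then show ?thesis using \<eta> B by simp
      qed
      show ?case
      proof (intro allI impI)
        fix x t assume t: "0 \<le> t" "t \<le> \<tau> n"
        have "dist (x - t *\<^sub>R e) x < d1" using t elim e1 by (simp add: dist_norm)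
        then have "\<bar>f0 (x - t *\<^sub>R e) - f0 x\<bar> \<le> \<eta>" by (rule d1(2))
        then show "\<bar>f n (x - t *\<^sub>R e) - f0 x\<bar> \<le> \<epsilon>" using mv[of "x - t *\<^sub>R e"] \<eta>B by linarith
      qed
    qed
  qed

  have "D \<longlonglongrightarrow> ?W"
  proof (rule LIMSEQ_I)
    fix \<epsilon> :: real assume \<epsilon>: "\<epsilon> > 0"
    define \<eta> where "\<eta> = \<epsilon> / (N + 1)"
    have \<eta>: "\<eta> > 0" "\<eta> * N < \<epsilon>" using \<epsilon> N by (auto simp: \<eta>_def field_simps)
    obtain n0 where n0: "\<And>n x t. n \<ge> n0 \<Longrightarrow> 0 \<le> t \<Longrightarrow> t \<le> \<tau> n \<Longrightarrow> \<bar>f n (x - t *\<^sub>R e) - f0 x\<bar> \<le> \<eta>"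
      using close[OF \<eta>(1)] unfolding eventually_sequentially by metis
    show "\<exists>no. \<forall>n\<ge>no. norm (D n - ?W) < \<epsilon>"
    proof (intro exI[of _ n0] allI impI)
      fix n assume n: "n \<ge> n0"
      have "\<bar>?gs n - ?g0 n - \<tau> n * ?W\<bar> \<le> \<tau> n * \<eta> * N"
        unfolding e_def N_def
        by (rule weak_gradient_difference_quotient_C_c[OF g(1) f fs f0 f0s \<tau> r n0[OF n, unfolded e_def]])
      also have "?gs n - ?g0 n - \<tau> n * ?W
          = (D n - ?W) * \<tau> n"
        using \<tau>(1)[of n] by (simp add: D_def field_simps)
      finally have "\<bar>D n - ?W\<bar> * \<tau> n \<le> (\<eta> * N) * \<tau> n"
        using \<tau>(1)[of n] by (simp add: abs_mult mult_ac)
      then have "\<bar>D n - ?W\<bar> \<le> \<eta> * N" by (rule mult_right_le_imp_le) (rule \<tau>)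
      then show "norm (D n - ?W) < \<epsilon>" using \<eta>(2) by simp
    qed
  qed
  moreover have "(\<lambda>n. - D n) \<longlonglongrightarrow> ?H1"
  proof -
    let ?K = "cball (0::real^3) (r + 1)"
    have ai: "F absolutely_integrable_on ?K" if "continuous_on UNIV F" for F :: "real^3 \<Rightarrow> real"
      by (rule absolutely_integrable_continuous_compact[OF that]) simp
    have sh: "continuous_on UNIV (\<lambda>x. F (x - \<tau> n *\<^sub>R e))" if "continuous_on UNIV F" for n and F :: "real^3 \<Rightarrow> real"
      by (rule continuous_on_compose2[OF that]) (auto intro!: continuous_intros)
    have s1: "x \<in> ?K" if "F x \<noteq> 0" "\<And>x. F x \<noteq> 0 \<Longrightarrow> x \<in> cball 0 r" for x and F :: "real^3 \<Rightarrow> real"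
      using that(2)[OF that(1)] by simp
    have s2: "x \<in> ?K" if "F (x - \<tau> n *\<^sub>R e) \<noteq> 0" "\<And>x. F x \<noteq> 0 \<Longrightarrow> x \<in> cball 0 r" for x n and F :: "real^3 \<Rightarrow> real"
    proof -
      have "x \<in> cball 0 (r + \<bar>\<tau> n\<bar>)" by (rule shift_support[where f=F, OF that(2) that(1) e1])
      then show ?thesis using \<tau>[of n] by simp
    qed
    have I: "integrable lebesgue (\<lambda>x. F x * p x)" if "continuous_on UNIV F" "continuous_on UNIV p" "\<And>x. p x \<noteq> 0 \<Longrightarrow> x \<in> ?K" for F p :: "real^3 \<Rightarrow> real"
      by (rule integrable_mult_compact_support[OF ai[OF that(1)] compact_cball that(2,3)])
    have I1: "integrable lebesgue (\<lambda>x. H (g x) * \<phi> x)" by (rule I[OF Hgc \<phi>c s1[where F=\<phi>, OF _ \<phi>(2)]])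
    have I2: "integrable lebesgue (\<lambda>x. H (g x) * \<phi> (x - \<tau> n *\<^sub>R e))" for n by (rule I[OF Hgc sh[OF \<phi>c] s2[where F=\<phi>, OF _ \<phi>(2)]])
    have split_eq: "?Hq n
        = (?H0 - ?Hs n) / \<tau> n" for n
    proof -
      have "?Hq n
          = (LINT x|lebesgue. (H (g x) * \<phi> x - H (g x) * \<phi> (x - \<tau> n *\<^sub>R e)) / \<tau> n)"
        by (simp add: right_diff_distrib)
      also have "\<dots> = (?H0 - ?Hs n) / \<tau> n"
        using I1 I2[of n] by simp
      finally show ?thesis .
    qed
    \<comment> \<open>summation by parts: both translations are moved to the other factor\<close>
    have D_eq: "- D n = ?Hq n" for n
    proof -
      have A: "(LINT x|lebesgue. F x * p (x - \<tau> n *\<^sub>R e)) = (LINT x|lebesgue. F (x + \<tau> n *\<^sub>R e) * p x)"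
        if "continuous_on UNIV F" "continuous_on UNIV p" for F p :: "real^3 \<Rightarrow> real"
      proof -
        have "continuous_on UNIV (\<lambda>x. F x * p (x - \<tau> n *\<^sub>R e))" by (intro continuous_intros that sh)
        from continuous_lebesgue_integral_translation[OF this, of "\<tau> n *\<^sub>R e"] show ?thesis by simp
      qed
      have shp: "continuous_on UNIV (\<lambda>x. F (x + \<tau> n *\<^sub>R e))" if "continuous_on UNIV F" for F :: "real^3 \<Rightarrow> real"
        by (rule continuous_on_compose2[OF that]) (auto intro!: continuous_intros)
      have I3: "integrable lebesgue (\<lambda>x. H (g (x + \<tau> n *\<^sub>R e)) * \<phi> x)" by (rule I[OF shp[OF Hgc] \<phi>c s1[where F=\<phi>, OF _ \<phi>(2)]])
      have I4: "integrable lebesgue (\<lambda>x. g x * f n x)" by (rule I[OF g(2) f s1[where F="f n", OF _ fs]])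
      have I5: "integrable lebesgue (\<lambda>x. g (x + \<tau> n *\<^sub>R e) * f n x)" by (rule I[OF shp[OF g(2)] f s1[where F="f n", OF _ fs]])
      have "?Hq n
          = (?H0 - ?Hs n) / \<tau> n"
        by (rule split_eq)
      also have "\<dots> = (?H0 - (LINT x|lebesgue. H (g (x + \<tau> n *\<^sub>R e)) * \<phi> x)) / \<tau> n"
        by (simp only: A[OF Hgc \<phi>c])
      also have "?H0 - (LINT x|lebesgue. H (g (x + \<tau> n *\<^sub>R e)) * \<phi> x)
          = (LINT x|lebesgue. H (g x) * \<phi> x - H (g (x + \<tau> n *\<^sub>R e)) * \<phi> x)"
        using I1 I3 by simp
      also have "\<dots> = (LINT x|lebesgue. g x * f n x - g (x + \<tau> n *\<^sub>R e) * f n x)"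
      proof (rule Bochner_Integration.integral_cong[OF refl])
        fix x
        have "H (g (x + \<tau> n *\<^sub>R e)) - H (g x) = mean_value h (g x) (g (x + \<tau> n *\<^sub>R e)) * (g (x + \<tau> n *\<^sub>R e) - g x)"
          by (rule mean_value_antiderivative[OF H])
        then have "(H (g (x + \<tau> n *\<^sub>R e)) - H (g x)) * \<phi> x = (g (x + \<tau> n *\<^sub>R e) - g x) * f n x"
          by (simp add: f_def)
        then show "H (g x) * \<phi> x - H (g (x + \<tau> n *\<^sub>R e)) * \<phi> x = g x * f n x - g (x + \<tau> n *\<^sub>R e) * f n x"
          by (simp add: algebra_simps)
      qed
      also have "\<dots> = ?g0 n - (LINT x|lebesgue. g (x + \<tau> n *\<^sub>R e) * f n x)"
        using I4 I5 by simp
      also have "\<dots> = ?g0 n - ?gs n"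
        by (simp only: A[OF g(2) f])
      finally show ?thesis by (simp only: D_def minus_divide_left minus_diff_eq)
    qed
    have "((\<lambda>t. LINT x|lebesgue. H (g x) * \<phi> (x - t *\<^sub>R e)) has_real_derivative
        (LINT x|lebesgue. H (g x) * - partial i \<phi> (x - 0 *\<^sub>R e))) (at 0)"
      unfolding e_def
      by (rule integral_translation_derivative[OF absolutely_integrable_continuous_compact[OF Hgc] \<phi>])
    then have lim: "((\<lambda>k. ((LINT x|lebesgue. H (g x) * \<phi> (x - k *\<^sub>R e)) - ?H0) / k)
        \<longlongrightarrow> - ?H1) (at 0)"
      by (simp add: DERIV_def)
    have "filterlim \<tau> (at 0) sequentially"
      using \<tau>0 \<tau>(1) by (auto simp: filterlim_at intro!: always_eventually less_imp_neq[symmetric])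
    from tendsto_minus[OF filterlim_compose[OF lim this]]
    have "(\<lambda>n. (?H0 - ?Hs n) / \<tau> n)
        \<longlonglongrightarrow> ?H1"
      by (simp add: minus_divide_left)
    then have "(\<lambda>n. LINT x|lebesgue. H (g x) * ((\<phi> x - \<phi> (x - \<tau> n *\<^sub>R e)) / \<tau> n)) \<longlonglongrightarrow> ?H1"
      unfolding split_eq .
    then show ?thesis by (simp add: D_eq)
  qed
  ultimately have "- ?W = ?H1"
    using LIMSEQ_unique tendsto_minus by blast
  then show ?thesis by (simp add: f0_def mult_ac)
qed

section \<open>Functions of a Sobolev function have curl-free gradient\<close>

lemma C_k_partial: "C_k (Suc k) \<phi> \<Longrightarrow> C_k k (partial i \<phi>)"
  unfolding partial_def by simp

lemma partial_support:
  assumes "\<And>x. \<phi> x \<noteq> 0 \<Longrightarrow> x \<in> cball 0 r" "partial i \<phi> x \<noteq> 0"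
  shows "x \<in> cball 0 r"
proof (rule ccontr)
  assume "x \<notin> cball 0 r"
  then have "frechet_derivative \<phi> (at x) = (\<lambda>h. 0)"
    by (intro frechet_derivative_outside_support[OF closed_cball assms(1)])
  with assms(2) show False by (simp add: partial_def)
qed

lemma partial_commute:
  assumes "C_k 2 \<phi>" shows "partial i (partial j \<phi>) x = partial j (partial i \<phi>) x"
  unfolding partial_def by (rule second_derivative_symmetric[OF assms])

text \<open>By the chain rule both sides are \<open>- \<integral> H(g) \<partial>\<^sub>i\<partial>\<^sub>j\<phi>\<close> with \<open>H' = h\<close>.\<close>

lemma composite_gradient_closed:
  fixes i j :: 3
  assumes g: "has_weak_gradient UNIV g w" "continuous_on UNIV g"
    and h: "continuous_on UNIV h"
    and \<phi>: "\<And>k. C_k k \<phi>" "\<And>x. \<phi> x \<noteq> 0 \<Longrightarrow> x \<in> cball 0 r" and r: "0 \<le> r"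
  shows "(LINT x|lebesgue. h (g x) * w x $ i * partial j \<phi> x) = (LINT x|lebesgue. h (g x) * w x $ j * partial i \<phi> x)"
proof -
  obtain H where H: "\<And>r. (H has_real_derivative h r) (at r)"
    using continuous_has_antiderivative[OF h] by blast
  have "- (LINT x|lebesgue. h (g x) * w x $ i * partial j \<phi> x) = (LINT x|lebesgue. H (g x) * partial i (partial j \<phi>) x)" for i j
    by (rule weak_gradient_chain_rule[OF g h H C_k_partial[OF \<phi>(1)] partial_support[OF \<phi>(2)] r, symmetric])
  from this[of i j] this[of j i] show ?thesis by (simp add: partial_commute[OF \<phi>(1), of i j])
qed

lemma C_k_component:
  fixes \<Phi> :: "real^3 \<Rightarrow> real^3"
  assumes "\<And>k. C_k k \<Phi>" shows "C_k k (\<lambda>x. \<Phi> x $ i)"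
  by (rule C_k_linear_compose[OF bounded_linear_vec_nth assms])

lemma curl_support:
  assumes "\<And>x. \<Phi> x \<noteq> 0 \<Longrightarrow> x \<in> cball 0 r" "classical_curl \<Phi> x \<noteq> 0"
  shows "x \<in> cball 0 r"
proof (rule ccontr)
  assume x: "x \<notin> cball 0 r"
  have "partial i (\<lambda>y. \<Phi> y $ j) x = 0" for i j
  proof (rule ccontr)
    assume "partial i (\<lambda>y. \<Phi> y $ j) x \<noteq> 0"
    then have "x \<in> cball 0 r"
      by (rule partial_support[rotated]) (use assms(1) in \<open>metis zero_index\<close>)
    with x show False by simp
  qed
  then show False using assms(2) by (simp add: classical_curl_def vec_eq_iff forall_3)
qed

lemma locally_integrable_UNIV_measurable:
  fixes u :: "real^3 \<Rightarrow> 'b::euclidean_space"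
  assumes "locally_integrable UNIV u" shows "u \<in> borel_measurable lebesgue"
proof (rule borel_measurable_LIMSEQ_metric)
  fix n :: nat
  have "u absolutely_integrable_on cball 0 (real n)"
    using assms by (auto simp: locally_integrable_def)
  then show "(\<lambda>x. indicator (cball 0 (real n)) x *\<^sub>R u x) \<in> borel_measurable lebesgue"
    by (simp add: set_integrable_def borel_measurable_integrable)
next
  fix x :: "real^3"
  obtain n0 :: nat where "norm x \<le> n0" using real_arch_simple by blast
  then have "\<forall>n\<ge>n0. indicator (cball 0 (real n)) x *\<^sub>R u x = u x" by (auto simp: indicator_def)
  then show "(\<lambda>n. indicator (cball 0 (real n)) x *\<^sub>R u x) \<longlonglongrightarrow> u x"
    by (intro tendsto_eventually) (auto simp: eventually_sequentially)
qed

text \<open>The test field has compact support, so \<open>f\<close> may be extended from a compact interval of values of \<open>g\<close> to the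
  real line; then the six terms of \<open>w \<bullet> curl \<Phi>\<close> cancel in pairs by \<open>composite_gradient_closed\<close>.\<close>

lemma composite_gradient_curl_free:
  assumes g: "has_weak_gradient UNIV g w" "continuous_on UNIV g"
    and f: "continuous_on (range g) f"
    and u: "locally_integrable UNIV u" "AE x in lebesgue. u x = f (g x) *\<^sub>R w x"
  shows "has_weak_curl UNIV u (\<lambda>x. 0)"
proof -
  have "(LINT x|lebesgue. u x \<bullet> classical_curl \<Phi> x) = 0" if \<Phi>: "test_function UNIV \<Phi>" for \<Phi>
  proof -
    have Ck: "\<And>k. C_k k \<Phi>" using \<Phi> by (simp add: test_function_def)
    have "bounded (closure {x. \<Phi> x \<noteq> 0})"
      using \<Phi> by (simp add: test_function_def compact_imp_bounded)
    then obtain r' where r': "0 < r'" "\<And>x. x \<in> closure {x. \<Phi> x \<noteq> 0} \<Longrightarrow> norm x \<le> r'"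
      by (auto simp: bounded_pos)
    have supp: "x \<in> cball 0 r'" if "\<Phi> x \<noteq> 0" for x
      using r'(2)[of x] that closure_subset[of "{x. \<Phi> x \<noteq> 0}"] by auto
    have r': "0 \<le> r'" using r' by simp
    have "connected (g ` cball 0 r')" "compact (g ` cball 0 r')"
      by (intro connected_continuous_image compact_continuous_image continuous_on_subset[OF g(2)]; simp)+
    then obtain a b where ab: "g ` cball 0 r' = {a..b}"
      using connected_compact_interval_1 by metis
    have "g 0 \<in> {a..b}" using r' by (subst ab[symmetric]) auto
    then have ne: "a \<le> b" by simp
    \<comment> \<open>on a ball containing the support of \<open>\<Phi>\<close> the values of \<open>g\<close> fill a compact interval, so clamping extends \<open>f\<close> to the real line\<close>
    define h where "h y = f (max a (min b y))" for y
    have clamp: "max a (min b y) \<in> range g" for y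
    proof -
      have "max a (min b y) \<in> {a..b}" using ne by simp
      then show ?thesis using ab by blast
    qed
    have h: "continuous_on UNIV h"
      unfolding h_def by (rule continuous_on_compose2[OF f]) (use clamp in \<open>auto intro!: continuous_intros\<close>)
    have hg: "h (g x) = f (g x)" if "x \<in> cball 0 r'" for x
    proof -
      have "g x \<in> {a..b}" using ab that by blast
      then show ?thesis by (simp add: h_def)
    qed
    have int: "integrable lebesgue (\<lambda>x. h (g x) * w x $ i * partial j (\<lambda>y. \<Phi> y $ k) x)" for i j k
    proof -
      have *: "continuous_on UNIV (\<lambda>x. h (g x) * partial j (\<lambda>y. \<Phi> y $ k) x)"
        using C_k_partial[OF C_k_component[OF Ck], of 0 j k]
        by (intro continuous_intros continuous_on_compose2[OF h g(2)]) auto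
      have "integrable lebesgue (\<lambda>x. w x $ i * (h (g x) * partial j (\<lambda>y. \<Phi> y $ k) x))"
      proof (rule integrable_mult_compact_support[OF _ compact_cball[of 0 r'] *])
        show "(\<lambda>x. w x $ i) absolutely_integrable_on cball 0 r'"
          using g(1) by (intro locally_integrable_UNIV_component) (simp_all add: has_weak_gradient_def)
        show "x \<in> cball 0 r'" if "h (g x) * partial j (\<lambda>y. \<Phi> y $ k) x \<noteq> 0" for x
        proof (rule partial_support)
          show "partial j (\<lambda>y. \<Phi> y $ k) x \<noteq> 0" using that by auto
          show "y \<in> cball 0 r'" if "\<Phi> y $ k \<noteq> 0" for y by (rule supp) (use that in auto)
        qed
      qed
      then show ?thesis by (simp add: mult_ac)
    qed
    define J where "J i j k = (LINT x|lebesgue. h (g x) * w x $ i * partial j (\<lambda>y. \<Phi> y $ k) x)" for i j k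
    have J: "J i j k = J j i k" for i j k
      unfolding J_def
    proof (rule composite_gradient_closed[OF g h C_k_component[OF Ck] _ r'])
      show "y \<in> cball 0 r'" if "\<Phi> y $ k \<noteq> 0" for y by (rule supp) (use that in auto)
    qed
    have "(LINT x|lebesgue. u x \<bullet> classical_curl \<Phi> x) = (LINT x|lebesgue. (h (g x) *\<^sub>R w x) \<bullet> classical_curl \<Phi> x)"
    proof (rule integral_cong_AE)
      let ?m = "borel_measurable lebesgue"
      have curl_m: "classical_curl \<Phi> \<in> ?m"
      proof -
        have "continuous_on UNIV (\<lambda>x. classical_curl \<Phi> x $ i)" for i
          using C_k_partial[OF C_k_component[OF Ck], of 0]
          using exhaust_3[of i] by (auto simp: classical_curl_def intro!: continuous_on_diff)
        then have "continuous_on UNIV (\<lambda>x. \<chi> i. classical_curl \<Phi> x $ i)" by (intro continuous_on_vec_lambda)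
        then show ?thesis using continuous_imp_lebesgue_measurable by simp
      qed
      have w_m: "w \<in> ?m"
        using g(1) by (intro locally_integrable_UNIV_measurable) (simp add: has_weak_gradient_def)
      have h_m: "(\<lambda>x. h (g x)) \<in> ?m"
        by (intro continuous_imp_lebesgue_measurable continuous_on_compose2[OF h g(2)]) auto
      have u_m: "u \<in> ?m" by (rule locally_integrable_UNIV_measurable[OF u(1)])
      show "(\<lambda>x. u x \<bullet> classical_curl \<Phi> x) \<in> ?m" using u_m curl_m by (rule borel_measurable_inner)
      show "(\<lambda>x. (h (g x) *\<^sub>R w x) \<bullet> classical_curl \<Phi> x) \<in> ?m"
        by (intro borel_measurable_inner borel_measurable_scaleR h_m w_m curl_m)
      show "AE x in lebesgue. u x \<bullet> classical_curl \<Phi> x = (h (g x) *\<^sub>R w x) \<bullet> classical_curl \<Phi> x"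
        using u(2)
      proof eventually_elim
        case (elim x)
        show ?case
        proof (cases "x \<in> cball 0 r'")
          case True then show ?thesis using hg elim by simp
        next
          case False
          then have "classical_curl \<Phi> x = 0" using curl_support[of \<Phi> r' x] supp by blast
          then show ?thesis by simp
        qed
      qed
    qed
    also have "\<dots> = (LINT x|lebesgue.
         h (g x) * w x $ 1 * partial 2 (\<lambda>y. \<Phi> y $ 3) x - h (g x) * w x $ 1 * partial 3 (\<lambda>y. \<Phi> y $ 2) x
       + (h (g x) * w x $ 2 * partial 3 (\<lambda>y. \<Phi> y $ 1) x - h (g x) * w x $ 2 * partial 1 (\<lambda>y. \<Phi> y $ 3) x)
       + (h (g x) * w x $ 3 * partial 1 (\<lambda>y. \<Phi> y $ 2) x - h (g x) * w x $ 3 * partial 2 (\<lambda>y. \<Phi> y $ 1) x))"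
      by (rule Bochner_Integration.integral_cong[OF refl])
         (simp add: classical_curl_def inner_vec_def sum_3 algebra_simps)
    also have "\<dots> = J 1 2 3 - J 1 3 2 + (J 2 3 1 - J 2 1 3) + (J 3 1 2 - J 3 2 1)"
      unfolding J_def
      by (simp only: int Bochner_Integration.integral_add Bochner_Integration.integral_diff
          Bochner_Integration.integrable_add Bochner_Integration.integrable_diff)
    also have "\<dots> = 0" using J[of 1 2 3] J[of 1 3 2] J[of 2 3 1] by simp
    finally show ?thesis .
  qed
  moreover have "locally_integrable UNIV (\<lambda>x::real^3. 0::real^3)" by (simp add: locally_integrable_def)
  ultimately show ?thesis using u(1) by (simp add: has_weak_curl_def lebesgue_on_UNIV_eq)
qed

lemma has_weak_curl_0_open_subset:
  assumes u: "has_weak_curl UNIV u (\<lambda>x. 0)" and \<Omega>: "open \<Omega>"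
  shows "has_weak_curl \<Omega> u (\<lambda>x. 0)"
  unfolding has_weak_curl_def
proof (intro conjI allI impI)
  show "locally_integrable \<Omega> u" "locally_integrable \<Omega> (\<lambda>x. 0 :: real^3)"
    using u by (auto simp: has_weak_curl_def locally_integrable_def)
  fix \<Phi> :: "real^3 \<Rightarrow> real^3" assume \<Phi>: "test_function \<Omega> \<Phi>"
  then have "test_function UNIV \<Phi>" by (simp add: test_function_def)
  then have "(LINT x|lebesgue. u x \<bullet> classical_curl \<Phi> x) = 0"
    using u by (simp add: has_weak_curl_def lebesgue_on_UNIV_eq)
  moreover have "classical_curl \<Phi> x = 0" if "x \<notin> \<Omega>" for x
  proof -
    let ?K = "closure {x. \<Phi> x \<noteq> 0}"
    have x: "x \<notin> ?K" using \<Phi> that by (auto simp: test_function_def)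
    have "partial i (\<lambda>y. \<Phi> y $ j) x = 0" for i j
    proof -
      have "y \<in> ?K" if "\<Phi> y $ j \<noteq> 0" for y
        using that closure_subset[of "{x. \<Phi> x \<noteq> 0}"] by auto
      from frechet_derivative_outside_support[where f="\<lambda>y. \<Phi> y $ j", OF closed_closure this x]
      show ?thesis by (simp add: partial_def)
    qed
    then show ?thesis by (simp add: classical_curl_def vec_eq_iff forall_3)
  qed
  then have "(LINT x|lebesgue_on \<Omega>. u x \<bullet> classical_curl \<Phi> x) = (LINT x|lebesgue. u x \<bullet> classical_curl \<Phi> x)"
    using \<Omega> by (intro LINT_lebesgue_on_eq) (auto simp: lborelD)
  ultimately show "(LINT x|lebesgue_on \<Omega>. u x \<bullet> classical_curl \<Phi> x) = (LINT x|lebesgue_on \<Omega>. 0 \<bullet> \<Phi> x)"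
    by simp
qed

section \<open>Oscillators with prescribed period\<close>

text \<open>Throughout \<open>a = (p+1)/2\<close>. Put \<open>z = cos \<theta>\<close> in \<open>z'' + z + \<beta> |z|\<^sup>2\<^sup>a\<^sup>-\<^sup>2 z = 0\<close>. Conservation of energy from \<open>z = 1\<close>,
  \<open>z' = 0\<close> reads \<open>z'\<^sup>2 = 1 - z\<^sup>2 + (\<beta>/a) (1 - |z|\<^sup>2\<^sup>a)\<close>; division by \<open>sin\<^sup>2 \<theta> = 1 - z\<^sup>2\<close> turns this into
  \<open>\<theta>'\<^sup>2 = 1 + (\<beta>/a) \<rho>(cos\<^sup>2 \<theta>)\<close> with \<open>\<rho>(v) = (1 - v\<^sup>a)/(1 - v)\<close>. The right-hand side is continuous and
  positive for \<open>\<beta> > -1\<close>, also at the turning points, so the time needed to reach an angle is an ordinary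
  integral, and monotonicity and bounds of the period can be read off its integrand.\<close>

lemma one_minus_powr_bounds:
  fixes v r :: real
  assumes v: "0 \<le> v" "v \<le> 1" and r: "r \<ge> 1"
  shows "1 - v powr r \<le> r * (1 - v)" "r * v powr (r - 1) * (1 - v) \<le> 1 - v powr r" "1 - v \<le> 1 - v powr r"
proof -
  have "1 - v powr r \<le> r * (1 - v) \<and> r * v powr (r - 1) * (1 - v) \<le> 1 - v powr r"
  proof (cases "v = 0 \<or> v = 1")
    case True then show ?thesis using r by auto
  next
    case False
    with v have v': "0 < v" "v < 1" by auto
    have "\<exists>\<xi>. v < \<xi> \<and> \<xi> < 1 \<and> 1 powr r - v powr r = (1 - v) * (r * \<xi> powr (r - 1))"
      by (rule MVT2[OF v'(2)]) (use v' in \<open>auto intro!: derivative_eq_intros\<close>)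
    then obtain \<xi> where \<xi>: "v < \<xi>" "\<xi> < 1" "1 - v powr r = (1 - v) * (r * \<xi> powr (r - 1))" by auto
    have "\<xi> powr (r - 1) \<le> 1" "v powr (r - 1) \<le> \<xi> powr (r - 1)"
      using \<xi> v' r by (auto intro!: powr_mono2 powr_le1)
    then have "(1 - v) * (r * \<xi> powr (r - 1)) \<le> (1 - v) * (r * 1)"
        "(1 - v) * (r * v powr (r - 1)) \<le> (1 - v) * (r * \<xi> powr (r - 1))"
      using v r by (intro mult_left_mono; simp)+
    then show ?thesis unfolding \<xi>(3) by (simp add: mult_ac)
  qed
  then show "1 - v powr r \<le> r * (1 - v)" "r * v powr (r - 1) * (1 - v) \<le> 1 - v powr r" by auto
  show "1 - v \<le> 1 - v powr r"
    using powr_mono_both'[of 1 r v v] v r by (cases "v = 0") auto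
qed

definition rho :: "real \<Rightarrow> real \<Rightarrow> real" where
  "rho a v = (if v = 1 then a else (1 - v powr a) / (1 - v))"

lemma rho_mult: "rho a v * (1 - v) = 1 - v powr a"
  by (simp add: rho_def)

lemma rho_bounds:
  assumes v: "0 \<le> v" "v \<le> 1" and a: "a \<ge> 1"
  shows "1 \<le> rho a v" "rho a v \<le> a" "a * v powr (a - 1) \<le> rho a v"
  using one_minus_powr_bounds[OF v a] v a by (auto simp: rho_def field_simps)

lemma rho_continuous:
  assumes a: "a \<ge> 1" shows "continuous_on {0..1} (rho a)"
  unfolding continuous_on_def
proof
  fix v :: real assume v: "v \<in> {0..1}"
  show "(rho a \<longlongrightarrow> rho a v) (at v within {0..1})"
  proof (cases "v = 1")
    case True
    have "((\<lambda>x. x powr a) has_real_derivative a) (at 1 within {0..1})"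
      by (auto intro!: derivative_eq_intros)
    then have "((\<lambda>y. (y powr a - 1) / (y - 1)) \<longlongrightarrow> a) (at 1 within {0..1})"
      by (simp add: has_field_derivative_iff)
    moreover have "\<forall>\<^sub>F y in at 1 within {0..1}. (y powr a - 1) / (y - 1) = rho a y"
      by (auto simp: eventually_at_filter rho_def field_simps)
    ultimately have "(rho a \<longlongrightarrow> a) (at 1 within {0..1})" by (rule Lim_transform_eventually)
    then show ?thesis using True by (simp add: rho_def)
  next
    case False
    have "((\<lambda>y. (1 - y powr a) / (1 - y)) \<longlongrightarrow> (1 - v powr a) / (1 - v)) (at v within {0..1})"
      using False v a by (intro tendsto_intros) (auto simp: eventually_at_filter)
    moreover have "\<forall>\<^sub>F y in at v within {0..1}. (1 - y powr a) / (1 - y) = rho a y"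
    proof -
      have "\<forall>\<^sub>F y in at v within {0..1}. y \<noteq> 1"
        using False by (rule tendsto_imp_eventually_ne[OF tendsto_ident_at])
      then show ?thesis by eventually_elim (simp add: rho_def)
    qed
    ultimately have "(rho a \<longlongrightarrow> (1 - v powr a) / (1 - v)) (at v within {0..1})" by (rule Lim_transform_eventually)
    then show ?thesis using False by (simp add: rho_def)
  qed
qed

text \<open>The square of the angular velocity.\<close>

definition speed2 :: "real \<Rightarrow> real \<Rightarrow> real \<Rightarrow> real" where
  "speed2 a \<beta> \<theta> = 1 + \<beta> / a * rho a ((cos \<theta>)\<^sup>2)"

lemma cos_sq_01: "0 \<le> (cos \<theta>)\<^sup>2" "(cos \<theta>)\<^sup>2 \<le> (1::real)"
  by (auto simp: abs_square_le_1)

lemma speed2_bounds: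
  assumes a: "a \<ge> 1" and \<beta>: "\<beta> > -1"
  shows "speed2 a \<beta> \<theta> > 0" "speed2 a \<beta> \<theta> \<le> 1 + \<bar>\<beta>\<bar>"
    "\<beta> \<ge> 0 \<Longrightarrow> 1 + \<beta> / a \<le> speed2 a \<beta> \<theta>" "\<beta> \<le> 0 \<Longrightarrow> speed2 a \<beta> \<theta> \<le> 1 + \<beta> / a"
proof -
  define X where "X = rho a ((cos \<theta>)\<^sup>2) / a"
  have rb: "1 \<le> rho a ((cos \<theta>)\<^sup>2)" "rho a ((cos \<theta>)\<^sup>2) \<le> a" using rho_bounds[OF cos_sq_01 a] by auto
  then have x: "1 / a \<le> X" "X \<le> 1" "0 \<le> 1 / a" using a by (auto simp: X_def divide_right_mono)
  have eq: "speed2 a \<beta> \<theta> = 1 + \<beta> * X" by (simp add: speed2_def X_def)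
  have "\<bar>X\<bar> \<le> 1" using x by linarith
  then have "\<bar>\<beta> * X\<bar> \<le> \<bar>\<beta>\<bar> * 1" unfolding abs_mult[of \<beta>] by (rule mult_left_mono) simp
  then show "speed2 a \<beta> \<theta> \<le> 1 + \<bar>\<beta>\<bar>" by (simp add: eq)
  show "speed2 a \<beta> \<theta> > 0"
  proof (cases "\<beta> \<ge> 0")
    case True
    then have "0 \<le> \<beta> * X" using x by (intro mult_nonneg_nonneg) linarith+
    then show ?thesis by (simp add: eq)
  next
    case False
    then have "\<beta> * 1 \<le> \<beta> * X" using x by (intro mult_left_mono_neg) auto
    then show ?thesis using \<beta> by (simp add: eq)
  qed
  show "1 + \<beta> / a \<le> speed2 a \<beta> \<theta>" if "\<beta> \<ge> 0"
    using mult_left_mono[OF x(1) that] by (simp add: eq)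
  show "speed2 a \<beta> \<theta> \<le> 1 + \<beta> / a" if "\<beta> \<le> 0"
    using mult_left_mono_neg[OF x(1) that] by (simp add: eq)
qed

lemma rho_cos_continuous: "a \<ge> 1 \<Longrightarrow> continuous_on S (\<lambda>\<theta>. rho a ((cos \<theta>)\<^sup>2))"
  by (rule continuous_on_compose2[OF rho_continuous]) (auto intro!: continuous_intros simp: abs_square_le_1)

definition slowness :: "real \<Rightarrow> real \<Rightarrow> real \<Rightarrow> real" where
  "slowness a \<beta> \<theta> = 1 / sqrt (speed2 a \<beta> \<theta>)"

text \<open>The integral of the slowness from \<open>0\<close> to \<open>\<theta>\<close>; written as a mean value it is correct for both signs of
  \<open>\<theta>\<close> and has a fixed domain of integration, which gives continuity in \<open>\<beta>\<close>.\<close>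

definition travel_time :: "real \<Rightarrow> real \<Rightarrow> real \<Rightarrow> real" where
  "travel_time a \<beta> \<theta> = mean_value (slowness a \<beta>) 0 \<theta> * \<theta>"

lemma slowness_continuous:
  assumes "a \<ge> 1" shows "continuous_on ({-1<..} \<times> UNIV) (\<lambda>(\<beta>, \<theta>). slowness a \<beta> \<theta>)"
proof -
  have "continuous_on ({-1<..} \<times> UNIV) (\<lambda>x. rho a ((cos (snd x))\<^sup>2))"
    by (rule continuous_on_compose2[OF rho_cos_continuous[OF assms]]) (auto intro!: continuous_intros)
  moreover have "sqrt (speed2 a \<beta> \<theta>) \<noteq> 0" if "\<beta> > -1" for \<beta> \<theta>
    using speed2_bounds(1)[OF assms that, of \<theta>] by simp
  ultimately show ?thesis
    unfolding slowness_def split_beta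
    by (intro continuous_on_divide continuous_on_real_sqrt continuous_on_const)
       (use assms in \<open>auto simp: speed2_def intro!: continuous_intros\<close>)
qed

lemma slowness_continuous_angle:
  assumes "a \<ge> 1" "\<beta> > -1" shows "continuous_on UNIV (slowness a \<beta>)"
proof -
  have "continuous_on UNIV (\<lambda>\<theta>. (\<beta>, \<theta>))" by (intro continuous_intros)
  from continuous_on_compose2[OF slowness_continuous[OF assms(1)] this] show ?thesis
    using assms(2) by auto
qed

lemma slowness_pos: "a \<ge> 1 \<Longrightarrow> \<beta> > -1 \<Longrightarrow> slowness a \<beta> \<theta> > 0"
  using speed2_bounds(1) by (simp add: slowness_def)

lemma travel_time_derivative:
  assumes "a \<ge> 1" "\<beta> > -1"
  shows "(travel_time a \<beta> has_real_derivative slowness a \<beta> \<theta>) (at \<theta>)"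
proof -
  obtain H where H: "\<And>r. (H has_real_derivative slowness a \<beta> r) (at r)"
    using continuous_has_antiderivative[OF slowness_continuous_angle[OF assms]] by blast
  have "travel_time a \<beta> = (\<lambda>\<theta>. H \<theta> - H 0)"
    using mean_value_antiderivative[OF H, of _ 0] by (simp add: travel_time_def fun_eq_iff)
  then show ?thesis using H by (auto intro!: derivative_eq_intros)
qed

lemma travel_time_0 [simp]: "travel_time a \<beta> 0 = 0" by (simp add: travel_time_def)

lemma travel_time_continuous_param:
  assumes a: "a \<ge> 1" shows "continuous_on {-1<..} (\<lambda>\<beta>. travel_time a \<beta> \<theta>)"
proof -
  have "continuous_on ({-1<..} \<times> cbox 0 1) (\<lambda>(\<beta>, s). slowness a \<beta> (0 + s * (\<theta> - 0)))"
  proof -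
    have "continuous_on ({-1<..} \<times> cbox 0 1) (\<lambda>x. (fst x, 0 + snd x * (\<theta> - 0)))"
      by (intro continuous_intros)
    moreover have "(\<lambda>x. (fst x, 0 + snd x * (\<theta> - 0))) ` ({-1<..} \<times> cbox 0 1) \<subseteq> {-1<..} \<times> UNIV" by auto
    ultimately show ?thesis
      using continuous_on_compose2[OF slowness_continuous[OF a]] by (fastforce simp: split_beta)
  qed
  from integral_continuous_on_param[OF this]
  show ?thesis unfolding travel_time_def mean_value_def
    by (intro continuous_intros) simp
qed

lemma travel_time_strict_mono:
  assumes "a \<ge> 1" "\<beta> > -1" shows "strict_mono (travel_time a \<beta>)"
proof (rule strict_monoI)
  have *: "\<exists>y. (travel_time a \<beta> has_real_derivative y) (at \<theta>) \<and> 0 < y" for \<theta>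
    by (intro exI[of _ "slowness a \<beta> \<theta>"] conjI travel_time_derivative slowness_pos assms)
  fix x y :: real assume "x < y"
  then show "travel_time a \<beta> x < travel_time a \<beta> y" by (rule DERIV_pos_imp_increasing) (rule *)
qed

lemma travel_time_ge:
  assumes "a \<ge> 1" "\<beta> > -1" "\<And>\<theta>. c \<le> slowness a \<beta> \<theta>" "x \<le> y"
  shows "c * (y - x) \<le> travel_time a \<beta> y - travel_time a \<beta> x"
proof -
  have "travel_time a \<beta> x - c * x \<le> travel_time a \<beta> y - c * y"
  proof (rule DERIV_nonneg_imp_nondecreasing[OF assms(4)])
    fix \<theta>
    have "((\<lambda>x. travel_time a \<beta> x - c * x) has_real_derivative slowness a \<beta> \<theta> - c) (at \<theta>)"
      by (auto intro!: derivative_eq_intros travel_time_derivative assms)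
    then show "\<exists>y. ((\<lambda>x. travel_time a \<beta> x - c * x) has_real_derivative y) (at \<theta>) \<and> 0 \<le> y"
      using assms(3)[of \<theta>] by (intro exI[of _ "slowness a \<beta> \<theta> - c"]) simp
  qed
  then show ?thesis by (simp add: algebra_simps)
qed

lemma travel_time_le:
  assumes "a \<ge> 1" "\<beta> > -1" "\<And>\<theta>. slowness a \<beta> \<theta> \<le> c" "x \<le> y"
  shows "travel_time a \<beta> y - travel_time a \<beta> x \<le> c * (y - x)"
proof -
  have "travel_time a \<beta> y - c * y \<le> travel_time a \<beta> x - c * x"
  proof (rule DERIV_nonpos_imp_nonincreasing[OF assms(4)])
    fix \<theta>
    have "((\<lambda>x. travel_time a \<beta> x - c * x) has_real_derivative slowness a \<beta> \<theta> - c) (at \<theta>)"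
      by (auto intro!: derivative_eq_intros travel_time_derivative assms)
    then show "\<exists>y. ((\<lambda>x. travel_time a \<beta> x - c * x) has_real_derivative y) (at \<theta>) \<and> y \<le> 0"
      using assms(3)[of \<theta>] by (intro exI[of _ "slowness a \<beta> \<theta> - c"]) simp
  qed
  then show ?thesis by (simp add: algebra_simps)
qed

definition period :: "real \<Rightarrow> real \<Rightarrow> real" where
  "period a \<beta> = travel_time a \<beta> (2 * pi)"

lemma travel_time_add_2pi:
  assumes "a \<ge> 1" "\<beta> > -1"
  shows "travel_time a \<beta> (\<theta> + 2 * pi) = travel_time a \<beta> \<theta> + period a \<beta>"
proof -
  have "((\<lambda>\<theta>. travel_time a \<beta> (\<theta> + 2 * pi) - travel_time a \<beta> \<theta>) has_real_derivative 0) (at \<theta>)" for \<theta>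
  proof -
    have "((\<lambda>\<theta>. travel_time a \<beta> (\<theta> + 2 * pi)) has_real_derivative slowness a \<beta> (\<theta> + 2 * pi) * 1) (at \<theta>)"
      by (rule DERIV_chain2[OF travel_time_derivative[OF assms]]) (auto intro!: derivative_eq_intros)
    moreover have "slowness a \<beta> (\<theta> + 2 * pi) = slowness a \<beta> \<theta>" by (simp add: slowness_def speed2_def)
    ultimately show ?thesis using DERIV_diff travel_time_derivative[OF assms, of \<theta>] by fastforce
  qed
  from DERIV_isconst_all[of "\<lambda>\<theta>. travel_time a \<beta> (\<theta> + 2 * pi) - travel_time a \<beta> \<theta>" \<theta> 0] this
  show ?thesis by (simp add: period_def)
qed

lemma period_strict_antimono:
  assumes a: "a \<ge> 1" and \<beta>: "-1 < \<beta>1" "\<beta>1 < \<beta>2"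
  shows "period a \<beta>2 < period a \<beta>1"
proof -
  have \<beta>2: "-1 < \<beta>2" using \<beta> by simp
  have lt: "slowness a \<beta>2 \<theta> < slowness a \<beta>1 \<theta>" for \<theta>
  proof -
    have "\<beta>1 / a * rho a ((cos \<theta>)\<^sup>2) < \<beta>2 / a * rho a ((cos \<theta>)\<^sup>2)"
      using \<beta> a rho_bounds(1)[OF cos_sq_01 a, of \<theta>] by (intro mult_strict_right_mono divide_strict_right_mono) auto
    then have "speed2 a \<beta>1 \<theta> < speed2 a \<beta>2 \<theta>" by (simp add: speed2_def)
    then show ?thesis unfolding slowness_def
      using speed2_bounds(1)[OF a \<beta>(1), of \<theta>] by (intro divide_strict_left_mono) (auto intro!: mult_pos_pos)
  qed
  have "travel_time a \<beta>1 0 - travel_time a \<beta>2 0 < travel_time a \<beta>1 (2 * pi) - travel_time a \<beta>2 (2 * pi)"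
  proof (rule DERIV_pos_imp_increasing[where f="\<lambda>\<theta>. travel_time a \<beta>1 \<theta> - travel_time a \<beta>2 \<theta>"])
    fix \<theta>
    have "((\<lambda>\<theta>. travel_time a \<beta>1 \<theta> - travel_time a \<beta>2 \<theta>) has_real_derivative slowness a \<beta>1 \<theta> - slowness a \<beta>2 \<theta>) (at \<theta>)"
      by (intro DERIV_diff travel_time_derivative a \<beta> \<beta>2)
    then show "\<exists>y. ((\<lambda>\<theta>. travel_time a \<beta>1 \<theta> - travel_time a \<beta>2 \<theta>) has_real_derivative y) (at \<theta>) \<and> 0 < y"
      using lt[of \<theta>] by (intro exI[of _ "slowness a \<beta>1 \<theta> - slowness a \<beta>2 \<theta>"]) simp
  qed simp
  then show ?thesis by (simp add: period_def)
qed

lemma period_0: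
  assumes "a \<ge> 1" shows "period a 0 = 2 * pi"
proof -
  have "slowness a 0 \<theta> = 1" for \<theta> by (simp add: slowness_def speed2_def)
  then show ?thesis using travel_time_ge[of a 0 1 0 "2*pi"] travel_time_le[of a 0 1 0 "2*pi"] assms
    by (simp add: period_def)
qed

text \<open>These bounds come from \<open>\<rho> \<ge> 1\<close>. They control \<open>\<beta>\<close> by the deviation of the period from \<open>2\<pi>\<close>, which is the source
  of the spatial decay.\<close>

lemma period_bounds:
  assumes a: "a \<ge> 1" and \<beta>: "\<beta> > -1"
  shows "\<beta> \<ge> 0 \<Longrightarrow> period a \<beta> \<le> 2 * pi / sqrt (1 + \<beta> / a)"
    "\<beta> \<le> 0 \<Longrightarrow> 2 * pi / sqrt (1 + \<beta> / a) \<le> period a \<beta>"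
proof -
  have a\<beta>: "1 + \<beta> / a > 0" using a \<beta> by (simp add: field_simps)
  show "period a \<beta> \<le> 2 * pi / sqrt (1 + \<beta> / a)" if "\<beta> \<ge> 0"
  proof -
    have "slowness a \<beta> \<theta> \<le> 1 / sqrt (1 + \<beta> / a)" for \<theta>
      unfolding slowness_def using speed2_bounds(3)[OF a \<beta> that, of \<theta>] a\<beta> 
      by (intro divide_left_mono) (auto intro!: mult_pos_pos)
    from travel_time_le[OF a \<beta> this, of 0 "2*pi"] show ?thesis by (simp add: period_def)
  qed
  show "2 * pi / sqrt (1 + \<beta> / a) \<le> period a \<beta>" if "\<beta> \<le> 0"
  proof -
    have "1 / sqrt (1 + \<beta> / a) \<le> slowness a \<beta> \<theta>" for \<theta>
      unfolding slowness_def using speed2_bounds(4)[OF a \<beta> that, of \<theta>] speed2_bounds(1)[OF a \<beta>, of \<theta>]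
      by (intro divide_left_mono) (auto intro!: mult_pos_pos a\<beta>)
    from travel_time_ge[OF a \<beta> this, of 0 "2*pi"] show ?thesis by (simp add: period_def)
  qed
qed

lemma powr_ge_linear:
  fixes v a :: real
  assumes v: "0 \<le> v" "v \<le> 1" and a: "a \<ge> 1"
  shows "1 - a * (1 - v) \<le> v powr (a - 1)"
proof (cases "a \<ge> 2")
  case True
  have "1 - v powr (a - 1) \<le> (a - 1) * (1 - v)" using True v by (intro one_minus_powr_bounds) auto
  also have "\<dots> \<le> a * (1 - v)" using v by (intro mult_right_mono) auto
  finally show ?thesis by simp
next
  case False
  have "v \<le> v powr (a - 1)" if "v > 0" using powr_mono_both'[of "a - 1" 1 v v] v False a that by auto
  moreover have "1 - a * (1 - v) \<le> 1 - 1 * (1 - v)" using a v by (intro diff_left_mono mult_right_mono) auto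
  ultimately show ?thesis using v a by (cases "v = 0") auto
qed

text \<open>As \<open>\<beta>\<close> tends to \<open>-1\<close> the equilibrium \<open>|\<beta>|\<^sup>-\<^sup>1\<^sup>/\<^sup>(\<^sup>p\<^sup>-\<^sup>1\<^sup>)\<close> approaches the starting point \<open>z = 1\<close>. With \<open>s\<^sup>2 = 1 + \<beta>\<close>
  the angular velocity is at most \<open>\<theta> sqrt (1 + a)\<close> for \<open>\<theta> \<ge> s\<close>, so the time spent up to \<open>\<theta> = 1\<close> is at
  least \<open>- ln s / sqrt (1 + a)\<close>.\<close>

lemma period_large:
  assumes a: "a \<ge> 1"
  obtains \<beta> where "-1 < \<beta>" "\<beta> < 0" "M < period a \<beta>"
proof -
  define s where "s = exp (- ((\<bar>M\<bar> + 1) * sqrt (1 + a)))"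
  define \<beta> where "\<beta> = s\<^sup>2 - 1"
  have "(\<bar>M\<bar> + 1) * sqrt (1 + a) > 0" using a by (intro mult_pos_pos) auto
  then have s: "0 < s" "s < 1" by (auto simp: s_def)
  then have "s\<^sup>2 < 1" by (simp add: abs_square_less_1)
  then have \<beta>: "-1 < \<beta>" "\<beta> < 0" using s by (auto simp: \<beta>_def)
  have low: "1 / (\<theta> * sqrt (1 + a)) \<le> slowness a \<beta> \<theta>" if "s \<le> \<theta>" for \<theta>
  proof -
    have \<theta>: "\<theta> > 0" using that s by simp
    have "1 - (cos \<theta>)\<^sup>2 \<le> \<theta>\<^sup>2"
      using abs_sin_x_le_abs_x[of \<theta>] by (simp add: cos_squared_eq abs_le_square_iff)
    then have "1 - a * \<theta>\<^sup>2 \<le> 1 - a * (1 - (cos \<theta>)\<^sup>2)" using a by (intro diff_left_mono mult_left_mono) auto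
    also have "\<dots> \<le> ((cos \<theta>)\<^sup>2) powr (a - 1)" by (rule powr_ge_linear[OF cos_sq_01 a])
    also have "\<dots> \<le> rho a ((cos \<theta>)\<^sup>2) / a"
      using rho_bounds(3)[OF cos_sq_01 a, of \<theta>] a by (simp add: field_simps)
    finally have "\<beta> * (rho a ((cos \<theta>)\<^sup>2) / a) \<le> \<beta> * (1 - a * \<theta>\<^sup>2)"
      using \<beta> by (intro mult_left_mono_neg) auto
    then have "speed2 a \<beta> \<theta> \<le> s\<^sup>2 + (- \<beta>) * (a * \<theta>\<^sup>2)" by (simp add: speed2_def \<beta>_def algebra_simps)
    also have "\<dots> \<le> \<theta>\<^sup>2 + 1 * (a * \<theta>\<^sup>2)"
      using s that \<beta> a by (intro add_mono mult_right_mono power_mono) auto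
    also have "\<dots> = (\<theta> * sqrt (1 + a))\<^sup>2" using a by (simp add: power_mult_distrib algebra_simps)
    finally have "sqrt (speed2 a \<beta> \<theta>) \<le> \<theta> * sqrt (1 + a)"
      using \<theta> a by (intro real_le_lsqrt) auto
    then show ?thesis unfolding slowness_def
      using speed2_bounds(1)[OF a \<beta>(1), of \<theta>] \<theta> a by (intro divide_left_mono) (auto intro!: mult_pos_pos)
  qed
  have "travel_time a \<beta> s - ln s / sqrt (1 + a) \<le> travel_time a \<beta> 1 - ln 1 / sqrt (1 + a)"
  proof (rule DERIV_nonneg_imp_nondecreasing[where f="\<lambda>x. travel_time a \<beta> x - ln x / sqrt (1 + a)"])
    fix \<theta> assume \<theta>: "s \<le> \<theta>" "\<theta> \<le> 1"
    have "((\<lambda>x. travel_time a \<beta> x - ln x / sqrt (1 + a)) has_real_derivative slowness a \<beta> \<theta> - 1 / (\<theta> * sqrt (1 + a))) (at \<theta>)"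
    proof -
      have "\<theta> > 0" using \<theta> s by simp
      from DERIV_diff[OF travel_time_derivative[OF a \<beta>(1)] DERIV_cdivide[OF DERIV_ln_divide[OF this], of "sqrt (1 + a)"]]
      show ?thesis by simp
    qed
    then show "\<exists>y. ((\<lambda>x. travel_time a \<beta> x - ln x / sqrt (1 + a)) has_real_derivative y) (at \<theta>) \<and> 0 \<le> y"
      using low[OF \<theta>(1)] by (intro exI[of _ "slowness a \<beta> \<theta> - 1 / (\<theta> * sqrt (1 + a))"]) simp
  qed (use s in simp)
  moreover have "ln s / sqrt (1 + a) = - (\<bar>M\<bar> + 1)" using a by (simp add: s_def)
  moreover have "travel_time a \<beta> s > 0" 
    using strict_monoD[OF travel_time_strict_mono[OF a \<beta>(1)] s(1)] by simp
  moreover have "travel_time a \<beta> 1 < period a \<beta>"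
    unfolding period_def using pi_gt3 by (intro strict_monoD[OF travel_time_strict_mono[OF a \<beta>(1)]]) simp
  ultimately have "M < period a \<beta>" by simp
  then show thesis using that \<beta> by blast
qed

lemma period_small:
  assumes a: "a \<ge> 1" and M: "M > 0"
  obtains \<beta> where "0 < \<beta>" "period a \<beta> < M"
proof -
  define \<beta> where "\<beta> = a * (2 * pi / M)\<^sup>2"
  have \<beta>: "\<beta> > 0" using a M by (simp add: \<beta>_def)
  have "period a \<beta> \<le> 2 * pi / sqrt (1 + \<beta> / a)" using \<beta> by (intro period_bounds a) auto
  also have "1 + \<beta> / a = 1 + (2 * pi / M)\<^sup>2" using a by (simp add: \<beta>_def)
  also have "2 * pi / sqrt (1 + (2 * pi / M)\<^sup>2) < 2 * pi / (2 * pi / M)"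
    using M by (intro divide_strict_left_mono real_less_rsqrt mult_pos_pos) (auto intro!: add_pos_nonneg)
  also have "\<dots> = M" by simp
  finally show thesis using that \<beta> by blast
qed

text \<open>Used twice, to invert the travel time in the angle and the period in \<open>\<beta>\<close>.\<close>

lemma implicit_function_continuous:
  fixes F :: "'p::topological_space \<Rightarrow> real \<Rightarrow> real"
  assumes S: "open S" and cont: "\<And>y. y \<in> S \<Longrightarrow> continuous_on U (\<lambda>p. F p y)"
    and mono: "\<And>p x y. p \<in> U \<Longrightarrow> x \<in> S \<Longrightarrow> y \<in> S \<Longrightarrow> x < y \<Longrightarrow> F p x < F p y"
    and G: "\<And>p. p \<in> U \<Longrightarrow> G p \<in> S" "\<And>p. p \<in> U \<Longrightarrow> F p (G p) = 0"
  shows "continuous_on U G"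
  unfolding continuous_on_def
proof
  fix p0 assume p0: "p0 \<in> U"
  obtain e where e: "e > 0" "ball (G p0) e \<subseteq> S" using S G(1)[OF p0] open_contains_ball by blast
  have inU: "\<forall>\<^sub>F p in at p0 within U. p \<in> U" by (simp add: eventually_at_filter)
  show "(G \<longlongrightarrow> G p0) (at p0 within U)"
  proof (rule order_tendstoI)
    fix l assume l: "l < G p0"
    define y where "y = max ((l + G p0) / 2) (G p0 - e / 2)"
    have y: "l < y" "y < G p0" "y \<in> S" using l e by (auto simp: y_def dist_real_def subset_iff max_def field_simps)
    have "F p0 y < 0" using mono[OF p0 y(3) G(1)[OF p0] y(2)] G(2)[OF p0] by simp
    then have "\<forall>\<^sub>F p in at p0 within U. F p y < 0"
      using cont[OF y(3)] p0 unfolding continuous_on_def by (intro order_tendstoD(2)) blast+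
    with inU show "\<forall>\<^sub>F p in at p0 within U. l < G p"
    proof eventually_elim
      case (elim p)
      have "\<not> G p \<le> y"
        using mono[OF elim(1) G(1)[OF elim(1)] y(3)] G(2)[OF elim(1)] elim(2) by (cases "G p = y") auto
      then show ?case using y(1) by simp
    qed
  next
    fix u assume u: "G p0 < u"
    define y where "y = min ((u + G p0) / 2) (G p0 + e / 2)"
    have y: "y < u" "G p0 < y" "y \<in> S" using u e by (auto simp: y_def dist_real_def subset_iff min_def field_simps)
    have "F p0 y > 0" using mono[OF p0 G(1)[OF p0] y(3) y(2)] G(2)[OF p0] by simp
    then have "\<forall>\<^sub>F p in at p0 within U. F p y > 0"
      using cont[OF y(3)] p0 unfolding continuous_on_def by (intro order_tendstoD(1)) blast+
    with inU show "\<forall>\<^sub>F p in at p0 within U. G p < u"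
    proof eventually_elim
      case (elim p)
      have "\<not> y \<le> G p"
        using mono[OF elim(1) y(3) G(1)[OF elim(1)]] G(2)[OF elim(1)] elim(2) by (cases "G p = y") auto
      then show ?case using y(1) by simp
    qed
  qed
qed

lemma travel_time_surj:
  assumes a: "a \<ge> 1" and \<beta>: "\<beta> > -1" shows "\<exists>\<theta>. travel_time a \<beta> \<theta> = t"
proof -
  define m where "m = 1 / sqrt (1 + \<bar>\<beta>\<bar>)"
  have m: "m > 0" by (simp add: m_def)
  have low: "m \<le> slowness a \<beta> \<theta>" for \<theta>
    unfolding m_def slowness_def using speed2_bounds(1,2)[OF a \<beta>, of \<theta>]
    by (intro divide_left_mono) (auto intro!: mult_pos_pos)
  define x where "x = \<bar>t\<bar> / m"
  have x: "x \<ge> 0" "m * x = \<bar>t\<bar>" using m by (auto simp: x_def)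
  have "travel_time a \<beta> (- x) \<le> t" "t \<le> travel_time a \<beta> x"
    using travel_time_ge[OF a \<beta> low, of 0 x] travel_time_ge[OF a \<beta> low, of "-x" 0] x by auto
  moreover have "\<forall>y. - x \<le> y \<and> y \<le> x \<longrightarrow> isCont (travel_time a \<beta>) y"
    using travel_time_derivative[OF a \<beta>] DERIV_isCont by blast
  ultimately show ?thesis using IVT[of "travel_time a \<beta>" "-x" t x] x by auto
qed

definition angle :: "real \<Rightarrow> real \<Rightarrow> real \<Rightarrow> real" where
  "angle a \<beta> t = inv (travel_time a \<beta>) t"

lemma travel_time_angle:
  assumes "a \<ge> 1" "\<beta> > -1" shows "travel_time a \<beta> (angle a \<beta> t) = t"
proof -
  have "surj (travel_time a \<beta>)" using travel_time_surj[OF assms] by (metis surjI)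
  then show ?thesis by (simp add: angle_def surj_f_inv_f)
qed

lemma angle_travel_time:
  assumes "a \<ge> 1" "\<beta> > -1" shows "angle a \<beta> (travel_time a \<beta> \<theta>) = \<theta>"
  unfolding angle_def
  by (rule inv_f_f) (rule strict_mono_imp_inj_on[OF travel_time_strict_mono[OF assms]])

lemma angle_continuous:
  assumes a: "a \<ge> 1" shows "continuous_on ({-1<..} \<times> UNIV) (\<lambda>p. angle a (fst p) (snd p))"
proof (rule implicit_function_continuous[where S=UNIV and F="\<lambda>p y. travel_time a (fst p) y - snd p"])
  show "continuous_on ({-1<..} \<times> UNIV) (\<lambda>p. travel_time a (fst p) y - snd p)" for y
    by (intro continuous_intros continuous_on_compose2[OF travel_time_continuous_param[OF a]]) auto
  show "travel_time a (fst p) x - snd p < travel_time a (fst p) y - snd p"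
    if "p \<in> {-1<..} \<times> UNIV" "x < y" for p x y
    using strict_monoD[OF travel_time_strict_mono[OF a] that(2), of "fst p"] that(1) by auto
qed (use travel_time_angle[OF a] in auto)

lemma angle_derivative:
  assumes a: "a \<ge> 1" and \<beta>: "\<beta> > -1"
  shows "(angle a \<beta> has_real_derivative sqrt (speed2 a \<beta> (angle a \<beta> t))) (at t)"
proof -
  have "continuous_on UNIV (\<lambda>t. angle a (fst (\<beta>, t)) (snd (\<beta>, t)))"
    by (rule continuous_on_compose2[OF angle_continuous[OF a]]) (use \<beta> in \<open>auto intro!: continuous_intros\<close>)
  then have "isCont (angle a \<beta>) t" by (simp add: continuous_on_eq_continuous_at)
  moreover have "slowness a \<beta> (angle a \<beta> t) \<noteq> 0" using slowness_pos[OF a \<beta>] by (simp add: less_imp_neq[symmetric])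
  ultimately have "(angle a \<beta> has_real_derivative inverse (slowness a \<beta> (angle a \<beta> t))) (at t)"
    by (intro DERIV_inverse_function[where a="t - 1" and b="t + 1" and f="travel_time a \<beta>"] travel_time_derivative a \<beta> travel_time_angle) auto
  then show ?thesis by (simp add: slowness_def)
qed

lemma angle_add_period:
  assumes "a \<ge> 1" "\<beta> > -1" shows "angle a \<beta> (t + period a \<beta>) = angle a \<beta> t + 2 * pi"
  using angle_travel_time[OF assms, of "angle a \<beta> t + 2 * pi"] travel_time_add_2pi[OF assms, of "angle a \<beta> t"]
    travel_time_angle[OF assms] by simp

lemma angle_0: "a \<ge> 1 \<Longrightarrow> \<beta> > -1 \<Longrightarrow> angle a \<beta> 0 = 0"
  using angle_travel_time[of a \<beta> 0] by simp

definition oscillation :: "real \<Rightarrow> real \<Rightarrow> real \<Rightarrow> real" where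
  "oscillation a \<beta> t = cos (angle a \<beta> t)"

definition oscillation' :: "real \<Rightarrow> real \<Rightarrow> real \<Rightarrow> real" where
  "oscillation' a \<beta> t = - sin (angle a \<beta> t) * sqrt (speed2 a \<beta> (angle a \<beta> t))"

lemma oscillation_derivative:
  assumes "a \<ge> 1" "\<beta> > -1"
  shows "(oscillation a \<beta> has_real_derivative oscillation' a \<beta> t) (at t)"
  unfolding oscillation_def oscillation'_def
  using DERIV_chain2[OF DERIV_cos angle_derivative[OF assms]] by simp

lemma oscillation_continuous:
  assumes a: "a \<ge> 1"
  shows "continuous_on ({-1<..} \<times> UNIV) (\<lambda>p. oscillation a (fst p) (snd p))"
    "continuous_on ({-1<..} \<times> UNIV) (\<lambda>p. oscillation' a (fst p) (snd p))"
  unfolding oscillation_def oscillation'_def speed2_def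
  using a by (auto intro!: continuous_intros angle_continuous continuous_on_compose2[OF rho_cos_continuous[where S=UNIV]])

lemma oscillation_add_period:
  assumes "a \<ge> 1" "\<beta> > -1" shows "oscillation a \<beta> (t + period a \<beta>) = oscillation a \<beta> t"
  by (simp add: oscillation_def angle_add_period assms)

lemma abs_oscillation_le_1: "\<bar>oscillation a \<beta> t\<bar> \<le> 1" by (simp add: oscillation_def)

lemma oscillation_0: "a \<ge> 1 \<Longrightarrow> \<beta> > -1 \<Longrightarrow> oscillation a \<beta> 0 = 1" by (simp add: oscillation_def angle_0)

lemma abs_powr_derivative:
  fixes z r :: real
  assumes r: "r > 1"
  shows "((\<lambda>z. \<bar>z\<bar> powr r) has_real_derivative r * \<bar>z\<bar> powr (r - 2) * z) (at z)"
proof (cases "z = 0")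
  case False
  have e: "r * \<bar>z\<bar> powr (r - 1) * sgn z = r * \<bar>z\<bar> powr (r - 2) * z"
  proof -
    have "\<bar>z\<bar> powr (r - 1) = \<bar>z\<bar> powr (r - 2) * \<bar>z\<bar> powr 1"
      using powr_add[of "\<bar>z\<bar>" "r - 2" 1] by simp
    then show ?thesis using False by (simp add: sgn_if abs_if)
  qed
  have "((\<lambda>z. \<bar>z\<bar> powr r) has_real_derivative r * \<bar>z\<bar> powr (r - 1) * sgn z) (at z)"
  proof (rule has_field_derivative_transform_within_open[where S="{y. 0 < sgn z * y}"])
    have "0 < sgn z * z" using False by (simp add: sgn_if)
    then show "((\<lambda>y. (sgn z * y) powr r) has_real_derivative r * \<bar>z\<bar> powr (r - 1) * sgn z) (at z)"
      by (auto intro!: derivative_eq_intros simp: abs_sgn mult.commute)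
    show "open {y. 0 < sgn z * y}" by (intro open_Collect_less continuous_intros)
    show "z \<in> {y. 0 < sgn z * y}" using False by (simp add: sgn_if)
    show "(sgn z * y) powr r = \<bar>y\<bar> powr r" if "y \<in> {y. 0 < sgn z * y}" for y
    proof -
      have "sgn z * y = \<bar>y\<bar>" using that by (auto simp: sgn_if split: if_splits)
      then show ?thesis by simp
    qed
  qed
  then show ?thesis unfolding e .
next
  case True
  have "((\<lambda>h. \<bar>h\<bar> powr (r - 1)) \<longlongrightarrow> \<bar>0::real\<bar> powr (r - 1)) (at 0)"
    using r by (intro tendsto_intros) auto
  then have "((\<lambda>h. \<bar>\<bar>h\<bar> powr (r - 1)\<bar>) \<longlongrightarrow> 0) (at (0::real))" by simp
  moreover have "\<forall>\<^sub>F h in at (0::real). \<bar>\<bar>h\<bar> powr (r - 1)\<bar> = \<bar>\<bar>h\<bar> powr r / h\<bar>"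
    by (auto simp: eventually_at_filter powr_diff abs_divide)
  ultimately have "((\<lambda>h::real. \<bar>\<bar>h\<bar> powr r / h\<bar>) \<longlongrightarrow> 0) (at 0)" by (rule Lim_transform_eventually)
  then have "((\<lambda>h::real. \<bar>h\<bar> powr r / h) \<longlongrightarrow> 0) (at 0)" by (rule tendsto_rabs_zero_cancel)
  then show ?thesis using True by (simp add: DERIV_def)
qed

text \<open>The square of the velocity, as a function of the position, at the energy of the orbit through \<open>z = 1\<close> at rest.\<close>

definition kinetic :: "real \<Rightarrow> real \<Rightarrow> real \<Rightarrow> real" where
  "kinetic a \<beta> z = 1 - z\<^sup>2 + \<beta> / a * (1 - \<bar>z\<bar> powr (2 * a))"

definition restoring :: "real \<Rightarrow> real \<Rightarrow> real \<Rightarrow> real" where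
  "restoring a \<beta> z = z + \<beta> * \<bar>z\<bar> powr (2 * a - 2) * z"

lemma kinetic_derivative:
  assumes "a > 1" shows "(kinetic a \<beta> has_real_derivative - 2 * restoring a \<beta> z) (at z)"
proof -
  have d1: "((\<lambda>z. 1 - z\<^sup>2) has_real_derivative - (2 * z)) (at z)"
    by (auto intro!: derivative_eq_intros)
  have d2: "((\<lambda>z. 1 - \<bar>z\<bar> powr (2 * a)) has_real_derivative 0 - 2 * a * \<bar>z\<bar> powr (2 * a - 2) * z) (at z)"
    by (rule DERIV_diff[OF DERIV_const abs_powr_derivative]) (use assms in simp)
  have "- (2 * z) + \<beta> / a * (0 - 2 * a * \<bar>z\<bar> powr (2 * a - 2) * z) = - 2 * restoring a \<beta> z"
    using assms by (simp add: restoring_def algebra_simps)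
  with DERIV_add[OF d1 DERIV_cmult[OF d2, of "\<beta> / a"]] show ?thesis
    by (simp only: kinetic_def[abs_def])
qed

lemma energy_conservation:
  assumes a: "a \<ge> 1" and \<beta>: "\<beta> > -1"
  shows "(oscillation' a \<beta> t)\<^sup>2 = kinetic a \<beta> (oscillation a \<beta> t)"
proof -
  let ?\<theta> = "angle a \<beta> t"
  have "(oscillation' a \<beta> t)\<^sup>2 = (sin ?\<theta>)\<^sup>2 * speed2 a \<beta> ?\<theta>"
    using speed2_bounds(1)[OF a \<beta>, of ?\<theta>] by (simp add: oscillation'_def power_mult_distrib)
  also have "\<dots> = (1 - (cos ?\<theta>)\<^sup>2) + \<beta> / a * (rho a ((cos ?\<theta>)\<^sup>2) * (1 - (cos ?\<theta>)\<^sup>2))"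
  proof -
    have "x * (1 + y * r) = x + y * (r * x)" for x y r :: real by (simp add: algebra_simps)
    then show ?thesis by (simp only: speed2_def sin_squared_eq)
  qed
  also have "rho a ((cos ?\<theta>)\<^sup>2) * (1 - (cos ?\<theta>)\<^sup>2) = 1 - ((cos ?\<theta>)\<^sup>2) powr a" by (rule rho_mult)
  also have "((cos ?\<theta>)\<^sup>2) powr a = \<bar>cos ?\<theta>\<bar> powr (2 * a)"
  proof (cases "cos ?\<theta> = 0")
    case False
    then show ?thesis using powr_powr[of "\<bar>cos ?\<theta>\<bar>" 2 a] by simp
  qed simp
  finally show ?thesis by (simp add: kinetic_def oscillation_def)
qed

text \<open>Away from turning points the velocity has constant sign locally and is a square root of the kinetic energy,
  so the chain rule applies to \<open>kinetic\<close> instead of \<open>rho\<close>.\<close>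

lemma oscillation'_derivative_regular:
  assumes a: "a > 1" and \<beta>: "\<beta> > -1" and s: "sin (angle a \<beta> t) \<noteq> 0"
  shows "(oscillation' a \<beta> has_real_derivative - restoring a \<beta> (oscillation a \<beta> t)) (at t)"
proof -
  have a': "a \<ge> 1" using a by simp
  define \<epsilon> where "\<epsilon> = - sgn (sin (angle a \<beta> t))"
  have \<epsilon>: "\<epsilon> * \<epsilon> = 1" using s by (simp add: \<epsilon>_def sgn_if)
  define U where "U = {r. \<epsilon> * sin (angle a \<beta> r) < 0}"
  have ac: "continuous_on UNIV (angle a \<beta>)"
    using angle_derivative[OF a' \<beta>] by (meson DERIV_isCont continuous_at_imp_continuous_on)
  have U: "open U" "t \<in> U"
    using s unfolding U_def by (auto intro!: open_Collect_less continuous_intros ac simp: \<epsilon>_def sgn_if)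
  have v: "oscillation' a \<beta> r = \<epsilon> * sqrt (kinetic a \<beta> (oscillation a \<beta> r))" if "r \<in> U" for r
  proof -
    have "\<epsilon> * oscillation' a \<beta> r = - (\<epsilon> * sin (angle a \<beta> r)) * sqrt (speed2 a \<beta> (angle a \<beta> r))"
      by (simp add: oscillation'_def)
    also have "\<dots> \<ge> 0" using that speed2_bounds(1)[OF a' \<beta>] by (intro mult_nonneg_nonneg) (auto simp: U_def less_imp_le)
    finally have "\<epsilon> * oscillation' a \<beta> r \<ge> 0" .
    moreover have "(\<epsilon> * oscillation' a \<beta> r)\<^sup>2 = kinetic a \<beta> (oscillation a \<beta> r)"
      using energy_conservation[OF a' \<beta>, of r] \<epsilon> by (simp add: power_mult_distrib power2_eq_square[of \<epsilon>])
    ultimately have "sqrt (kinetic a \<beta> (oscillation a \<beta> r)) = \<epsilon> * oscillation' a \<beta> r"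
      by (metis real_sqrt_abs abs_of_nonneg)
    then show ?thesis using \<epsilon> by (simp flip: mult.assoc)
  qed
  let ?k = "kinetic a \<beta> (oscillation a \<beta> t)"
  have o': "oscillation' a \<beta> t \<noteq> 0"
    using s speed2_bounds(1)[OF a' \<beta>, of "angle a \<beta> t"] by (simp add: oscillation'_def)
  then have k: "?k > 0" using energy_conservation[OF a' \<beta>, of t] by (metis zero_less_power2)
  have "((\<lambda>r. kinetic a \<beta> (oscillation a \<beta> r)) has_real_derivative - 2 * restoring a \<beta> (oscillation a \<beta> t) * oscillation' a \<beta> t) (at t)"
    by (rule DERIV_chain2[OF kinetic_derivative[OF a] oscillation_derivative[OF a' \<beta>]])
  from DERIV_cmult[OF DERIV_chain2[OF DERIV_real_sqrt[OF k] this], of \<epsilon>]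
  have "((\<lambda>r. \<epsilon> * sqrt (kinetic a \<beta> (oscillation a \<beta> r))) has_real_derivative
      \<epsilon> * (inverse (sqrt ?k) / 2 * (- 2 * restoring a \<beta> (oscillation a \<beta> t) * oscillation' a \<beta> t))) (at t)" .
  moreover have "\<epsilon> * (inverse (sqrt ?k) / 2 * (- 2 * restoring a \<beta> (oscillation a \<beta> t) * oscillation' a \<beta> t)) = - restoring a \<beta> (oscillation a \<beta> t)"
  proof -
    have "oscillation' a \<beta> t = \<epsilon> * sqrt ?k" by (rule v[OF U(2)])
    then have "\<epsilon> * (inverse (sqrt ?k) / 2 * (- 2 * restoring a \<beta> (oscillation a \<beta> t) * oscillation' a \<beta> t))
       = (\<epsilon> * \<epsilon>) * (inverse (sqrt ?k) * sqrt ?k) * (- restoring a \<beta> (oscillation a \<beta> t))" by simp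
    then show ?thesis using k \<epsilon> by simp
  qed
  ultimately have "((\<lambda>r. \<epsilon> * sqrt (kinetic a \<beta> (oscillation a \<beta> r))) has_real_derivative - restoring a \<beta> (oscillation a \<beta> t)) (at t)"
    by (simp only:)
  then show ?thesis
    by (rule has_field_derivative_transform_within_open[OF _ U]) (simp add: v)
qed

lemma restoring_continuous:
  assumes "a > 1" shows "continuous_on UNIV (restoring a \<beta>)"
  unfolding restoring_def
  by (intro continuous_intros continuous_on_powr') (use assms in auto)

text \<open>Turning points are isolated and the formula for the derivative is continuous across them, so l'Hospital's rule
  extends it.\<close>

lemma oscillation'_derivative:
  assumes a: "a > 1" and \<beta>: "\<beta> > -1"
  shows "(oscillation' a \<beta> has_real_derivative - restoring a \<beta> (oscillation a \<beta> t)) (at t)"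
proof (cases "sin (angle a \<beta> t) = 0")
  case False
  then show ?thesis by (rule oscillation'_derivative_regular[OF assms])
next
  case True
  have a': "a \<ge> 1" using a by simp
  let ?L = "- restoring a \<beta> (oscillation a \<beta> t)"
  have ac: "isCont (angle a \<beta>) r" for r
    using angle_derivative[OF a' \<beta>] DERIV_isCont by blast
  have oc: "isCont (oscillation a \<beta>) r" for r
    using oscillation_derivative[OF a' \<beta>] DERIV_isCont by blast
  have o'c: "isCont (oscillation' a \<beta>) t"
  proof -
    have "continuous_on UNIV (\<lambda>t. oscillation' a (fst (\<beta>, t)) (snd (\<beta>, t)))"
      by (rule continuous_on_compose2[OF oscillation_continuous(2)[OF a']]) (use \<beta> in \<open>auto intro!: continuous_intros\<close>)
    then show ?thesis by (simp add: continuous_on_eq_continuous_at)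
  qed
  have regular: "\<forall>\<^sub>F r in at t. sin (angle a \<beta> r) \<noteq> 0"
  proof -
    have "\<forall>\<^sub>F r in at t. dist (angle a \<beta> r) (angle a \<beta> t) < pi"
      using ac[of t] by (intro tendstoD) (auto simp: isCont_def)
    moreover have "\<forall>\<^sub>F r in at t. r \<noteq> t" by (simp add: eventually_at_filter)
    ultimately show ?thesis
    proof eventually_elim
      case (elim r)
      show ?case
      proof
        assume "sin (angle a \<beta> r) = 0"
        then obtain i where i: "angle a \<beta> r = of_int i * pi" by (auto simp: sin_zero_iff_int2)
        obtain j where j: "angle a \<beta> t = of_int j * pi" using True by (auto simp: sin_zero_iff_int2)
        have "\<bar>of_int (i - j) * pi\<bar> < pi" using elim(1) by (simp add: i j dist_real_def left_diff_distrib)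
        then have "\<bar>of_int (i - j) :: real\<bar> < 1" by (simp add: abs_mult)
        then have "i = j" by linarith
        then have "angle a \<beta> r = angle a \<beta> t" by (simp add: i j)
        then have "r = t" using travel_time_angle[OF a' \<beta>] by metis
        with elim show False by simp
      qed
    qed
  qed
  have "((\<lambda>r. (oscillation' a \<beta> r - oscillation' a \<beta> t) / (r - t)) \<longlongrightarrow> ?L) (at t)"
  proof (rule lhopital[where f'="\<lambda>r. - restoring a \<beta> (oscillation a \<beta> r)" and g'="\<lambda>r. 1"])
    show "((\<lambda>r. oscillation' a \<beta> r - oscillation' a \<beta> t) \<longlongrightarrow> 0) (at t)"
      using o'c by (simp add: isCont_def LIM_zero)
    show "((\<lambda>r. r - t) \<longlongrightarrow> 0) (at t)" by (intro LIM_zero tendsto_ident_at)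
    show "\<forall>\<^sub>F r in at t. r - t \<noteq> 0" by (simp add: eventually_at_filter)
    show "\<forall>\<^sub>F r in at t. ((\<lambda>r. oscillation' a \<beta> r - oscillation' a \<beta> t) has_real_derivative - restoring a \<beta> (oscillation a \<beta> r)) (at r)"
      using regular
      by eventually_elim (auto intro!: derivative_eq_intros oscillation'_derivative_regular[OF assms])
    show "\<forall>\<^sub>F r in at t. ((\<lambda>r. r - t) has_real_derivative 1) (at r)"
      by (intro always_eventually) (auto intro!: derivative_eq_intros)
    have "isCont (restoring a \<beta>) (oscillation a \<beta> t)"
      using restoring_continuous[OF a] by (simp add: continuous_on_eq_continuous_at)
    then have "((\<lambda>r. restoring a \<beta> (oscillation a \<beta> r)) \<longlongrightarrow> restoring a \<beta> (oscillation a \<beta> t)) (at t)"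
      using oc[of t, unfolded isCont_def] by (rule isCont_tendsto_compose)
    then show "((\<lambda>r. - restoring a \<beta> (oscillation a \<beta> r) / 1) \<longlongrightarrow> ?L) (at t)" by (auto intro: tendsto_minus)
  qed simp
  then show ?thesis by (simp add: has_field_derivative_iff)
qed

lemma period_continuous: "a \<ge> 1 \<Longrightarrow> continuous_on {-1<..} (period a)"
  unfolding period_def by (rule travel_time_continuous_param)

text \<open>The inverse of the period map.\<close>

definition stiffness :: "real \<Rightarrow> real \<Rightarrow> real" where
  "stiffness a c = (SOME \<beta>. \<beta> > -1 \<and> period a \<beta> = c)"

lemma stiffness:
  assumes a: "a \<ge> 1" and c: "c > 0"
  shows "stiffness a c > -1" "period a (stiffness a c) = c"
proof -
  obtain \<beta>1 where b1: "-1 < \<beta>1" "\<beta>1 < 0" "c < period a \<beta>1" using period_large[OF a] by blast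
  obtain \<beta>2 where b2: "0 < \<beta>2" "period a \<beta>2 < c" using period_small[OF a c] by blast
  have "continuous_on {\<beta>1..\<beta>2} (period a)"
    by (rule continuous_on_subset[OF period_continuous[OF a]]) (use b1 in auto)
  then have "\<exists>x. \<beta>1 \<le> x \<and> x \<le> \<beta>2 \<and> period a x = c"
    using b1 b2 by (intro IVT2') auto
  then have "\<exists>\<beta>. \<beta> > -1 \<and> period a \<beta> = c" using b1(1) less_le_trans by blast
  from someI_ex[OF this] show "stiffness a c > -1" "period a (stiffness a c) = c" unfolding stiffness_def by auto
qed

lemma stiffness_continuous:
  assumes a: "a \<ge> 1" shows "continuous_on {0<..} (stiffness a)"
proof (rule implicit_function_continuous[where S="{-1<..}" and F="\<lambda>c \<beta>. c - period a \<beta>"])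
  show "c - period a x < c - period a y" if "x \<in> {-1<..}" "x < y" for c x y
    using period_strict_antimono[OF a, of x y] that by simp
qed (use stiffness[OF a] in \<open>auto intro!: continuous_intros\<close>)

lemma stiffness_sign:
  assumes a: "a \<ge> 1" and c: "c > 0"
  shows "c \<le> 2 * pi \<Longrightarrow> 0 \<le> stiffness a c" "2 * pi \<le> c \<Longrightarrow> stiffness a c \<le> 0"
    "c \<noteq> 2 * pi \<Longrightarrow> stiffness a c \<noteq> 0"
proof -
  note s = stiffness[OF a c] and p0 = period_0[OF a]
  show "0 \<le> stiffness a c" if "c \<le> 2 * pi"
    using period_strict_antimono[OF a s(1), of 0] s(2) p0 that by (cases "0 \<le> stiffness a c") auto
  show "stiffness a c \<le> 0" if "2 * pi \<le> c"
    using period_strict_antimono[OF a, of 0 "stiffness a c"] s(2) p0 that by (cases "stiffness a c \<le> 0") auto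
  show "stiffness a c \<noteq> 0" if "c \<noteq> 2 * pi" using s(2) p0 that by auto
qed

lemma abs_stiffness_le:
  assumes a: "a \<ge> 1" and c: "c > 0"
  shows "\<bar>stiffness a c\<bar> \<le> a * \<bar>(2 * pi / c)\<^sup>2 - 1\<bar>"
proof -
  define \<beta> where "\<beta> = stiffness a c"
  note s = stiffness[OF a c, folded \<beta>_def]
  have q: "1 + \<beta> / a > 0" using a s(1) by (simp add: field_simps)
  show ?thesis
  proof (cases "\<beta> \<ge> 0")
    case True
    have "c \<le> 2 * pi / sqrt (1 + \<beta> / a)" using period_bounds(1)[OF a s(1) True] s(2) by simp
    then have "sqrt (1 + \<beta> / a) \<le> 2 * pi / c" using c q by (simp add: field_simps)
    then have "1 + \<beta> / a \<le> (2 * pi / c)\<^sup>2" using q by (metis less_imp_le real_sqrt_le_iff real_sqrt_unique sqrt_le_D)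
    then have "\<beta> / a \<le> \<bar>(2 * pi / c)\<^sup>2 - 1\<bar>" by simp
    then show ?thesis using a True by (simp add: \<beta>_def[symmetric] field_simps)
  next
    case False
    have "2 * pi / sqrt (1 + \<beta> / a) \<le> c" using period_bounds(2)[OF a s(1)] False s(2) by simp
    then have "2 * pi / c \<le> sqrt (1 + \<beta> / a)" using c q by (simp add: field_simps)
    then have "(2 * pi / c)\<^sup>2 \<le> (sqrt (1 + \<beta> / a))\<^sup>2" using c by (intro power_mono) auto
    then have "(2 * pi / c)\<^sup>2 \<le> 1 + \<beta> / a" using q by simp
    then have "- \<beta> / a \<le> \<bar>(2 * pi / c)\<^sup>2 - 1\<bar>" by simp
    then show ?thesis using a False by (simp add: \<beta>_def[symmetric] field_simps)
  qed
qed

section \<open>Fields depending uniformly continuously on time\<close>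

text \<open>Local boundedness and continuity in time, uniform for \<open>x\<close> in compact sets. Sampling such
  a field at finitely many times gives step functions that converge to it uniformly on balls, hence in
  \<open>L\<^sup>2\<close>.\<close>

definition tame :: "(real \<Rightarrow> vfield) \<Rightarrow> bool" where
  "tame F \<longleftrightarrow> (\<forall>t. F t \<in> borel_measurable lebesgue) \<and>
     (\<forall>K a b. compact K \<longrightarrow> (\<exists>B. \<forall>t\<in>{a..b}. \<forall>x\<in>K. norm (F t x) \<le> B)) \<and>
     (\<forall>K a b e. compact K \<longrightarrow> e > 0 \<longrightarrow> (\<exists>d>0. \<forall>s\<in>{a..b}. \<forall>t\<in>{a..b}. \<bar>s - t\<bar> < d \<longrightarrow>
         (\<forall>x\<in>K. norm (F s x - F t x) \<le> e)))"

lemma tame_measurable: "tame F \<Longrightarrow> F t \<in> borel_measurable lebesgue"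
  by (simp add: tame_def)

lemma tame_bounded:
  assumes "tame F" "compact K"
  obtains B where "B > 0" "\<And>t x. t \<in> {a..b} \<Longrightarrow> x \<in> K \<Longrightarrow> norm (F t x) \<le> B"
proof -
  obtain B where "\<forall>t\<in>{a..b}. \<forall>x\<in>K. norm (F t x) \<le> B" using assms unfolding tame_def by metis
  then have "norm (F t x) \<le> max B 1" if "t \<in> {a..b}" "x \<in> K" for t x using that by force
  then show ?thesis using that[of "max B 1"] by auto
qed

lemma tame_uniform:
  assumes "tame F" "compact K" "e > 0"
  obtains d where "d > 0" "\<And>s t x. s \<in> {a..b} \<Longrightarrow> t \<in> {a..b} \<Longrightarrow> \<bar>s - t\<bar> < d \<Longrightarrow> x \<in> K \<Longrightarrow> norm (F s x - F t x) \<le> e"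
  using assms unfolding tame_def by metis

lemma tame_scaleR:
  assumes F: "tame F" and f: "continuous_on UNIV f"
  shows "tame (\<lambda>t x. f t *\<^sub>R F t x)"
  unfolding tame_def
proof (intro conjI allI impI)
  show "(\<lambda>x. f t *\<^sub>R F t x) \<in> borel_measurable lebesgue" for t
    using tame_measurable[OF F] by simp
  fix K :: "(real^3) set" and a b :: real assume K: "compact K"
  obtain B where B: "B > 0" "\<And>t x. t \<in> {a..b} \<Longrightarrow> x \<in> K \<Longrightarrow> norm (F t x) \<le> B"
    using tame_bounded[OF F K] by metis
  have "bounded (f ` {a..b})"
    using f by (intro compact_imp_bounded compact_continuous_image) (auto intro: continuous_on_subset)
  then obtain M where M: "M > 0" "\<And>t. t \<in> {a..b} \<Longrightarrow> \<bar>f t\<bar> \<le> M" by (auto simp: bounded_pos)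
  show "\<exists>B. \<forall>t\<in>{a..b}. \<forall>x\<in>K. norm (f t *\<^sub>R F t x) \<le> B"
    using B M by (intro exI[of _ "M * B"]) (auto intro!: mult_mono)
  fix e :: real assume e: "e > 0"
  obtain d1 where d1: "d1 > 0" "\<And>s t x. s \<in> {a..b} \<Longrightarrow> t \<in> {a..b} \<Longrightarrow> \<bar>s - t\<bar> < d1 \<Longrightarrow> x \<in> K \<Longrightarrow> norm (F s x - F t x) \<le> e / (2 * M)"
    using tame_uniform[OF F K, of "e / (2 * M)" a b] e M by (auto simp: field_simps)
  have "uniformly_continuous_on {a..b} f"
    using f by (intro compact_uniformly_continuous) (auto intro: continuous_on_subset)
  then obtain d2 where d2: "d2 > 0" "\<And>s t. s \<in> {a..b} \<Longrightarrow> t \<in> {a..b} \<Longrightarrow> \<bar>s - t\<bar> < d2 \<Longrightarrow> \<bar>f s - f t\<bar> < e / (2 * B)"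
    using e B unfolding uniformly_continuous_on_def dist_real_def
    by (metis abs_minus_commute mult_pos_pos zero_less_divide_iff zero_less_numeral)
  show "\<exists>d>0. \<forall>s\<in>{a..b}. \<forall>t\<in>{a..b}. \<bar>s - t\<bar> < d \<longrightarrow> (\<forall>x\<in>K. norm (f s *\<^sub>R F s x - f t *\<^sub>R F t x) \<le> e)"
  proof (intro exI[of _ "min d1 d2"] conjI ballI impI)
    show "0 < min d1 d2" using d1 d2 by simp
    fix s t x assume st: "s \<in> {a..b}" "t \<in> {a..b}" "\<bar>s - t\<bar> < min d1 d2" and x: "x \<in> K"
    have "f s *\<^sub>R F s x - f t *\<^sub>R F t x = f s *\<^sub>R (F s x - F t x) + (f s - f t) *\<^sub>R F t x"
      by (simp add: algebra_simps)
    also have "norm \<dots> \<le> \<bar>f s\<bar> * norm (F s x - F t x) + \<bar>f s - f t\<bar> * norm (F t x)"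
      by (rule norm_triangle_le) simp
    also have "\<dots> \<le> M * (e / (2 * M)) + (e / (2 * B)) * B"
      using st x M B d1(2)[of s t x] d2(2)[of s t] e
      by (intro add_mono mult_mono) (auto intro: less_imp_le)
    also have "\<dots> = e" using M B by simp
    finally show "norm (f s *\<^sub>R F s x - f t *\<^sub>R F t x) \<le> e" .
  qed
qed

lemma L2I:
  assumes "u \<in> borel_measurable lebesgue" "\<And>x. x \<in> ball c r \<Longrightarrow> norm (u x) \<le> B"
  shows "u \<in> L2 (ball c r)"
proof -
  have m: "u \<in> borel_measurable (lebesgue_on (ball c r))"
    using assms(1) by (simp add: measurable_restrict_space1)
  have "integrable (lebesgue_on (ball c r)) (\<lambda>x. (norm (u x))\<^sup>2)"
  proof (rule Bochner_Integration.integrable_bound)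
    show "integrable (lebesgue_on (ball c r)) (\<lambda>x. B\<^sup>2)"
      by (intro finite_measure.integrable_const finite_measure_lebesgue_on) auto
    show "(\<lambda>x. (norm (u x))\<^sup>2) \<in> borel_measurable (lebesgue_on (ball c r))"
      using m by measurable
    show "AE x in lebesgue_on (ball c r). norm ((norm (u x))\<^sup>2) \<le> norm (B\<^sup>2)"
      using assms(2) by (intro AE_I2) (auto intro!: power_mono)
  qed
  with m show ?thesis by (simp add: L2_def)
qed

lemma L2_norm_le:
  assumes "\<And>x. x \<in> ball c r \<Longrightarrow> norm (u x) \<le> B"  "B \<ge> 0"
  shows "L2_norm (ball c r) u \<le> B * sqrt (measure lebesgue (ball c r))"
proof -
  have "(LINT x|lebesgue_on (ball c r). (norm (u x))\<^sup>2) \<le> (LINT x|lebesgue_on (ball c r). B\<^sup>2)"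
  proof (rule integral_mono')
    show "integrable (lebesgue_on (ball c r)) (\<lambda>x. B\<^sup>2)"
      by (intro finite_measure.integrable_const finite_measure_lebesgue_on) auto
  qed (use assms in \<open>auto intro!: power_mono\<close>)
  also have "\<dots> = B\<^sup>2 * measure lebesgue (ball c r)"
    by (simp add: measure_restrict_space)
  finally have "L2_norm (ball c r) u \<le> sqrt (B\<^sup>2 * measure lebesgue (ball c r))"
    unfolding L2_norm_def by simp
  then show ?thesis using assms(2) by (simp add: real_sqrt_mult)
qed

lemma L2_norm_nonneg: "0 \<le> L2_norm \<Omega> u"
  by (simp add: L2_norm_def)

lemma tame_L2:
  assumes "tame F" shows "F t \<in> L2 (ball c r)"
proof -
  obtain B where "\<And>x. x \<in> cball c r \<Longrightarrow> norm (F t x) \<le> B"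
    using tame_bounded[OF assms compact_cball, of t t c r] by (metis atLeastAtMost_iff order_refl)
  then show ?thesis by (intro L2I[where B=B] tame_measurable assms) auto
qed

lemma tame_L2_norm_square_continuous:
  assumes F: "tame F"
  shows "continuous_on UNIV (\<lambda>t. (L2_norm (ball c r) (F t))\<^sup>2)"
proof -
  have eq: "(L2_norm (ball c r) (F t))\<^sup>2 = (LINT x|lebesgue_on (ball c r). (norm (F t x))\<^sup>2)" for t
    unfolding L2_norm_def by (simp add: integral_nonneg_AE)
  have "((\<lambda>t. (L2_norm (ball c r) (F t))\<^sup>2) \<longlongrightarrow> (L2_norm (ball c r) (F t0))\<^sup>2) (at t0)" for t0
  proof (subst tendsto_at_iff_sequentially, intro allI impI)
    fix X assume X: "\<forall>i. X i \<in> UNIV - {t0}" "X \<longlonglongrightarrow> t0"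
    from X(2) have "bounded (range X)" using convergent_imp_bounded by blast
    then obtain M where M: "\<And>n. \<bar>X n\<bar> \<le> M" by (auto simp: bounded_iff)
    have Mt: "\<bar>t0\<bar> \<le> M" using M X(2) by (intro LIMSEQ_le_const2[OF tendsto_rabs[OF X(2)]]) auto
    obtain B where B: "B > 0" "\<And>t x. t \<in> {-M..M} \<Longrightarrow> x \<in> cball c r \<Longrightarrow> norm (F t x) \<le> B"
      using tame_bounded[OF F compact_cball, of "-M" M c r] by metis
    have mm: "F t \<in> borel_measurable (lebesgue_on (ball c r))" for t
      using tame_measurable[OF F] by (simp add: measurable_restrict_space1)
    have "(\<lambda>n. LINT x|lebesgue_on (ball c r). (norm (F (X n) x))\<^sup>2) \<longlonglongrightarrow> (LINT x|lebesgue_on (ball c r). (norm (F t0 x))\<^sup>2)"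
    proof (rule integral_dominated_convergence[where w="\<lambda>x. B\<^sup>2"])
      show "integrable (lebesgue_on (ball c r)) (\<lambda>x. B\<^sup>2)"
        by (intro finite_measure.integrable_const finite_measure_lebesgue_on) auto
      show "(\<lambda>x. (norm (F t x))\<^sup>2) \<in> borel_measurable (lebesgue_on (ball c r))" 
           "(\<lambda>x. (norm (F t x))\<^sup>2) \<in> borel_measurable (lebesgue_on (ball c r))" for t
        using mm[of t] by measurable
      show "AE x in lebesgue_on (ball c r). norm ((norm (F (X n) x))\<^sup>2) \<le> B\<^sup>2" for n
        using B(2)[of "X n"] M[of n] by (intro AE_I2) (auto intro!: power_mono simp: abs_le_iff minus_le_iff)
      have "(\<lambda>n. F (X n) x) \<longlonglongrightarrow> F t0 x" if x: "x \<in> cball c r" for x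
      proof (rule LIMSEQ_I)
        fix e :: real assume "e > 0"
        then obtain d where d: "d > 0" "\<And>s t x. s \<in> {-M..M} \<Longrightarrow> t \<in> {-M..M} \<Longrightarrow> \<bar>s - t\<bar> < d \<Longrightarrow> x \<in> cball c r \<Longrightarrow> norm (F s x - F t x) \<le> e/2"
          using tame_uniform[OF F compact_cball, of "e/2" "-M" M c r] by (metis half_gt_zero)
        obtain N where "\<And>n. n \<ge> N \<Longrightarrow> \<bar>X n - t0\<bar> < d"
          using LIMSEQ_D[OF X(2) d(1)] by (auto simp: real_norm_def)
        then have "norm (F (X n) x - F t0 x) \<le> e / 2" if "n \<ge> N" for n
          using that M[of n] Mt x by (intro d(2)) auto
        then show "\<exists>no. \<forall>n\<ge>no. norm (F (X n) x - F t0 x) < e" using \<open>e > 0\<close> 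
          by (intro exI[of _ N]) force
      qed
      then show "AE x in lebesgue_on (ball c r). (\<lambda>n. (norm (F (X n) x))\<^sup>2) \<longlonglongrightarrow> (norm (F t0 x))\<^sup>2"
        by (intro AE_I2) (auto intro!: tendsto_intros)
    qed
    then show "((\<lambda>t. (L2_norm (ball c r) (F t))\<^sup>2) \<circ> X) \<longlonglongrightarrow> (L2_norm (ball c r) (F t0))\<^sup>2"
      by (simp add: eq o_def)
  qed
  then show ?thesis by (simp add: continuous_on_def)
qed

text \<open>Rounding \<open>t\<close> down to a multiple of \<open>1/(n+1)\<close> turns a field into a step function of time. The rounded time may
  leave the interval on the left by at most \<open>1\<close>, whence the recurring \<open>a - 1\<close>.\<close>

definition sample :: "nat \<Rightarrow> real \<Rightarrow> real" where
  "sample n t = of_int \<lfloor>(real n + 1) * t\<rfloor> / (real n + 1)"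

lemma sample_le:
  fixes t :: real
  shows "sample n t \<le> t" "t < sample n t + 1 / (real n + 1)"
proof -
  have "of_int \<lfloor>(real n + 1) * t\<rfloor> \<le> (real n + 1) * t" "(real n + 1) * t < of_int \<lfloor>(real n + 1) * t\<rfloor> + 1"
    by linarith+
  then show "sample n t \<le> t" "t < sample n t + 1 / (real n + 1)"
    by (auto simp: sample_def field_simps)
qed

lemma sample_in:
  assumes "t \<in> {a<..<b}" shows "sample n t \<in> {a-1..b}"
proof -
  have "1 / (real n + 1) \<le> 1" by simp
  with sample_le[where n=n and t=t] have "t - 1 < sample n t" "sample n t \<le> t" by linarith+
  then show ?thesis using assms by auto
qed

lemma simple_function_sample:
  "simple_function (lebesgue_on {a<..<b}) (\<lambda>t. F (sample n t))"
proof (rule simple_function_compose[where f="sample n", unfolded o_def])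
  show "simple_function (lebesgue_on {a<..<b}) (sample n)"
  proof (rule simple_function_borel_measurable)
    show "sample n \<in> borel_measurable (lebesgue_on {a<..<b})"
      unfolding sample_def
      by (intro measurable_restrict_space1 measurable_completion) measurable
    have "sample n ` {a<..<b} \<subseteq> (\<lambda>k. of_int k / (real n + 1)) ` {\<lfloor>(real n + 1) * a\<rfloor>..\<lfloor>(real n + 1) * b\<rfloor>}"
      by (auto simp: sample_def intro!: imageI floor_mono mult_left_mono)
    then have "finite (sample n ` {a<..<b})" by (rule finite_subset) simp
    then show "finite (sample n ` space (lebesgue_on {a<..<b}))" by (simp add: space_restrict_space)
  qed
qed

lemma tame_sample_L2_norm:
  assumes F: "tame F" and e: "e > 0"
  shows "\<forall>\<^sub>F n in sequentially. \<forall>t\<in>{a<..<b}. L2_norm (ball c r) (\<lambda>x. F (sample n t) x - F t x) \<le> e"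
proof -
  define M where "M = sqrt (measure lebesgue (ball c r)) + 1"
  have M: "M > 0" by (simp add: M_def add_nonneg_pos)
  obtain d where d: "d > 0" "\<And>s t x. s \<in> {a-1..b} \<Longrightarrow> t \<in> {a-1..b} \<Longrightarrow> \<bar>s - t\<bar> < d \<Longrightarrow> x \<in> cball c r \<Longrightarrow> norm (F s x - F t x) \<le> e / M"
    using tame_uniform[OF F compact_cball, of "e / M" "a-1" b c r] e M by (metis divide_pos_pos)
  have "(\<lambda>n. 1 / (real n + 1)) \<longlonglongrightarrow> 0" using LIMSEQ_Suc[OF lim_1_over_n] by (simp add: add.commute)
  then have "\<forall>\<^sub>F n in sequentially. 1 / (real n + 1) < d" using d(1) by (rule order_tendstoD)
  then show ?thesis
  proof eventually_elim
    case (elim n)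
    show ?case
    proof
      fix t assume t: "t \<in> {a<..<b}"
      have "L2_norm (ball c r) (\<lambda>x. F (sample n t) x - F t x) \<le> e / M * sqrt (measure lebesgue (ball c r))"
        using d(2)[OF sample_in[OF t, of n], of t] sample_le[where n=n and t=t] elim t e M
        by (intro L2_norm_le) auto
      also have "\<dots> \<le> e / M * M" using e M by (intro mult_left_mono) (auto simp: M_def)
      finally show "L2_norm (ball c r) (\<lambda>x. F (sample n t) x - F t x) \<le> e" using M by simp
    qed
  qed
qed

text \<open>The hypothesis on \<open>N\<close> covers both \<open>L\<^sup>2\<close> and, for curl-free fields, \<open>H\<^sub>c\<^sub>u\<^sub>r\<^sub>l\<close>.\<close>

lemma tame_bochner_measurable:
  assumes F: "tame F"
    and X: "\<And>t. F t \<in> X"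
    and N: "\<And>s t. N (\<lambda>x. F s x - F t x) = L2_norm (ball c r) (\<lambda>x. F s x - F t x)"
  shows "bochner_measurable X N {a<..<b} F"
  unfolding bochner_measurable_def
proof (intro exI[of _ "\<lambda>n t. F (sample n t)"] conjI allI ballI)
  show "simple_function (lebesgue_on {a<..<b}) (\<lambda>t. F (sample n t))" for n
    by (rule simple_function_sample)
  have "(\<lambda>n. N (\<lambda>x. F (sample n t) x - F t x)) \<longlonglongrightarrow> 0" if t: "t \<in> {a<..<b}" for t
  proof (rule LIMSEQ_I)
    fix e :: real assume e: "e > 0"
    from tame_sample_L2_norm[OF F, of "e/2" a b c r] e
    obtain n0 where "\<And>n. n \<ge> n0 \<Longrightarrow> L2_norm (ball c r) (\<lambda>x. F (sample n t) x - F t x) \<le> e/2"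
      using t unfolding eventually_sequentially by force
    then show "\<exists>no. \<forall>n\<ge>no. norm (N (\<lambda>x. F (sample n t) x - F t x) - 0) < e"
      using e L2_norm_nonneg by (intro exI[of _ n0]) (force simp: N)
  qed
  then show "AE t in lebesgue_on {a<..<b}. (\<lambda>n. N (\<lambda>x. F (sample n t) x - F t x)) \<longlonglongrightarrow> 0"
    by (intro AE_I2) auto
qed (rule X)

lemma tame_bochner_L2:
  assumes F: "tame F"
    and X: "\<And>t. F t \<in> X"
    and N: "\<And>s t. N (\<lambda>x. F s x - F t x) = L2_norm (ball c r) (\<lambda>x. F s x - F t x)"
    and N': "\<And>t. N (F t) = L2_norm (ball c r) (F t)"
  shows "F \<in> bochner_L2 X N {a<..<b}"
proof -
  have "(\<lambda>t. (L2_norm (ball c r) (F t))\<^sup>2) integrable_on {a..b}"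
    using tame_L2_norm_square_continuous[OF F] 
    by (intro integrable_continuous_real) (auto intro: continuous_on_subset)
  then have "(\<lambda>t. (L2_norm (ball c r) (F t))\<^sup>2) absolutely_integrable_on {a..b}"
    by (intro nonnegative_absolutely_integrable_1) auto
  then have "(\<lambda>t. (L2_norm (ball c r) (F t))\<^sup>2) absolutely_integrable_on {a<..<b}"
    by (rule set_integrable_subset) auto
  then have "integrable (lebesgue_on {a<..<b}) (\<lambda>t. (N (F t))\<^sup>2)"
    unfolding N' set_integrable_def by (subst integrable_restrict_space) auto
  then show ?thesis
    using tame_bochner_measurable[OF F X N, of a b] X by (auto simp: bochner_L2_def)
qed

lemma tame_L2_L2: "tame F \<Longrightarrow> F \<in> L2_L2 {a<..<b} (ball c r)"
  by (rule tame_bochner_L2) (auto intro: tame_L2)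

lemma tame_has_trace:
  assumes F: "tame F" shows "has_trace a b (ball c r) F t0 (F t0)"
  unfolding has_trace_def
proof (intro exI[of _ F] conjI ballI)
  show "F t \<in> L2 (ball c r)" for t by (rule tame_L2[OF F])
  fix t assume t: "t \<in> {a..b}"
  show "((\<lambda>s. L2_norm (ball c r) (\<lambda>x. F s x - F t x)) \<longlongrightarrow> 0) (at t within {a..b})"
  proof (rule tendstoI)
    fix e :: real assume e: "e > 0"
    define M where "M = sqrt (measure lebesgue (ball c r)) + 1"
    have M: "M > 0" by (simp add: M_def add_nonneg_pos)
    obtain d where d: "d > 0" "\<And>s t x. s \<in> {a..b} \<Longrightarrow> t \<in> {a..b} \<Longrightarrow> \<bar>s - t\<bar> < d \<Longrightarrow> x \<in> cball c r \<Longrightarrow> norm (F s x - F t x) \<le> e / M"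
      using tame_uniform[OF F compact_cball, of "e / M" a b c r] e M by (metis divide_pos_pos)
    show "\<forall>\<^sub>F s in at t within {a..b}. dist (L2_norm (ball c r) (\<lambda>x. F s x - F t x)) 0 < e"
      unfolding eventually_at
    proof (intro exI[of _ d] conjI ballI impI)
      fix s assume s: "s \<in> {a..b}" "s \<noteq> t \<and> dist s t < d"
      have "L2_norm (ball c r) (\<lambda>x. F s x - F t x) \<le> e / M * sqrt (measure lebesgue (ball c r))"
        using d(2)[of s t] s t e M by (intro L2_norm_le) (auto simp: dist_real_def)
      also have "\<dots> < e / M * M" using e M by (intro mult_strict_left_mono) (auto simp: M_def)
      finally show "dist (L2_norm (ball c r) (\<lambda>x. F s x - F t x)) 0 < e" using M L2_norm_nonneg by simp
    qed (rule d)
  qed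
qed auto

text \<open>The integral of a step function of time is a pointwise integral, so convergence of the integrals in \<open>L\<^sup>2\<close>
  reduces to uniform convergence in \<open>x\<close>.\<close>

lemma simple_integral_field_eq:
  assumes S: "simple_function (lebesgue_on {a<..<b}) S"
  shows "simple_integral_field {a<..<b} S x = (LINT t|lebesgue_on {a<..<b}. S t x)"
proof -
  let ?I = "{a<..<b}"
  have fin: "finite (S ` ?I)" using simple_functionD(1)[OF S] by (simp add: space_restrict_space)
  have meas: "{t\<in>?I. S t = v} \<in> sets (lebesgue_on ?I)" for v
  proof -
    have "S -` {v} \<inter> space (lebesgue_on ?I) \<in> sets (lebesgue_on ?I)" by (rule simple_functionD(2)[OF S])
    moreover have "S -` {v} \<inter> space (lebesgue_on ?I) = {t\<in>?I. S t = v}" by (auto simp: space_restrict_space)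
    ultimately show ?thesis by simp
  qed
  have "(LINT t|lebesgue_on ?I. S t x) = (LINT t|lebesgue_on ?I. (\<Sum>v\<in>S ` ?I. indicator {t\<in>?I. S t = v} t *\<^sub>R v x))"
  proof (rule Bochner_Integration.integral_cong[OF refl])
    fix t assume "t \<in> space (lebesgue_on ?I)"
    then have t: "t \<in> ?I" by (simp add: space_restrict_space)
    have "(\<Sum>v\<in>S ` ?I. indicator {t\<in>?I. S t = v} t *\<^sub>R v x) = (\<Sum>v\<in>S ` ?I. if v = S t then v x else 0)"
      using t by (intro sum.cong) (auto simp: indicator_def)
    also have "\<dots> = S t x" using fin t by (simp add: sum.delta)
    finally show "S t x = (\<Sum>v\<in>S ` ?I. indicator {t\<in>?I. S t = v} t *\<^sub>R v x)" by simp
  qed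
  also have "\<dots> = (\<Sum>v\<in>S ` ?I. LINT t|lebesgue_on ?I. indicator {t\<in>?I. S t = v} t *\<^sub>R v x)"
  proof (rule Bochner_Integration.integral_sum)
    interpret finite_measure "lebesgue_on ?I" by (rule finite_measure_lebesgue_on) auto
    show "integrable (lebesgue_on ?I) (\<lambda>t. indicator {t\<in>?I. S t = v} t *\<^sub>R v x)" for v
      using meas[of v] by (intro integrable_scaleR_left integrable_real_indicator) (auto simp: emeasure_eq_measure)
  qed
  also have "\<dots> = (\<Sum>v\<in>S ` ?I. measure lebesgue {t\<in>?I. S t = v} *\<^sub>R v x)"
  proof (rule sum.cong[OF refl])
    fix v
    have "(LINT t|lebesgue_on ?I. indicator {t\<in>?I. S t = v} t *\<^sub>R v x) = measure (lebesgue_on ?I) ({t\<in>?I. S t = v} \<inter> space (lebesgue_on ?I)) *\<^sub>R v x"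
    proof (cases "v x = 0")
      case False
      interpret finite_measure "lebesgue_on ?I" by (rule finite_measure_lebesgue_on) auto
      have "integrable (lebesgue_on ?I) (indicator {t\<in>?I. S t = v} :: real \<Rightarrow> real)"
        using meas[of v] by (intro integrable_real_indicator) (auto simp: emeasure_eq_measure)
      then show ?thesis
        by (subst integral_scaleR_left) (simp_all only: Bochner_Integration.integral_indicator)
    qed simp
    also have "\<dots> = measure lebesgue {t\<in>?I. S t = v} *\<^sub>R v x"
      by (subst measure_restrict_space) (auto simp: space_restrict_space Int_def intro!: arg_cong2[where f=scaleR] arg_cong[where f="measure lebesgue"])
    finally show "(LINT t|lebesgue_on ?I. indicator {t\<in>?I. S t = v} t *\<^sub>R v x) = measure lebesgue {t\<in>?I. S t = v} *\<^sub>R v x" .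
  qed
  finally show ?thesis by (simp add: simple_integral_field_def)
qed

lemma tame_continuous:
  assumes F: "tame F" shows "continuous_on UNIV (\<lambda>t. F t x)"
  unfolding continuous_on_iff
proof (intro ballI allI impI)
  fix t0 e :: real assume e: "e > 0"
  obtain d where d: "d > 0" "\<And>s t y. s \<in> {t0-1..t0+1} \<Longrightarrow> t \<in> {t0-1..t0+1} \<Longrightarrow> \<bar>s - t\<bar> < d \<Longrightarrow> y \<in> {x} \<Longrightarrow> norm (F s y - F t y) \<le> e / 2"
    using tame_uniform[OF F, of "{x}" "e/2" "t0-1" "t0+1"] e by (metis compact_insert finite.emptyI finite_imp_compact half_gt_zero)
  show "\<exists>d>0. \<forall>s\<in>UNIV. dist s t0 < d \<longrightarrow> dist (F s x) (F t0 x) < e"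
  proof (intro exI[of _ "min d 1"] conjI ballI impI)
    show "0 < min d 1" using d by simp
    fix s assume s: "dist s t0 < min d 1"
    then have "norm (F s x - F t0 x) \<le> e / 2" by (intro d(2)) (auto simp: dist_real_def)
    then show "dist (F s x) (F t0 x) < e" using e by (simp add: dist_norm)
  qed
qed

lemma continuous_integrable_interval:
  fixes f :: "real \<Rightarrow> 'a::euclidean_space"
  assumes "continuous_on UNIV f" shows "integrable (lebesgue_on {a<..<b}) f"
proof -
  have "f absolutely_integrable_on {a..b}"
    using absolutely_integrable_continuous[of a b f] continuous_on_subset[OF assms] by (simp add: cbox_interval)
  then have "f absolutely_integrable_on {a<..<b}" by (rule set_integrable_subset) auto
  then show ?thesis unfolding set_integrable_def by (subst integrable_restrict_space) auto
qed

lemma sample_integrable: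
  assumes F: "tame F" shows "integrable (lebesgue_on {a<..<b}) (\<lambda>t. F (sample n t) x)"
proof -
  interpret finite_measure "lebesgue_on {a<..<b}" by (rule finite_measure_lebesgue_on) auto
  obtain B where B: "\<And>t y. t \<in> {a-1..b} \<Longrightarrow> y \<in> {x} \<Longrightarrow> norm (F t y) \<le> B"
    using tame_bounded[OF F, of "{x}" "a-1" b] by (metis compact_insert finite.emptyI finite_imp_compact)
  show ?thesis
  proof (rule integrable_const_bound[of _ B])
    show "AE t in lebesgue_on {a<..<b}. norm (F (sample n t) x) \<le> B"
      by (intro AE_I2 B sample_in) (auto simp: space_restrict_space)
    show "(\<lambda>t. F (sample n t) x) \<in> borel_measurable (lebesgue_on {a<..<b})"
      by (rule borel_measurable_simple_function) (rule simple_function_sample)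
  qed
qed

lemma tame_sample_integral:
  assumes F: "tame F" and ab: "a < b" and K: "compact K" and e: "e > 0"
  shows "\<forall>\<^sub>F n in sequentially. \<forall>x\<in>K.
     norm ((LINT t|lebesgue_on {a<..<b}. F (sample n t) x) - (LINT t|lebesgue_on {a<..<b}. F t x)) \<le> e * (b - a)"
proof -
  let ?L = "lebesgue_on {a<..<b}"
  let ?S = "\<lambda>n x. LINT t|lebesgue_on {a<..<b}. F (sample n t) x"
  let ?v = "\<lambda>x. LINT t|lebesgue_on {a<..<b}. F t x"
  interpret finite_measure "?L" by (rule finite_measure_lebesgue_on) auto
  obtain d where d: "d > 0" "\<And>s t x. s \<in> {a-1..b} \<Longrightarrow> t \<in> {a-1..b} \<Longrightarrow> \<bar>s - t\<bar> < d \<Longrightarrow> x \<in> K \<Longrightarrow> norm (F s x - F t x) \<le> e"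
    using tame_uniform[OF F K e, of "a-1" b] by metis
  have "(\<lambda>n. 1 / (real n + 1)) \<longlonglongrightarrow> 0" using LIMSEQ_Suc[OF lim_1_over_n] by (simp add: add.commute)
  then have "\<forall>\<^sub>F n in sequentially. 1 / (real n + 1) < d" using d(1) by (rule order_tendstoD)
  then show ?thesis
  proof eventually_elim
    case (elim n)
    show ?case
    proof
      fix x assume x: "x \<in> K"
      have i1: "integrable (?L) (\<lambda>t. F (sample n t) x)" by (rule sample_integrable[OF F])
      have i2: "integrable (?L) (\<lambda>t. F t x)" by (rule continuous_integrable_interval[OF tame_continuous[OF F]])
      have "norm (?S n x - ?v x)
         = norm (LINT t|?L. F (sample n t) x - F t x)"
        using i1 i2 by simp
      also have "\<dots> \<le> (LINT t|?L. norm (F (sample n t) x - F t x))"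
        by (rule integral_norm_bound)
      also have "\<dots> \<le> (LINT t|?L. e)"
      proof (rule integral_mono)
        show "integrable (?L) (\<lambda>t. norm (F (sample n t) x - F t x))"
          using i1 i2 by simp
        fix t assume "t \<in> space (?L)"
        then have t: "t \<in> {a<..<b}" by (simp add: space_restrict_space)
        show "norm (F (sample n t) x - F t x) \<le> e"
          using sample_le[where n=n and t=t] elim t by (intro d(2) sample_in[OF t] x) auto
      qed simp
      also have "\<dots> = e * (b - a)" using ab by (simp add: measure_restrict_space)
      finally show "norm (?S n x - ?v x) \<le> e * (b - a)" .
    qed
  qed
qed

lemma tame_integral_measurable:
  assumes F: "tame F" and ab: "a < b"
  shows "(\<lambda>x. LINT t|lebesgue_on {a<..<b}. F t x) \<in> borel_measurable lebesgue"
proof (rule borel_measurable_LIMSEQ_metric)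
  fix n
  have "(\<lambda>x. LINT t|lebesgue_on {a<..<b}. F (sample n t) x) = simple_integral_field {a<..<b} (\<lambda>t. F (sample n t))"
    by (rule ext) (rule simple_integral_field_eq[OF simple_function_sample, symmetric])
  also have "\<dots> \<in> borel_measurable lebesgue"
    unfolding simple_integral_field_def[abs_def]
    by (intro borel_measurable_sum borel_measurable_scaleR borel_measurable_const) (auto intro: tame_measurable[OF F])
  finally show "(\<lambda>x. LINT t|lebesgue_on {a<..<b}. F (sample n t) x) \<in> borel_measurable lebesgue" .
next
  fix x :: "real^3"
  show "(\<lambda>n. LINT t|lebesgue_on {a<..<b}. F (sample n t) x) \<longlonglongrightarrow> (LINT t|lebesgue_on {a<..<b}. F t x)"
  proof (rule LIMSEQ_I)
    fix e :: real assume e: "e > 0"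
    have "\<forall>\<^sub>F n in sequentially. \<forall>y\<in>{x}.
     norm ((LINT t|lebesgue_on {a<..<b}. F (sample n t) y) - (LINT t|lebesgue_on {a<..<b}. F t y)) \<le> e / (2 * (b - a)) * (b - a)"
      using e ab by (intro tame_sample_integral[OF F ab]) auto
    moreover have "e / (2 * (b - a)) * (b - a) < e" using e ab by (simp add: field_simps)
    ultimately show "\<exists>no. \<forall>n\<ge>no. norm ((LINT t|lebesgue_on {a<..<b}. F (sample n t) x) - (LINT t|lebesgue_on {a<..<b}. F t x)) < e"
      unfolding eventually_sequentially by (meson insertI1 le_less_trans)
  qed
qed

lemma tame_has_bochner_integral_field:
  assumes F: "tame F" and ab: "a < b"
  shows "has_bochner_integral_field (L2 (ball c r)) (L2_norm (ball c r)) {a<..<b} F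
           (\<lambda>x. LINT t|lebesgue_on {a<..<b}. F t x)"
    (is "has_bochner_integral_field _ ?N _ _ ?v")
proof -
  let ?L = "lebesgue_on {a<..<b}"
  let ?S = "\<lambda>n x. LINT t|lebesgue_on {a<..<b}. F (sample n t) x"
  interpret finite_measure "?L" by (rule finite_measure_lebesgue_on) auto
  obtain B where B: "B > 0" "\<And>t x. t \<in> {a..b} \<Longrightarrow> x \<in> cball c r \<Longrightarrow> norm (F t x) \<le> B"
    using tame_bounded[OF F compact_cball, of a b c r] by metis
  have "?v \<in> L2 (ball c r)"
  proof (rule L2I[OF tame_integral_measurable[OF F ab]])
    fix x assume x: "x \<in> ball c r"
    have "norm (?v x) \<le> (LINT t|?L. norm (F t x))" by (rule integral_norm_bound)
    also have "\<dots> \<le> (LINT t|?L. B)"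
      using B(2)[of _ x] x
      by (intro integral_mono integrable_norm continuous_integrable_interval[OF tame_continuous[OF F]])
         (auto simp: space_restrict_space)
    finally show "norm (?v x) \<le> (LINT t|?L. B)" .
  qed
  moreover have "F t \<in> L2 (ball c r)" for t by (rule tame_L2[OF F])
  moreover have "bochner_measurable (L2 (ball c r)) ?N {a<..<b} F"
    by (rule tame_bochner_measurable[OF F tame_L2[OF F]]) simp
  moreover have "\<exists>S. (\<forall>n::nat. simple_function (?L) (S n) \<and> (\<forall>t\<in>{a<..<b}. S n t \<in> L2 (ball c r)) \<and>
                    emeasure lebesgue {t \<in> {a<..<b}. S n t \<noteq> (\<lambda>x. 0)} < \<infinity>) \<and>
          (\<lambda>n. \<integral>\<^sup>+ t. ennreal (?N (\<lambda>x. S n t x - F t x)) \<partial>?L) \<longlonglongrightarrow> 0 \<and>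
          (\<lambda>n. ?N (\<lambda>x. simple_integral_field {a<..<b} (S n) x - ?v x)) \<longlonglongrightarrow> 0"
  proof (intro exI[of _ "\<lambda>n t. F (sample n t)"] conjI allI ballI)
    show "simple_function (?L) (\<lambda>t. F (sample n t))" for n by (rule simple_function_sample)
    show "F (sample n t) \<in> L2 (ball c r)" for n t by (rule tame_L2[OF F])
    show "emeasure lebesgue {t \<in> {a<..<b}. F (sample n t) \<noteq> (\<lambda>x. 0)} < \<infinity>" for n
    proof -
      have "emeasure lebesgue {t \<in> {a<..<b}. F (sample n t) \<noteq> (\<lambda>x. 0)} \<le> emeasure lebesgue {a<..<b}"
        by (rule emeasure_mono) auto
      also have "\<dots> < \<infinity>" using ab by simp
      finally show ?thesis .
    qed
    show "(\<lambda>n. \<integral>\<^sup>+ t. ennreal (?N (\<lambda>x. F (sample n t) x - F t x)) \<partial>?L) \<longlonglongrightarrow> 0"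
    proof (rule order_tendstoI)
      fix e :: ennreal assume e: "0 < e"
      obtain e' where e': "0 < e'" "ennreal (e' * (b - a)) < e"
      proof -
        obtain y where y: "0 < y" "y < e" using e dense by blast
        then obtain z where z: "y = ennreal z" "0 < z" by (cases y) auto
        show thesis by (rule that[of "z / (b - a)"]) (use z y ab in auto)
      qed
      from tame_sample_L2_norm[OF F e'(1), of a b c r]
      show "\<forall>\<^sub>F n in sequentially. (\<integral>\<^sup>+ t. ennreal (?N (\<lambda>x. F (sample n t) x - F t x)) \<partial>?L) < e"
      proof eventually_elim
        case (elim n)
        have "(\<integral>\<^sup>+ t. ennreal (?N (\<lambda>x. F (sample n t) x - F t x)) \<partial>?L) \<le> (\<integral>\<^sup>+ t. ennreal e' \<partial>?L)"
          using elim by (intro nn_integral_mono) (auto simp: space_restrict_space intro!: ennreal_leI)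
        also have "\<dots> = ennreal e' * emeasure (?L) (space (?L))" by simp
        also have "emeasure (?L) (space (?L)) = ennreal (b - a)"
          using ab by (simp add: emeasure_restrict_space space_restrict_space)
        also have "ennreal e' * ennreal (b - a) = ennreal (e' * (b - a))" using e' ab by (simp add: ennreal_mult)
        finally show ?case using e'(2) by simp
      qed
    qed simp
    show "(\<lambda>n. ?N (\<lambda>x. simple_integral_field {a<..<b} (\<lambda>t. F (sample n t)) x - ?v x)) \<longlonglongrightarrow> 0"
    proof (rule LIMSEQ_I)
      fix e :: real assume e: "e > 0"
      define M where "M = sqrt (measure lebesgue (ball c r)) + 1"
      have M: "M > 0" by (simp add: M_def add_nonneg_pos)
      define \<eta> where "\<eta> = e / (2 * M * (b - a))"
      have \<eta>: "\<eta> > 0" "\<eta> * (b - a) * M < e" using e M ab by (auto simp: \<eta>_def)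
      from tame_sample_integral[OF F ab compact_cball \<eta>(1), of c r]
      obtain n0 where n0: "\<And>n x. n \<ge> n0 \<Longrightarrow> x \<in> cball c r \<Longrightarrow> norm (?S n x - ?v x) \<le> \<eta> * (b - a)"
        unfolding eventually_sequentially by blast
      show "\<exists>no. \<forall>n\<ge>no. norm (?N (\<lambda>x. simple_integral_field {a<..<b} (\<lambda>t. F (sample n t)) x - ?v x) - 0) < e"
      proof (intro exI[of _ n0] allI impI)
        fix n assume n: "n \<ge> n0"
        have "?N (\<lambda>x. simple_integral_field {a<..<b} (\<lambda>t. F (sample n t)) x - ?v x) \<le> \<eta> * (b - a) * sqrt (measure lebesgue (ball c r))"
          unfolding simple_integral_field_eq[OF simple_function_sample]
          using n0[OF n] \<eta> ab by (intro L2_norm_le) auto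
        also have "\<dots> \<le> \<eta> * (b - a) * M" using \<eta> ab by (intro mult_left_mono) (auto simp: M_def)
        also have "\<dots> < e" by (rule \<eta>)
        finally show "norm (?N (\<lambda>x. simple_integral_field {a<..<b} (\<lambda>t. F (sample n t)) x - ?v x) - 0) < e"
          using L2_norm_nonneg by simp
      qed
    qed
  qed
  ultimately show ?thesis unfolding has_bochner_integral_field_def by (intro conjI AE_I2) auto
qed

lemma C_k_deriv_real:
  fixes \<phi> :: "real \<Rightarrow> real"
  assumes "C_k (Suc 0) \<phi>"
  shows "(\<phi> has_real_derivative deriv \<phi> t) (at t)" "continuous_on UNIV (deriv \<phi>)"
proof -
  have d: "(\<phi> has_real_derivative frechet_derivative \<phi> (at t) 1) (at t)" for t
    using C_k_directional_derivative[OF assms, of 0 1 t] by simp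
  then have eq: "deriv \<phi> t = frechet_derivative \<phi> (at t) 1" for t by (rule DERIV_imp_deriv)
  show "(\<phi> has_real_derivative deriv \<phi> t) (at t)" using d eq by simp
  have "deriv \<phi> = (\<lambda>t. frechet_derivative \<phi> (at t) 1)" using eq by blast
  then show "continuous_on UNIV (deriv \<phi>)" using assms by simp
qed

text \<open>Pointwise in \<open>x\<close> this is integration by parts against a test function vanishing at both ends of the interval.\<close>

lemma tame_has_weak_dt:
  assumes F: "tame F" and F': "tame F'" and ab: "a < b"
    and der: "\<And>x t. ((\<lambda>t. F t x) has_vector_derivative F' t x) (at t)"
  shows "has_weak_dt {a<..<b} (ball c r) F F'"
  unfolding has_weak_dt_def
proof (intro conjI allI impI tame_L2_L2 F F')
  let ?L = "lebesgue_on {a<..<b}"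
  fix \<phi> :: "real \<Rightarrow> real" assume \<phi>: "test_function {a<..<b} \<phi>"
  have Ck: "C_k k \<phi>" for k using \<phi> by (simp add: test_function_def)
  note der\<phi> = C_k_deriv_real[OF Ck[of "Suc 0"]]
  have \<phi>c: "continuous_on UNIV \<phi>" using Ck[of 0] by simp
  have zero: "\<phi> a = 0" "\<phi> b = 0"
    using \<phi> closure_subset[of "{x. \<phi> x \<noteq> 0}"] unfolding test_function_def by (metis (mono_tags, lifting) greaterThanLessThan_iff less_irrefl mem_Collect_eq subsetD)+
  let ?v = "\<lambda>x. LINT t|?L. deriv \<phi> t *\<^sub>R F t x"
  have t1: "tame (\<lambda>t x. deriv \<phi> t *\<^sub>R F t x)" by (rule tame_scaleR[OF F der\<phi>(2)])
  have t2: "tame (\<lambda>t x. \<phi> t *\<^sub>R F' t x)" by (rule tame_scaleR[OF F' \<phi>c])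
  have "(LINT t|?L. \<phi> t *\<^sub>R F' t x) = - ?v x" for x
  proof -
    have i1: "integrable (?L) (\<lambda>t. deriv \<phi> t *\<^sub>R F t x)"
      by (rule continuous_integrable_interval[OF tame_continuous[OF t1]])
    have i2: "integrable (?L) (\<lambda>t. \<phi> t *\<^sub>R F' t x)"
      by (rule continuous_integrable_interval[OF tame_continuous[OF t2]])
    have "((\<lambda>t. \<phi> t *\<^sub>R F' t x + deriv \<phi> t *\<^sub>R F t x) has_integral \<phi> b *\<^sub>R F b x - \<phi> a *\<^sub>R F a x) {a..b}"
    proof (rule fundamental_theorem_of_calculus)
      show "((\<lambda>t. \<phi> t *\<^sub>R F t x) has_vector_derivative \<phi> t *\<^sub>R F' t x + deriv \<phi> t *\<^sub>R F t x) (at t within {a..b})" for t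
        by (rule has_vector_derivative_at_within[OF has_vector_derivative_scaleR[OF der\<phi>(1) der]])
    qed (use ab in simp)
    then have "integral {a..b} (\<lambda>t. \<phi> t *\<^sub>R F' t x + deriv \<phi> t *\<^sub>R F t x) = 0"
      using zero by (simp add: integral_unique)
    then have "integral {a<..<b} (\<lambda>t. \<phi> t *\<^sub>R F' t x + deriv \<phi> t *\<^sub>R F t x) = 0"
      by (simp add: integral_open_interval_real)
    then have "(LINT t|?L. \<phi> t *\<^sub>R F' t x + deriv \<phi> t *\<^sub>R F t x) = 0"
      using i1 i2 by (subst lebesgue_integral_eq_integral) auto
    then show ?thesis using i1 i2 by (simp add: eq_neg_iff_add_eq_0)
  qed
  then have "(\<lambda>x. LINT t|?L. \<phi> t *\<^sub>R F' t x) = (\<lambda>x. - ?v x)" by blast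
  then show "\<exists>v. has_bochner_integral_field (L2 (ball c r)) (L2_norm (ball c r)) {a<..<b} (\<lambda>t x. deriv \<phi> t *\<^sub>R F t x) v \<and>
             has_bochner_integral_field (L2 (ball c r)) (L2_norm (ball c r)) {a<..<b} (\<lambda>t x. \<phi> t *\<^sub>R F' t x) (\<lambda>x. - v x)"
    using tame_has_bochner_integral_field[OF t1 ab, of c r] tame_has_bochner_integral_field[OF t2 ab, of c r]
    by (intro exI[of _ ?v]) simp
qed

lemma has_weak_curl_0_weak_curl:
  assumes \<Omega>: "open \<Omega>" and u: "has_weak_curl \<Omega> u (\<lambda>x. 0)"
  shows "AE x in lebesgue. x \<in> \<Omega> \<longrightarrow> weak_curl \<Omega> u x = 0"
proof (rule weak_curl_0_unique[OF \<Omega> u])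
  show "has_weak_curl \<Omega> u (weak_curl \<Omega> u)" unfolding weak_curl_def by (rule someI[of "has_weak_curl \<Omega> u"]) (rule u)
qed

lemma H_curl_norm_curl_free:
  assumes \<Omega>: "open \<Omega>" and u: "has_weak_curl \<Omega> u (\<lambda>x. 0)"
  shows "H_curl_norm \<Omega> u = L2_norm \<Omega> u"
proof -
  have "AE x in lebesgue_on \<Omega>. (norm (weak_curl \<Omega> u x))\<^sup>2 = 0"
    using has_weak_curl_0_weak_curl[OF assms] \<Omega>
    by (subst AE_restrict_space_iff) (auto simp: lborelD elim: AE_mp intro!: AE_I2)
  then have "L2_norm \<Omega> (weak_curl \<Omega> u) = 0"
    unfolding L2_norm_def by (simp add: integral_eq_zero_AE)
  then show ?thesis by (simp add: H_curl_norm_def L2_norm_nonneg)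
qed

text \<open>Differences are required to be curl-free because the curl part of the norm of a difference enters the
  approximation by step functions.\<close>

lemma tame_curl_free_L2_H_curl:
  assumes F: "tame F" and curl: "\<And>t. has_weak_curl UNIV (F t) (\<lambda>x. 0)"
    and curl_diff: "\<And>s t. has_weak_curl UNIV (\<lambda>x. F s x - F t x) (\<lambda>x. 0)"
  shows "F \<in> L2_H_curl {a<..<b} (ball c r)"
proof (rule tame_bochner_L2[OF F])
  note sub = has_weak_curl_0_open_subset[OF _ open_ball[of c r]]
  show "F t \<in> H_curl (ball c r)" for t
  proof -
    have "(\<lambda>x. 0) \<in> L2 (ball c r)" by (rule L2I[where B=0]) auto
    then show ?thesis using tame_L2[OF F] sub[OF curl] unfolding H_curl_def by blast
  qed
  show "H_curl_norm (ball c r) (\<lambda>x. F s x - F t x) = L2_norm (ball c r) (\<lambda>x. F s x - F t x)" for s t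
    by (rule H_curl_norm_curl_free[OF open_ball sub[OF curl_diff]])
  show "H_curl_norm (ball c r) (F t) = L2_norm (ball c r) (F t)" for t
    by (rule H_curl_norm_curl_free[OF open_ball sub[OF curl]])
qed

section \<open>Fields in gradient direction\<close>

definition profile_field :: "(real^3 \<Rightarrow> real) \<Rightarrow> vfield \<Rightarrow> (real \<Rightarrow> real \<Rightarrow> real) \<Rightarrow> real \<Rightarrow> vfield" where
  "profile_field g n f t x = f (g x) t *\<^sub>R n x"

text \<open>On a compact set \<open>K\<close> the pair \<open>(g(x), t)\<close> runs through the compact set \<open>g(K) \<times> [a,b]\<close>, where \<open>f\<close> is uniformly
  continuous.\<close>

lemma tame_profile_field:
  assumes g: "continuous_on UNIV g" and n: "n \<in> borel_measurable lebesgue" "\<And>x. norm (n x) \<le> 1"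
    and f: "continuous_on (range g \<times> UNIV) (\<lambda>p. f (fst p) (snd p))"
  shows "tame (profile_field g n f)"
  unfolding tame_def
proof (intro conjI allI impI)
  fix t
  have "continuous_on UNIV (\<lambda>x. f (fst (g x, t)) (snd (g x, t)))"
    by (rule continuous_on_compose2[OF f]) (auto intro!: continuous_intros g)
  then have "(\<lambda>x. f (g x) t) \<in> borel_measurable lebesgue" by (simp add: continuous_imp_lebesgue_measurable)
  then show "profile_field g n f t \<in> borel_measurable lebesgue"
    unfolding profile_field_def[abs_def] using n(1) by (rule borel_measurable_scaleR)
next
  fix K :: "(real^3) set" and a b :: real assume K: "compact K"
  let ?C = "g ` K \<times> {a..b}"
  have C: "compact ?C"
    using K by (intro compact_Times compact_continuous_image continuous_on_subset[OF g]) auto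
  have fC: "continuous_on ?C (\<lambda>p. f (fst p) (snd p))" by (rule continuous_on_subset[OF f]) auto
  have "bounded ((\<lambda>p. f (fst p) (snd p)) ` ?C)"
    by (intro compact_imp_bounded compact_continuous_image fC C)
  then obtain B where B: "\<And>p. p \<in> ?C \<Longrightarrow> \<bar>f (fst p) (snd p)\<bar> \<le> B"
    unfolding bounded_iff real_norm_def by blast
  show "\<exists>B. \<forall>t\<in>{a..b}. \<forall>x\<in>K. norm (profile_field g n f t x) \<le> B"
  proof (intro exI[of _ B] ballI)
    fix t x assume "t \<in> {a..b}" "x \<in> K"
    then have "\<bar>f (g x) t\<bar> \<le> B" using B[of "(g x, t)"] by simp
    moreover have "\<bar>f (g x) t\<bar> * norm (n x) \<le> \<bar>f (g x) t\<bar> * 1" using n(2)[of x] by (intro mult_left_mono) auto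
    ultimately show "norm (profile_field g n f t x) \<le> B" by (simp add: profile_field_def)
  qed
  fix e :: real assume e: "e > 0"
  have "uniformly_continuous_on ?C (\<lambda>p. f (fst p) (snd p))" by (rule compact_uniformly_continuous[OF fC C])
  then obtain d where d: "d > 0" "\<And>p p'. p \<in> ?C \<Longrightarrow> p' \<in> ?C \<Longrightarrow> dist p' p < d \<Longrightarrow> dist (f (fst p') (snd p')) (f (fst p) (snd p)) < e"
    using e unfolding uniformly_continuous_on_def by metis
  show "\<exists>d>0. \<forall>s\<in>{a..b}. \<forall>t\<in>{a..b}. \<bar>s - t\<bar> < d \<longrightarrow> (\<forall>x\<in>K. norm (profile_field g n f s x - profile_field g n f t x) \<le> e)"
  proof (intro exI[of _ d] conjI ballI impI d(1))
    fix s t x assume st: "s \<in> {a..b}" "t \<in> {a..b}" "\<bar>s - t\<bar> < d" "x \<in> K"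
    have "dist (f (fst (g x, s)) (snd (g x, s))) (f (fst (g x, t)) (snd (g x, t))) < e"
      using st by (intro d(2)) (auto simp: dist_Pair_Pair dist_real_def)
    then have "\<bar>f (g x) s - f (g x) t\<bar> \<le> e" by (simp add: dist_real_def)
    moreover have "\<bar>f (g x) s - f (g x) t\<bar> * norm (n x) \<le> \<bar>f (g x) s - f (g x) t\<bar> * 1"
      using n(2)[of x] by (intro mult_left_mono) auto
    ultimately show "norm (profile_field g n f s x - profile_field g n f t x) \<le> e"
      by (simp add: profile_field_def flip: scaleR_diff_left)
  qed
qed

lemma bounded_on_compact_locally_integrable:
  fixes u :: "real^3 \<Rightarrow> real^3"
  assumes u: "u \<in> borel_measurable lebesgue" and bdd: "\<And>K. compact K \<Longrightarrow> \<exists>B. \<forall>x\<in>K. norm (u x) \<le> B"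
  shows "locally_integrable UNIV u"
  unfolding locally_integrable_def
proof (intro allI impI)
  fix K :: "(real^3) set" assume "compact K \<and> K \<subseteq> UNIV"
  then have K: "compact K" by simp
  obtain B where B: "\<And>x. x \<in> K \<Longrightarrow> norm (u x) \<le> B" using bdd[OF K] by blast
  have Ks: "K \<in> lmeasurable" using K by (rule lmeasurable_compact)
  show "u absolutely_integrable_on K"
  proof (rule measurable_bounded_by_integrable_imp_absolutely_integrable)
    show "u \<in> borel_measurable (lebesgue_on K)" using u by (simp add: measurable_restrict_space1)
    show "(\<lambda>x. B) integrable_on K" using Ks by (rule integrable_on_const)
  qed (use B Ks in auto)
qed

lemma has_bochner_integral_AE_zero:
  fixes f :: "'a::euclidean_space \<Rightarrow> real"
  assumes "AE x in lebesgue. f x = 0" shows "has_bochner_integral lebesgue f 0"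
proof -
  have "f \<in> borel_measurable lebesgue"
    by (rule borel_measurable_AE[of "\<lambda>x. 0"]) (use assms in \<open>auto elim: AE_mp intro!: AE_I2\<close>)
  then have "has_bochner_integral lebesgue f 0 \<longleftrightarrow> has_bochner_integral lebesgue (\<lambda>x::'a. 0 :: real) 0"
    by (rule has_bochner_integral_cong_AE) (use assms in auto)
  then show ?thesis by (simp add: has_bochner_integral_zero)
qed

text \<open>The direction \<open>n\<close> is the sign of \<open>w\<close>, so that it is bounded by \<open>1\<close> everywhere and a unit vector almost
  everywhere.\<close>

locale gradient_profile =
  fixes g :: "real^3 \<Rightarrow> real" and w n :: vfield and G :: "real \<Rightarrow> real"
  assumes w: "has_weak_gradient UNIV g w" and g: "continuous_on UNIV g"
    and w_ne0: "AE x in lebesgue. w x \<noteq> 0" and norm_w: "AE x in lebesgue. norm (w x) = G (g x)"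
    and G_pos: "\<And>y. y \<in> range g \<Longrightarrow> 0 < G y" and G: "continuous_on (range g) G"
  defines "n \<equiv> \<lambda>x. sgn (w x)"
begin

lemma n_measurable: "n \<in> borel_measurable lebesgue"
proof -
  have "w \<in> borel_measurable lebesgue"
    using w by (intro locally_integrable_UNIV_measurable) (simp add: has_weak_gradient_def)
  then show ?thesis unfolding n_def sgn_div_norm
    by (intro borel_measurable_scaleR borel_measurable_inverse measurable_compose[OF _ borel_measurable_norm])
qed

lemma norm_n_le_1: "norm (n x) \<le> 1" by (simp add: n_def norm_sgn)

lemma norm_n: "AE x in lebesgue. norm (n x) = 1"
  using w_ne0 by eventually_elim (simp add: n_def norm_sgn)

lemma curl_free:
  assumes f: "continuous_on (range g) f" shows "has_weak_curl UNIV (\<lambda>x. f (g x) *\<^sub>R n x) (\<lambda>x. 0)"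
proof (rule composite_gradient_curl_free[OF w g])
  show "continuous_on (range g) (\<lambda>y. f y / G y)"
  proof (intro continuous_on_divide f G ballI)
    show "G y \<noteq> 0" if "y \<in> range g" for y using G_pos[OF that] by simp
  qed
  show "AE x in lebesgue. f (g x) *\<^sub>R n x = (f (g x) / G (g x)) *\<^sub>R w x"
    using norm_w by eventually_elim (simp add: n_def sgn_div_norm divide_inverse)
  have fgc: "continuous_on UNIV (\<lambda>x. f (g x))" by (rule continuous_on_compose2[OF f g]) auto
  show "locally_integrable UNIV (\<lambda>x. f (g x) *\<^sub>R n x)"
  proof (rule bounded_on_compact_locally_integrable)
    show "(\<lambda>x. f (g x) *\<^sub>R n x) \<in> borel_measurable lebesgue"
      by (intro borel_measurable_scaleR n_measurable continuous_imp_lebesgue_measurable fgc)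
    fix K :: "(real^3) set" assume "compact K"
    then have "bounded ((\<lambda>x. f (g x)) ` K)"
      by (intro compact_imp_bounded compact_continuous_image continuous_on_subset[OF fgc]) auto
    then obtain B where B: "\<And>x. x \<in> K \<Longrightarrow> \<bar>f (g x)\<bar> \<le> B" by (auto simp: bounded_iff)
    have "norm (f (g x) *\<^sub>R n x) \<le> B" if "x \<in> K" for x
      using B[OF that] mult_left_mono[OF norm_n_le_1[of x], of "\<bar>f (g x)\<bar>"] by simp
    then show "\<exists>B. \<forall>x\<in>K. norm (f (g x) *\<^sub>R n x) \<le> B" by blast
  qed
qed

lemma profile_curl_free:
  assumes f: "continuous_on (range g \<times> UNIV) (\<lambda>p. f (fst p) (snd p))"
  shows "has_weak_curl UNIV (profile_field g n f t) (\<lambda>x. 0)"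
    "has_weak_curl UNIV (\<lambda>x. profile_field g n f s x - profile_field g n f t x) (\<lambda>x. 0)"
proof -
  have c: "continuous_on (range g) (\<lambda>y. f y t)" for t
    using continuous_on_compose2[OF f, of "range g" "\<lambda>y. (y, t)"] by (simp add: continuous_on_Pair continuous_on_id image_subset_iff)
  show "has_weak_curl UNIV (profile_field g n f t) (\<lambda>x. 0)"
    using curl_free[OF c[of t]] by (simp add: profile_field_def[abs_def])
  have "has_weak_curl UNIV (\<lambda>x. (f (g x) s - f (g x) t) *\<^sub>R n x) (\<lambda>x. 0)"
    by (rule curl_free) (intro continuous_intros c)
  then show "has_weak_curl UNIV (\<lambda>x. profile_field g n f s x - profile_field g n f t x) (\<lambda>x. 0)"
    by (simp add: profile_field_def scaleR_diff_left)
qed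

text \<open>The curl term vanishes, and as \<open>n\<close> is a unit vector almost everywhere, the remaining integrand is the
  left-hand side of the scalar equation times \<open>n \<bullet> v\<close>.\<close>

lemma profile_weak_solution:
  assumes T: "T\<^sub>1 < T\<^sub>2"
    and f: "continuous_on (range g \<times> UNIV) (\<lambda>p. f (fst p) (snd p))"
      "continuous_on (range g \<times> UNIV) (\<lambda>p. f' (fst p) (snd p))"
      "continuous_on (range g \<times> UNIV) (\<lambda>p. f'' (fst p) (snd p))"
    and der: "\<And>y t. y \<in> range g \<Longrightarrow> (f y has_real_derivative f' y t) (at t)"
      "\<And>y t. y \<in> range g \<Longrightarrow> (f' y has_real_derivative f'' y t) (at t)"
    and eq: "\<And>x t. s x * f'' (g x) t + q x * f (g x) t + W x * \<bar>f (g x) t\<bar> powr (p - 1) * f (g x) t = 0"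
  shows "weak_solution p s q W (ereal T\<^sub>1) (ereal T\<^sub>2) (\<lambda>x t. profile_field g n f t x)"
    and "has_weak_dt {T\<^sub>1<..<T\<^sub>2} (ball c r) (\<lambda>t x. profile_field g n f t x) (profile_field g n f')"
proof -
  let ?F = "profile_field g n f"
  let ?F' = "profile_field g n f'"
  let ?F'' = "profile_field g n f''"
  let ?pde = "\<lambda>t v x. (s x *\<^sub>R ?F'' t x) \<bullet> v x + weak_curl UNIV (\<lambda>y. ?F t y) x \<bullet> weak_curl UNIV v x
     + (q x *\<^sub>R ?F t x + (W x * norm (?F t x) powr (p - 1)) *\<^sub>R ?F t x) \<bullet> v x"
  note tame = tame_profile_field[OF g n_measurable norm_n_le_1]
  have d: "((\<lambda>t. ?F t x) has_vector_derivative ?F' t x) (at t)"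
          "((\<lambda>t. ?F' t x) has_vector_derivative ?F'' t x) (at t)" for x t
    unfolding profile_field_def
    using has_vector_derivative_scaleR[OF der(1)[of "g x" t] has_vector_derivative_const[of "n x"]]
      has_vector_derivative_scaleR[OF der(2)[of "g x" t] has_vector_derivative_const[of "n x"]] by simp_all
  have dt: "has_weak_dt {T\<^sub>1<..<T\<^sub>2} (ball c r) (\<lambda>t x. ?F t x) (?F')" for c r
    by (rule tame_has_weak_dt[OF tame[OF f(1)] tame[OF f(2)] T d(1)])
  then show "has_weak_dt {T\<^sub>1<..<T\<^sub>2} (ball c r) (\<lambda>t x. ?F t x) (?F')" .
  have dt': "has_weak_dt {T\<^sub>1<..<T\<^sub>2} (ball c r) (?F') (?F'')" for c r
    by (rule tame_has_weak_dt[OF tame[OF f(2)] tame[OF f(3)] T d(2)])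
  have Linf: "?F t \<in> Linf_loc" for t
  proof -
    have "\<exists>C. AE x in lebesgue. x \<in> K \<longrightarrow> norm (?F t x) \<le> C" if K: "compact K" for K
    proof -
      obtain B where "\<And>s x. s \<in> {t..t} \<Longrightarrow> x \<in> K \<Longrightarrow> norm (?F s x) \<le> B"
        using tame_bounded[OF tame[OF f(1)] K, of t t] by metis
      then show ?thesis by (intro exI[of _ B] AE_I2) simp
    qed
    then show ?thesis using tame_measurable[OF tame[OF f(1)]] by (simp add: Linf_loc_def)
  qed
  have pde: "has_bochner_integral lebesgue
              (\<lambda>x. ?pde t v x)
              0" for t v
  proof -
    have "AE x in lebesgue. ?pde t v x = 0"
      using norm_n has_weak_curl_0_weak_curl[OF open_UNIV profile_curl_free(1)[OF f(1), of t]]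
    proof eventually_elim
      case (elim x)
      have wc: "weak_curl UNIV (\<lambda>y. ?F t y) x = 0" using elim by simp
      have nn: "norm (?F t x) = \<bar>f (g x) t\<bar>" using elim by (simp add: profile_field_def)
      have "?pde t v x
           = (s x * f'' (g x) t + q x * f (g x) t + W x * \<bar>f (g x) t\<bar> powr (p - 1) * f (g x) t) * (n x \<bullet> v x)"
        unfolding wc nn by (simp add: profile_field_def inner_add_left algebra_simps)
      then show ?case by (simp add: eq)
    qed
    then show ?thesis by (rule has_bochner_integral_AE_zero)
  qed
  show "weak_solution p s q W (ereal T\<^sub>1) (ereal T\<^sub>2) (\<lambda>x t. ?F t x)"
    unfolding weak_solution_def einterval_eq
  proof (intro conjI allI ballI exI[of _ "?F''"] AE_I2 impI)
    show "ereal T\<^sub>1 < ereal T\<^sub>2" using T by simp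
    show "(\<lambda>x. ?F t x) \<in> Linf_loc" for t by (rule Linf)
    show "(\<lambda>t x. ?F t x) \<in> L2_H_curl {T\<^sub>1<..<T\<^sub>2} (ball c r)" for c r
      by (rule tame_curl_free_L2_H_curl[OF tame[OF f(1)] profile_curl_free[OF f(1)]])
    show "has_weak_dt2 {T\<^sub>1<..<T\<^sub>2} (ball c r) (\<lambda>t x. ?F t x) (?F'')" for c r
      unfolding has_weak_dt2_def using dt dt' by blast
  qed (rule pde)
qed

lemma profile_periodic_weak_solution:
  assumes T: "T > 0"
    and f: "continuous_on (range g \<times> UNIV) (\<lambda>p. f (fst p) (snd p))"
      "continuous_on (range g \<times> UNIV) (\<lambda>p. f' (fst p) (snd p))"
      "continuous_on (range g \<times> UNIV) (\<lambda>p. f'' (fst p) (snd p))"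
    and der: "\<And>y t. y \<in> range g \<Longrightarrow> (f y has_real_derivative f' y t) (at t)"
      "\<And>y t. y \<in> range g \<Longrightarrow> (f' y has_real_derivative f'' y t) (at t)"
    and eq: "\<And>x t. s x * f'' (g x) t + q x * f (g x) t + W x * \<bar>f (g x) t\<bar> powr (p - 1) * f (g x) t = 0"
    and per: "\<And>y t. y \<in> range g \<Longrightarrow> f y (t + T) = f y t"
  shows "periodic_weak_solution p s q W T (\<lambda>x t. f (g x) t *\<^sub>R n x)"
proof -
  let ?F = "profile_field g n f"
  let ?F' = "profile_field g n f'"
  note tame = tame_profile_field[OF g n_measurable norm_n_le_1]
  have per': "f' y (t + T) = f' y t" if y: "y \<in> range g" for y t
  proof -
    have "((\<lambda>t. f y (t + T)) has_real_derivative f' y (t + T) * 1) (at t)"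
      by (rule DERIV_chain2[OF der(1)[OF y]]) (auto intro!: derivative_eq_intros)
    then have "(f y has_real_derivative f' y (t + T)) (at t)" by (simp add: per[OF y])
    then show ?thesis using der(1)[OF y, of t] by (rule DERIV_unique)
  qed
  have "periodic_weak_solution_on p s q W T\<^sub>1 T\<^sub>2 (\<lambda>x t. ?F t x)" if T12: "T\<^sub>2 - T\<^sub>1 = T" for T\<^sub>1 T\<^sub>2
    unfolding periodic_weak_solution_on_def
  proof (intro conjI allI)
    have lt: "T\<^sub>1 < T\<^sub>2" and T2: "T\<^sub>2 = T\<^sub>1 + T" using T T12 by auto
    note sol = profile_weak_solution[where s=s and q=q and W=W and p=p, OF lt f der eq]
    have p0: "?F T\<^sub>2 = ?F T\<^sub>1"
      by (auto simp: profile_field_def fun_eq_iff T2 per)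
    have p1: "?F' T\<^sub>2 = ?F' T\<^sub>1"
      by (auto simp: profile_field_def fun_eq_iff T2 per')
    show "weak_solution p s q W (ereal T\<^sub>1) (ereal T\<^sub>2) (\<lambda>x t. ?F t x)" by (rule sol(1))
    fix c r
    show "\<exists>w. has_trace T\<^sub>1 T\<^sub>2 (ball c r) (\<lambda>t x. ?F t x) T\<^sub>1 w \<and>
                has_trace T\<^sub>1 T\<^sub>2 (ball c r) (\<lambda>t x. ?F t x) T\<^sub>2 w"
      using tame_has_trace[OF tame[OF f(1)], of T\<^sub>1 T\<^sub>2 c r T\<^sub>1] tame_has_trace[OF tame[OF f(1)], of T\<^sub>1 T\<^sub>2 c r T\<^sub>2] p0 by metis
    show "\<exists>Ut w. has_weak_dt {T\<^sub>1<..<T\<^sub>2} (ball c r) (\<lambda>t x. ?F t x) Ut \<and>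
                   has_trace T\<^sub>1 T\<^sub>2 (ball c r) Ut T\<^sub>1 w \<and>
                   has_trace T\<^sub>1 T\<^sub>2 (ball c r) Ut T\<^sub>2 w"
      using sol(2)[of c r] tame_has_trace[OF tame[OF f(2)], of T\<^sub>1 T\<^sub>2 c r T\<^sub>1] tame_has_trace[OF tame[OF f(2)], of T\<^sub>1 T\<^sub>2 c r T\<^sub>2] p1 by metis
  qed
  then show ?thesis unfolding periodic_weak_solution_def by (simp add: profile_field_def per)
qed

end

section \<open>Localized standing waves\<close>

lemma AE_open_ex:
  fixes S :: "'a::euclidean_space set"
  assumes "AE x in lebesgue. P x" "open S" "S \<noteq> {}" shows "\<exists>x\<in>S. P x"
proof (rule ccontr)
  assume no: "\<not> ?thesis"
  have "AE x in lebesgue. x \<notin> S" using assms(1) by eventually_elim (use no in blast)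
  then have "S \<in> null_sets lebesgue" using assms(2) by (subst AE_iff_null_sets) (auto simp: lborelD)
  then show False using open_not_negligible[OF assms(2,3)] by (simp add: negligible_iff_null_sets)
qed

text \<open>The oscillators over the range \<open>R\<close> of \<open>g\<close>, with the sign \<open>\<epsilon>\<close> of the nonlinearity. The hypothesis \<open>sign\<close>
  says that the stiffness which produces the common period has the sign of the given nonlinearity.\<close>

locale oscillator_family =
  fixes p \<omega> \<epsilon> :: real and R :: "real set" and s' q' V' :: "real \<Rightarrow> real"
  assumes p: "p > 1" and \<omega>: "0 < \<omega>"
    and coeff_pos: "\<And>y. y \<in> R \<Longrightarrow> 0 < s' y" "\<And>y. y \<in> R \<Longrightarrow> 0 < q' y" "\<And>y. y \<in> R \<Longrightarrow> 0 < V' y"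
    and coeff_cont: "continuous_on R s'" "continuous_on R q'" "continuous_on R V'"
    and sign: "\<And>y. y \<in> R \<Longrightarrow> \<epsilon> * \<bar>stiffness ((p + 1) / 2) (2 * pi * sqrt (q' y / s' y) / \<omega>)\<bar>
                 = stiffness ((p + 1) / 2) (2 * pi * sqrt (q' y / s' y) / \<omega>)"
begin

text \<open>Scaling the oscillation by \<open>amp\<close> produces the coefficient \<open>\<epsilon> V\<close>, because \<open>amp\<^sup>p\<^sup>-\<^sup>1 = (q/V) |\<beta>|\<close>. The phase \<open>\<alpha>\<close> may
  depend on \<open>y\<close>.\<close>

definition "a = (p + 1) / 2"

definition "freq y = sqrt (q' y / s' y)"
definition "\<beta> y = stiffness a (2 * pi * freq y / \<omega>)"
definition "amp y = (q' y / V' y) powr (1 / (p - 1)) * \<bar>\<beta> y\<bar> powr (1 / (p - 1))"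
definition "profile \<alpha> y t = amp y * oscillation a (\<beta> y) (freq y * (t + \<alpha> y))"
definition "profile' \<alpha> y t = amp y * freq y * oscillation' a (\<beta> y) (freq y * (t + \<alpha> y))"
definition "profile'' \<alpha> y t = - (amp y * (freq y)\<^sup>2 * restoring a (\<beta> y) (oscillation a (\<beta> y) (freq y * (t + \<alpha> y))))"

lemma a: "a > 1" "a \<ge> 1" using p by (auto simp: a_def)

lemma coeff_nonzero: "y \<in> R \<Longrightarrow> s' y \<noteq> 0" "y \<in> R \<Longrightarrow> V' y \<noteq> 0"
  using coeff_pos by force+

lemma freq_pos: "y \<in> R \<Longrightarrow> freq y > 0" using coeff_pos by (simp add: freq_def)

lemma freq_cont: "continuous_on R freq"
  unfolding freq_def[abs_def]
  by (intro continuous_intros coeff_cont) (simp add: coeff_nonzero)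

lemma target_pos: "y \<in> R \<Longrightarrow> 0 < 2 * pi * freq y / \<omega>" using freq_pos \<omega> by simp

lemma \<beta>_gt: "y \<in> R \<Longrightarrow> \<beta> y > -1"
  unfolding \<beta>_def by (rule stiffness[OF a(2) target_pos])

lemma \<beta>_period: "y \<in> R \<Longrightarrow> period a (\<beta> y) = 2 * pi * freq y / \<omega>"
  unfolding \<beta>_def by (rule stiffness[OF a(2) target_pos])

lemma \<beta>_cont: "continuous_on R \<beta>"
  unfolding \<beta>_def[abs_def]
  by (rule continuous_on_compose2[OF stiffness_continuous[OF a(2)]])
     (use \<omega> target_pos in \<open>auto intro!: continuous_intros freq_cont\<close>)

lemma \<epsilon>_\<beta>: "y \<in> R \<Longrightarrow> \<epsilon> * \<bar>\<beta> y\<bar> = \<beta> y" using sign[of y] by (simp add: \<beta>_def freq_def a_def)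

lemma amp_cont: "continuous_on R amp"
proof -
  have "continuous_on R (\<lambda>y. q' y / V' y)"
    by (intro continuous_intros coeff_cont) (simp add: coeff_nonzero)
  moreover have "q' y / V' y > 0" if "y \<in> R" for y using coeff_pos that by simp
  ultimately show ?thesis
    unfolding amp_def[abs_def] using p
    by (intro continuous_on_mult continuous_on_powr' continuous_on_const continuous_on_rabs \<beta>_cont)
       (auto simp: less_imp_le dest: less_imp_neq)
qed

lemma amp_powr:
  assumes "y \<in> R" shows "amp y powr (p - 1) = q' y / V' y * \<bar>\<beta> y\<bar>"
proof -
  have "q' y / V' y > 0" using coeff_pos assms by simp
  moreover have "amp y powr (p - 1) = (q' y / V' y) powr 1 * \<bar>\<beta> y\<bar> powr 1"
    unfolding amp_def using p by (simp only: powr_mult powr_powr powr_ge_zero) simp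
  ultimately show ?thesis using coeff_pos[OF assms] by simp
qed

lemma amp_nonneg: "amp y \<ge> 0" by (simp add: amp_def)

lemma profile_cont:
  assumes \<alpha>: "continuous_on R \<alpha>"
  shows "continuous_on (R \<times> UNIV) (\<lambda>x. profile \<alpha> (fst x) (snd x))"
    "continuous_on (R \<times> UNIV) (\<lambda>x. profile' \<alpha> (fst x) (snd x))"
    "continuous_on (R \<times> UNIV) (\<lambda>x. profile'' \<alpha> (fst x) (snd x))"
proof -
  have c: "continuous_on (R \<times> UNIV) (\<lambda>x. h (fst x))" if "continuous_on R h" for h :: "real \<Rightarrow> real"
    by (rule continuous_on_compose2[OF that]) (auto intro!: continuous_intros)
  define P where "P x = (\<beta> (fst x), freq (fst x) * (snd x + \<alpha> (fst x)))" for x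
  have P: "continuous_on (R \<times> UNIV) P"
    unfolding P_def by (intro continuous_intros c \<beta>_cont freq_cont \<alpha>)
  have PR: "P ` (R \<times> UNIV) \<subseteq> {-1<..} \<times> UNIV" using \<beta>_gt by (auto simp: P_def)
  have o: "continuous_on (R \<times> UNIV) (\<lambda>x. oscillation a (\<beta> (fst x)) (freq (fst x) * (snd x + \<alpha> (fst x))))"
    using continuous_on_compose2[OF oscillation_continuous(1)[OF a(2)] P PR] by (simp add: P_def)
  have o': "continuous_on (R \<times> UNIV) (\<lambda>x. oscillation' a (\<beta> (fst x)) (freq (fst x) * (snd x + \<alpha> (fst x))))"
    using continuous_on_compose2[OF oscillation_continuous(2)[OF a(2)] P PR] by (simp add: P_def)
  show "continuous_on (R \<times> UNIV) (\<lambda>x. profile \<alpha> (fst x) (snd x))"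
    unfolding profile_def by (intro continuous_on_mult c amp_cont o)
  show "continuous_on (R \<times> UNIV) (\<lambda>x. profile' \<alpha> (fst x) (snd x))"
    unfolding profile'_def by (intro continuous_on_mult c amp_cont freq_cont o')
  have "continuous_on (R \<times> UNIV) (\<lambda>x. restoring a (\<beta> (fst x)) (oscillation a (\<beta> (fst x)) (freq (fst x) * (snd x + \<alpha> (fst x)))))"
    unfolding restoring_def using a
    by (intro continuous_on_add continuous_on_mult continuous_on_powr' continuous_on_rabs continuous_on_const o c \<beta>_cont) auto
  then show "continuous_on (R \<times> UNIV) (\<lambda>x. profile'' \<alpha> (fst x) (snd x))"
    unfolding profile''_def
    by (intro continuous_on_minus continuous_on_mult continuous_on_power c amp_cont freq_cont)
qed

lemma profile_derivative:
  assumes y: "y \<in> R"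
  shows "(profile \<alpha> y has_real_derivative profile' \<alpha> y t) (at t)"
    "(profile' \<alpha> y has_real_derivative profile'' \<alpha> y t) (at t)"
proof -
  have inner: "((\<lambda>t. freq y * (t + \<alpha> y)) has_real_derivative freq y) (at t)"
    by (auto intro!: derivative_eq_intros)
  show "(profile \<alpha> y has_real_derivative profile' \<alpha> y t) (at t)"
    using DERIV_cmult[OF DERIV_chain2[OF oscillation_derivative[OF a(2) \<beta>_gt[OF y]] inner], of "amp y"]
    by (simp add: profile_def[abs_def] profile'_def mult_ac)
  show "(profile' \<alpha> y has_real_derivative profile'' \<alpha> y t) (at t)"
    using DERIV_cmult[OF DERIV_chain2[OF oscillation'_derivative[OF a(1) \<beta>_gt[OF y]] inner], of "amp y * freq y"]
    by (simp add: profile'_def[abs_def] profile''_def power2_eq_square mult_ac)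
qed

lemma profile_ode:
  assumes y: "y \<in> R"
  shows "s' y * profile'' \<alpha> y t + q' y * profile \<alpha> y t + (\<epsilon> * V' y) * \<bar>profile \<alpha> y t\<bar> powr (p - 1) * profile \<alpha> y t = 0"
proof -
  define z where "z = oscillation a (\<beta> y) (freq y * (t + \<alpha> y))"
  have s: "s' y * (freq y)\<^sup>2 = q' y" using coeff_pos[OF y] by (simp add: freq_def)
  have "s' y * profile'' \<alpha> y t = - (amp y * (s' y * (freq y)\<^sup>2) * restoring a (\<beta> y) z)"
    by (simp add: profile''_def z_def)
  also have "\<dots> = - (q' y * amp y * z) - q' y * amp y * \<beta> y * \<bar>z\<bar> powr (p - 1) * z"
  proof -
    have "2 * a - 2 = p - 1" by (simp add: a_def field_simps)
    then show ?thesis unfolding s restoring_def by (simp add: algebra_simps)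
  qed
  finally have 1: "s' y * profile'' \<alpha> y t = - (q' y * amp y * z) - q' y * amp y * \<beta> y * \<bar>z\<bar> powr (p - 1) * z" .
  have f: "profile \<alpha> y t = amp y * z" by (simp add: profile_def z_def)
  have "\<bar>amp y * z\<bar> powr (p - 1) = q' y / V' y * \<bar>\<beta> y\<bar> * \<bar>z\<bar> powr (p - 1)"
    using amp_nonneg[of y] by (simp add: abs_mult powr_mult amp_powr[OF y])
  then have "(\<epsilon> * V' y) * \<bar>profile \<alpha> y t\<bar> powr (p - 1) * profile \<alpha> y t
     = (V' y * (q' y / V' y)) * (\<epsilon> * \<bar>\<beta> y\<bar>) * \<bar>z\<bar> powr (p - 1) * amp y * z"
    unfolding f by simp
  also have "\<dots> = q' y * \<beta> y * \<bar>z\<bar> powr (p - 1) * amp y * z"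
    using coeff_pos[OF y] by (simp add: \<epsilon>_\<beta>[OF y])
  finally show ?thesis unfolding 1 f by (simp add: algebra_simps)
qed

lemma profile_periodic:
  assumes y: "y \<in> R" shows "profile \<alpha> y (t + 2 * pi / \<omega>) = profile \<alpha> y t"
proof -
  have "freq y * (t + 2 * pi / \<omega> + \<alpha> y) = freq y * (t + \<alpha> y) + period a (\<beta> y)"
    unfolding \<beta>_period[OF y] by (simp add: algebra_simps)
  then show ?thesis by (simp add: profile_def oscillation_add_period[OF a(2) \<beta>_gt[OF y]])
qed

lemma profile_bound: "\<bar>profile \<alpha> y t\<bar> \<le> amp y"
  using mult_left_mono[OF abs_oscillation_le_1[of a "\<beta> y" "freq y * (t + \<alpha> y)"] amp_nonneg[of y]] amp_nonneg[of y]
  by (simp add: profile_def abs_mult)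

lemma profile_nonzero:
  assumes y: "y \<in> R" and ne: "freq y \<noteq> \<omega>" shows "profile (\<lambda>y. 0) y 0 \<noteq> 0"
proof -
  have "2 * pi * freq y / \<omega> \<noteq> 2 * pi" using ne \<omega> by (simp add: field_simps)
  then have "\<beta> y \<noteq> 0" unfolding \<beta>_def by (rule stiffness_sign(3)[OF a(2) target_pos[OF y]])
  then have "amp y \<noteq> 0" using coeff_pos[OF y] by (simp add: amp_def)
  then show ?thesis by (simp add: profile_def oscillation_0[OF a(2) \<beta>_gt[OF y]])
qed

text \<open>This turns the decay of \<open>\<sigma> - \<sigma>\<^sub>\<infinity>\<close> into decay of the amplitude; here \<open>\<omega>\<close> stands for \<open>\<sigma>\<^sub>\<infinity>\<close> and \<open>m\<close> for a
  positive lower bound of \<open>\<sigma>\<close>.\<close>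

lemma amp_le:
  assumes y: "y \<in> R" and m: "0 < m" "m \<le> freq y"
  shows "amp y \<le> (q' y / V' y) powr (1 / (p - 1))
     * (a * ((\<omega> / m + 1) / m) * \<bar>freq y - \<omega>\<bar>) powr (1 / (p - 1))"
proof -
  let ?f = "freq y"
  have f: "?f > 0" using m by simp
  have "\<bar>\<beta> y\<bar> \<le> a * \<bar>(2 * pi / (2 * pi * ?f / \<omega>))\<^sup>2 - 1\<bar>"
    unfolding \<beta>_def by (rule abs_stiffness_le[OF a(2) target_pos[OF y]])
  also have "2 * pi / (2 * pi * ?f / \<omega>) = \<omega> / ?f" by simp
  also have "\<bar>(\<omega> / ?f)\<^sup>2 - 1\<bar> = \<bar>((\<omega> / ?f + 1) / ?f) * (\<omega> - ?f)\<bar>"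
    using f by (simp add: field_simps power2_eq_square)
  also have "\<dots> = ((\<omega> / ?f + 1) / ?f) * \<bar>?f - \<omega>\<bar>"
    using f \<omega> by (simp add: abs_mult abs_minus_commute)
  also have "a * (((\<omega> / ?f + 1) / ?f) * \<bar>?f - \<omega>\<bar>) \<le> a * (((\<omega> / m + 1) / m) * \<bar>?f - \<omega>\<bar>)"
    using m \<omega> a by (intro mult_left_mono mult_right_mono frac_le add_mono) auto
  finally have "\<bar>\<beta> y\<bar> \<le> a * ((\<omega> / m + 1) / m) * \<bar>?f - \<omega>\<bar>" by (simp add: mult.assoc)
  then show ?thesis unfolding amp_def using p by (intro mult_left_mono powr_mono2) auto
qed

end

lemma positive_with_positive_limit_bounded_below:
  fixes f :: "real^3 \<Rightarrow> real"
  assumes c: "continuous_on UNIV f" and pos: "\<And>x. 0 < f x" and lim: "(f \<longlongrightarrow> l) at_infinity" "0 < l"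
  obtains m where "0 < m" "\<And>x. m \<le> f x"
proof -
  have "\<forall>\<^sub>F x in at_infinity. l / 2 < f x" using lim by (intro order_tendstoD(1)) auto
  then obtain b where b: "\<And>x. b \<le> norm x \<Longrightarrow> l / 2 < f x" unfolding eventually_at_infinity by blast
  have "\<exists>x\<in>cball 0 \<bar>b\<bar>. \<forall>y\<in>cball 0 \<bar>b\<bar>. f x \<le> f y"
    by (rule continuous_attains_inf) (auto intro: continuous_on_subset[OF c])
  then obtain x0 where x0: "\<And>y. y \<in> cball 0 \<bar>b\<bar> \<Longrightarrow> f x0 \<le> f y" by blast
  have "min (l / 2) (f x0) \<le> f x" for x
  proof (cases "b \<le> norm x")
    case True then show ?thesis using b[of x] by simp
  next
    case False
    then have "x \<in> cball 0 \<bar>b\<bar>" by simp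
    then show ?thesis using x0[of x] by simp
  qed
  then show thesis using that[of "min (l / 2) (f x0)"] lim pos by simp
qed

text \<open>Both cases of the theorem at once. The decay rate of \<open>U\<close> is \<open>\<delta>/(p-1)\<close>, the amplitude being at most of order
  \<open>|\<sigma> - \<sigma>\<^sub>\<infinity>|\<^sup>1\<^sup>/\<^sup>(\<^sup>p\<^sup>-\<^sup>1\<^sup>)\<close>. The field does not vanish near a point where \<open>\<sigma> \<noteq> \<sigma>\<^sub>\<infinity>\<close> and near time \<open>0\<close>, when
  the oscillation is at its maximum.\<close>

lemma localized_standing_wave_exists:
  fixes p \<omega> \<epsilon> :: real and s q V g :: "real^3 \<Rightarrow> real" and w :: vfield and G s' q' V' :: "real \<Rightarrow> real"
  assumes grad: "gradient_profile g w G" and fam: "oscillator_family p \<omega> \<epsilon> (range g) s' q' V'"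
    and coeffs: "\<And>x. s x = s' (g x)" "\<And>x. q x = q' (g x)" "\<And>x. V x = V' (g x)"
    and lim: "((\<lambda>x. sqrt (q x / s x)) \<longlongrightarrow> \<omega>) at_infinity"
    and decay: "\<exists>\<delta>>0. bdd_above (range (\<lambda>x. \<bar>sqrt (q x / s x) - \<omega>\<bar> * exp (\<delta> * norm x)))"
    and \<tau>: "bdd_above (range (\<lambda>x. (q x / V x) powr (1 / (p - 1))))"
    and ne: "\<exists>x. sqrt (q x / s x) \<noteq> \<omega>"
  shows "\<exists>U. periodic_weak_solution p s q (\<lambda>x. \<epsilon> * V x) (2 * pi / \<omega>) U \<and>
             \<not> (AE t in lebesgue. AE x in lebesgue. U x t = 0) \<and>
             exp_localized U (\<lambda>x t. 0) \<and>
             (\<forall>a::real \<Rightarrow> real. continuous_on UNIV a \<longrightarrow>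
                   periodic_weak_solution p s q (\<lambda>x. \<epsilon> * V x) (2 * pi / \<omega>) (\<lambda>x t. U x (t + a (g x))) \<and>
                   exp_localized (\<lambda>x t. U x (t + a (g x))) (\<lambda>x t. 0))"
proof -
  interpret gp: gradient_profile g w "\<lambda>x. sgn (w x)" G by (fact grad)+ simp
  interpret osc: oscillator_family p \<omega> \<epsilon> "range g" s' q' V' by (rule fam)
  define n where "n x = sgn (w x)" for x
  define U where "U x t = osc.profile (\<lambda>y. 0) (g x) t *\<^sub>R n x" for x t
  have shift: "U x (t + \<alpha> (g x)) = osc.profile \<alpha> (g x) t *\<^sub>R n x" for x t \<alpha>
    by (simp add: U_def osc.profile_def)
  have sol: "periodic_weak_solution p s q (\<lambda>x. \<epsilon> * V x) (2 * pi / \<omega>) (\<lambda>x t. U x (t + \<alpha> (g x)))"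
    if \<alpha>: "continuous_on UNIV \<alpha>" for \<alpha>
  proof -
    have \<alpha>': "continuous_on (range g) \<alpha>" using \<alpha> by (rule continuous_on_subset) simp
    show ?thesis
      unfolding shift n_def
      by (rule gp.profile_periodic_weak_solution[OF _ osc.profile_cont[OF \<alpha>'] osc.profile_derivative])
         (use osc.\<omega> osc.profile_ode osc.profile_periodic coeffs in auto)
  qed
  have freq: "osc.freq (g x) = sqrt (q x / s x)" for x by (simp add: osc.freq_def coeffs)
  have fc: "continuous_on UNIV (\<lambda>x. osc.freq (g x))"
    by (rule continuous_on_compose2[OF osc.freq_cont gp.g]) auto
  obtain m where m: "0 < m" "\<And>x. m \<le> osc.freq (g x)"
    using positive_with_positive_limit_bounded_below[OF fc osc.freq_pos, of \<omega>] lim osc.\<omega>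
    by (auto simp: freq)
  obtain M where M: "\<And>x. (q' (g x) / V' (g x)) powr (1 / (p - 1)) \<le> M"
    using \<tau> by (auto simp: bdd_above_def coeffs)
  obtain \<delta> D where \<delta>: "\<delta> > 0" and D: "\<And>x. \<bar>osc.freq (g x) - \<omega>\<bar> * exp (\<delta> * norm x) \<le> D"
    using decay by (auto simp: bdd_above_def freq)
  define C where "C = osc.a * ((\<omega> / m + 1) / m)"
  have C: "C \<ge> 0" using osc.a m osc.\<omega> by (simp add: C_def)
  have k: "1 / (p - 1) > 0" using osc.p by simp
  have loc: "exp_localized (\<lambda>x t. U x (t + \<alpha> (g x))) (\<lambda>x t. 0)" for \<alpha>
  proof -
    have "norm (U x (t + \<alpha> (g x)) - 0) * exp (\<delta> / (p - 1) * norm x) \<le> M * (C * D) powr (1 / (p - 1))" for x t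
    proof -
      have "norm (U x (t + \<alpha> (g x))) \<le> osc.amp (g x) * 1"
        unfolding shift norm_scaleR n_def
        using osc.profile_bound[of \<alpha> "g x" t] gp.norm_n_le_1[of x] by (intro mult_mono) auto
      also have "\<dots> \<le> M * (C * \<bar>osc.freq (g x) - \<omega>\<bar>) powr (1 / (p - 1))"
        using order_trans[OF osc.amp_le[OF _ m(1) m(2)[of x]] mult_right_mono[OF M[of x]]] by (simp add: C_def)
      finally have "norm (U x (t + \<alpha> (g x))) * exp (\<delta> * norm x) powr (1 / (p - 1))
          \<le> M * (C * \<bar>osc.freq (g x) - \<omega>\<bar>) powr (1 / (p - 1)) * exp (\<delta> * norm x) powr (1 / (p - 1))"
        by (rule mult_right_mono) simp
      also have "\<dots> = M * (C * (\<bar>osc.freq (g x) - \<omega>\<bar> * exp (\<delta> * norm x))) powr (1 / (p - 1))"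
        using C by (simp add: powr_mult)
      also have "\<dots> \<le> M * (C * D) powr (1 / (p - 1))"
      proof (rule mult_left_mono[OF powr_mono2])
        show "C * (\<bar>osc.freq (g x) - \<omega>\<bar> * exp (\<delta> * norm x)) \<le> C * D" using D[of x] C by (rule mult_left_mono)
        show "0 \<le> M" using M[of x] by (rule order_trans[rotated]) simp
      qed (use k C in auto)
      also have "exp (\<delta> * norm x) powr (1 / (p - 1)) = exp (\<delta> / (p - 1) * norm x)"
        by (simp add: powr_def)
      finally show ?thesis by simp
    qed
    then show ?thesis unfolding exp_localized_def
      using \<delta> osc.p by (intro exI[of _ "\<delta> / (p - 1)"] conjI bdd_aboveI[of _ "M * (C * D) powr (1 / (p - 1))"]) auto
  qed
  have "\<not> (AE t in lebesgue. AE x in lebesgue. U x t = 0)"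
  proof
    assume *: "AE t in lebesgue. AE x in lebesgue. U x t = 0"
    obtain x0 where x0: "osc.freq (g x0) \<noteq> \<omega>" using ne by (auto simp: freq)
    define P where "P z = osc.profile (\<lambda>y. 0) (g (fst z)) (snd z)" for z :: "(real^3) \<times> real"
    have "continuous_on UNIV (\<lambda>z. (g (fst z), snd z))"
      by (intro continuous_intros continuous_on_compose2[OF gp.g]) auto
    from continuous_on_compose2[OF osc.profile_cont(1)[of "\<lambda>y. 0"] this]
    have "continuous_on UNIV P" by (auto simp: P_def[abs_def])
    moreover have "P (x0, 0) \<noteq> 0" using osc.profile_nonzero[OF _ x0] by (simp add: P_def)
    ultimately have "\<forall>\<^sub>F z in nhds (x0, 0). P z \<noteq> 0"
      by (intro tendsto_imp_eventually_ne[where c="P (x0, 0)"])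
         (auto simp: continuous_on_eq_continuous_at isCont_def tendsto_at_iff_tendsto_nhds)
    then obtain d where d: "d > 0" "\<And>z. dist z (x0, 0) < d \<Longrightarrow> P z \<noteq> 0"
      by (auto simp: eventually_nhds_metric)
    obtain t where t: "t \<in> ball 0 (d / 2)" "AE x in lebesgue. U x t = 0"
      using AE_open_ex[OF *, of "ball 0 (d / 2)"] d(1) by auto
    from t(2) gp.w_ne0 have ne0: "AE x in lebesgue. U x t = 0 \<and> w x \<noteq> 0" by eventually_elim simp
    obtain x where x: "x \<in> ball x0 (d / 2)" "U x t = 0" "w x \<noteq> 0"
      using AE_open_ex[OF ne0, of "ball x0 (d / 2)"] d(1) by auto
    have "dist (x, t) (x0, 0) \<le> dist x x0 + dist t 0"
      unfolding dist_Pair_Pair by (rule sqrt_sum_squares_le_sum) auto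
    also have "\<dots> < d" using x(1) t(1) by (simp add: dist_commute)
    finally have "P (x, t) \<noteq> 0" by (rule d(2))
    then show False using x(2,3) by (simp add: U_def P_def n_def sgn_zero_iff)
  qed
  then show ?thesis
    using sol[of "\<lambda>y. 0"] loc[of "\<lambda>y. 0"] sol loc by (intro exI[of _ U]) auto
qed

theorem theorem5:
  fixes p sigma_inf \<omega> T :: real
    and s q V g \<sigma> \<tau> :: "real^3 \<Rightarrow> real"
    and G s' q' V' :: "real \<Rightarrow> real"
  assumes p: "p > 1"
    and pos: "\<And>x. 0 < s x" "\<And>x. 0 < q x" "\<And>x. 0 < V x"
    and g: "g \<in> W11_loc UNIV" "continuous_on UNIV g"
      "AE x in lebesgue. weak_gradient UNIV g x \<noteq> 0"
    and G: "AE x in lebesgue. norm (weak_gradient UNIV g x) = G (g x)"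
      "\<And>y. y \<in> range g \<Longrightarrow> 0 < G y" "continuous_on (range g) G" "0 < (INF y\<in>range g. G y)"
    and coeffs: "\<And>x. s x = s' (g x)" "\<And>x. q x = q' (g x)" "\<And>x. V x = V' (g x)"
    and coeffs_pos: "\<And>y. y \<in> range g \<Longrightarrow> 0 < s' y" "\<And>y. y \<in> range g \<Longrightarrow> 0 < q' y"
      "\<And>y. y \<in> range g \<Longrightarrow> 0 < V' y"
    and coeffs_cont: "continuous_on (range g) s'" "continuous_on (range g) q'"
      "continuous_on (range g) V'"
    and \<sigma>: "\<And>x. \<sigma> x = sqrt (q x / s x)"
    and \<tau>: "\<And>x. \<tau> x = (q x / V x) powr (1 / (p - 1))"
    and \<sigma>_lim: "(\<sigma> \<longlongrightarrow> sigma_inf) at_infinity" "0 < sigma_inf"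
    and \<sigma>_decay: "\<exists>\<delta>>0. bdd_above (range (\<lambda>x. \<bar>\<sigma> x - sigma_inf\<bar> * exp (\<delta> * norm x)))"
    and \<tau>_bdd: "bdd_above (range \<tau>)"
    and \<omega>: "\<omega> = sigma_inf"
    and T: "T = 2 * pi / \<omega>"
  shows "((\<forall>x. \<sigma> x \<le> sigma_inf) \<and> (\<exists>x. \<sigma> x \<noteq> sigma_inf) \<longrightarrow>
           (\<exists>U. periodic_weak_solution p s q V T U \<and>
                \<not> (AE t in lebesgue. AE x in lebesgue. U x t = 0) \<and>
                exp_localized U (\<lambda>x t. 0) \<and>
                (\<forall>a::real \<Rightarrow> real. continuous_on UNIV a \<longrightarrow>
                   periodic_weak_solution p s q V T (\<lambda>x t. U x (t + a (g x))) \<and>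
                   exp_localized (\<lambda>x t. U x (t + a (g x))) (\<lambda>x t. 0))))
       \<and> ((\<forall>x. \<sigma> x \<ge> sigma_inf) \<and> (\<exists>x. \<sigma> x \<noteq> sigma_inf) \<longrightarrow>
           (\<exists>U. periodic_weak_solution p s q (\<lambda>x. - V x) T U \<and>
                \<not> (AE t in lebesgue. AE x in lebesgue. U x t = 0) \<and>
                exp_localized U (\<lambda>x t. 0) \<and>
                (\<forall>a::real \<Rightarrow> real. continuous_on UNIV a \<longrightarrow>
                   periodic_weak_solution p s q (\<lambda>x. - V x) T (\<lambda>x t. U x (t + a (g x))) \<and>
                   exp_localized (\<lambda>x t. U x (t + a (g x))) (\<lambda>x t. 0))))"
proof -
  have T\<omega>: "T = 2 * pi / sigma_inf" using T \<omega> by simp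
  have \<sigma>_fun: "\<sigma> = (\<lambda>x. sqrt (q x / s x))" using \<sigma> by blast
  have \<tau>_fun: "\<tau> = (\<lambda>x. (q x / V x) powr (1 / (p - 1)))" using \<tau> by blast
  have grad: "gradient_profile g (weak_gradient UNIV g) G"
  proof
    have "\<exists>w. has_weak_gradient UNIV g w" using g(1) by (simp add: W11_loc_def)
    then show "has_weak_gradient UNIV g (weak_gradient UNIV g)"
      unfolding weak_gradient_def by (rule someI_ex)
  qed (use g G in auto)
  have target: "\<exists>x. y = g x \<and> 2 * pi * sqrt (q' y / s' y) / sigma_inf = 2 * pi * (\<sigma> x / sigma_inf)"
    if "y \<in> range g" for y
    using that by (auto simp: \<sigma> coeffs)
  have fam: "oscillator_family p sigma_inf \<epsilon> (range g) s' q' V'"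
    if sign: "\<And>x. \<epsilon> * \<bar>stiffness ((p + 1) / 2) (2 * pi * (\<sigma> x / sigma_inf))\<bar> = stiffness ((p + 1) / 2) (2 * pi * (\<sigma> x / sigma_inf))"
    for \<epsilon>
  proof
    fix y assume "y \<in> range g"
    then obtain x where "2 * pi * sqrt (q' y / s' y) / sigma_inf = 2 * pi * (\<sigma> x / sigma_inf)"
      using target by blast
    then show "\<epsilon> * \<bar>stiffness ((p + 1) / 2) (2 * pi * sqrt (q' y / s' y) / sigma_inf)\<bar>
                 = stiffness ((p + 1) / 2) (2 * pi * sqrt (q' y / s' y) / sigma_inf)"
      using sign[of x] by (simp only:)
  qed (use p \<sigma>_lim coeffs_pos coeffs_cont in auto)
  have a: "(p + 1) / 2 \<ge> 1" using p by simp
  have \<sigma>_pos: "2 * pi * (\<sigma> x / sigma_inf) > 0" for x using pos \<sigma>_lim(2) by (simp add: \<sigma>)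
  note exists = localized_standing_wave_exists[OF grad fam coeffs \<sigma>_lim(1)[unfolded \<sigma>_fun]
      \<sigma>_decay[unfolded \<sigma>_fun] \<tau>_bdd[unfolded \<tau>_fun], folded T\<omega>]
  show ?thesis
  proof ((intro conjI impI; elim conjE), goal_cases)
    case 1
    then have le: "\<forall>x. \<sigma> x \<le> sigma_inf" and ne: "\<exists>x. \<sigma> x \<noteq> sigma_inf" by auto
    have "1 * \<bar>stiffness ((p + 1) / 2) (2 * pi * (\<sigma> x / sigma_inf))\<bar> = stiffness ((p + 1) / 2) (2 * pi * (\<sigma> x / sigma_inf))" for x
    proof -
      have "2 * pi * (\<sigma> x / sigma_inf) \<le> 2 * pi" 
        using mult_left_mono[of "\<sigma> x / sigma_inf" 1 "2 * pi"] le \<sigma>_lim(2) by simp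
      from stiffness_sign(1)[OF a \<sigma>_pos this] show ?thesis by simp
    qed
    from exists[OF this ne[unfolded \<sigma>_fun]] show ?case
      by (simp only: mult_1)
  next
    case 2
    then have ge: "\<forall>x. \<sigma> x \<ge> sigma_inf" and ne: "\<exists>x. \<sigma> x \<noteq> sigma_inf" by auto
    have "-1 * \<bar>stiffness ((p + 1) / 2) (2 * pi * (\<sigma> x / sigma_inf))\<bar> = stiffness ((p + 1) / 2) (2 * pi * (\<sigma> x / sigma_inf))" for x
    proof -
      have "2 * pi \<le> 2 * pi * (\<sigma> x / sigma_inf)" 
        using mult_left_mono[of 1 "\<sigma> x / sigma_inf" "2 * pi"] ge \<sigma>_lim(2) by simp
      from stiffness_sign(2)[OF a \<sigma>_pos this] show ?thesis by simp
    qed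
    from exists[OF this ne[unfolded \<sigma>_fun]] show ?case
      by (simp only: mult_minus1)
  qed
qed

end
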